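(* Let $\Lambda$ be an action operad in $\mathbf{Sets}$. Then the 2-monad $\underline{E\Lambda}$ on $\mathbf{Cat}$ is (2-)cartesian.
   Context: $\mathbb N\ni 0$; permutations compose as functions. A (non-symmetric) operad $O$ in sets: sets $O(n)$ ($n\in\mathbb N$), $\mathrm{id}\in O(1)$, functions $\mu:O(n)\times O(k_1)\times\cdots\times O(k_n)\to O(k_1+\cdots+k_n)$, unital and associative in the usual sense; maps preserve $\mathrm{id}$ and $\mu$. The operad $\Sigma$ of symmetric groups has $\mu(\sigma;\tau_1,\dots,\tau_n)=\delta(\sigma)\cdot\beta(\tau_1,\dots,\tau_n)$, with $\beta$ the block sum of the permutations $\tau_i\in\Sigma_{k_i}$ and $\delta(\sigma)=\delta_{n;k_1,\dots,k_n}(\sigma)$ sending $k_1+\cdots+k_{i-1}+a$ ($1\le a\le k_i$) to $(\sum_{\sigma(i')<\sigma(i)}k_{i'})+a$. An action operad $(\Lambda,\pi)$: an operad $\Lambda$ in sets with a group structure on each $\Lambda(n)$ and a map of operads $\pi:\Lambda\to\Sigma$ whose components are group homomorphisms, such that, writing $g(i)=\pi_n(g)(i)$ and $g^{-1}(i)=\pi_n(g)^{-1}(i)$, $\mu(g';f_1',\dots,f_n')\mu(g;f_1,\dots,f_n)=\mu(g'g;f'_{g(1)}f_1,\dots,f'_{g(n)}f_n)$ for $g,g'\in\Lambda(n)$, $f_i\in\Lambda(k_i)$, $f_i'\in\Lambda(k_{g^{-1}(i)})$. $E\Lambda$ is the operad in $\mathbf{Cat}$ where $E\Lambda(n)$ is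 the category with object set $\Lambda(n)$ and exactly one morphism between any two objects, with operad structure given on objects by that of $\Lambda$ and right $\Lambda(n)$-action by right multiplication. $\underline{E\Lambda}(X)=\coprod_nE\Lambda(n)\otimes_{\Lambda(n)}X^n$, where $\Lambda(n)$ acts on $X^n$ by $g\cdot(x_1,\dots,x_n)=(x_{g^{-1}(1)},\dots,x_{g^{-1}(n)})$ and $E\Lambda(n)\otimes_{\Lambda(n)}X^n$ is the coequalizer in $\mathbf{Cat}$ of $(p,g,\underline x)\mapsto(p\cdot g,\underline x)$ and $(p,g,\underline x)\mapsto(p,g\cdot\underline x)$; unit $x\mapsto[\mathrm{id};x]$; multiplication $[p;[q_1;\underline{x_1}],\dots,[q_n;\underline{x_n}]]\mapsto[\mu(p;q_1,\dots,q_n);\underline{x_1},\dots,\underline{x_n}]$. A 2-monad $T$ on a 2-category with 2-pullbacks is 2-cartesian if $T$ preserves 2-pullbacks up to isomorphism and all naturality squares of the unit and multiplication are 2-pullbacks; in $\mathbf{Cat}$, 2-pullbacks coincide with ordinary (strict) pullbacks. *)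

theory Defs
  imports "HOL-Algebra.Group" "HOL-Combinatorics.Permutations"
begin

section \<open>Categories, functors, natural transformations\<close>

record ('o, 'm) cat =
  Ob :: "'o set"
  Ar :: "'m set"
  src :: "'m \<Rightarrow> 'o"
  tgt :: "'m \<Rightarrow> 'o"
  ident :: "'o \<Rightarrow> 'm"
  cmp :: "'m \<Rightarrow> 'm \<Rightarrow> 'm"

text \<open>\<open>cmp A v u\<close> is the composite of \<open>u\<close> followed by \<open>v\<close>.\<close>

definition category :: "('o, 'm) cat \<Rightarrow> bool" where
  "category A \<longleftrightarrow>
     (\<forall>u\<in>Ar A. src A u \<in> Ob A \<and> tgt A u \<in> Ob A) \<and>
     (\<forall>x\<in>Ob A. ident A x \<in> Ar A \<and> src A (ident A x) = x \<and> tgt A (ident A x) = x) \<and>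
     (\<forall>u\<in>Ar A. \<forall>v\<in>Ar A. src A v = tgt A u \<longrightarrow>
        cmp A v u \<in> Ar A \<and> src A (cmp A v u) = src A u \<and> tgt A (cmp A v u) = tgt A v) \<and>
     (\<forall>u\<in>Ar A. cmp A u (ident A (src A u)) = u \<and> cmp A (ident A (tgt A u)) u = u) \<and>
     (\<forall>u\<in>Ar A. \<forall>v\<in>Ar A. \<forall>w\<in>Ar A. src A v = tgt A u \<longrightarrow> src A w = tgt A v \<longrightarrow>
        cmp A w (cmp A v u) = cmp A (cmp A w v) u)"

record ('o, 'm, 'o2, 'm2) ftor =
  fob :: "'o \<Rightarrow> 'o2"
  far :: "'m \<Rightarrow> 'm2"

definition is_functor :: "('o, 'm) cat \<Rightarrow> ('o2, 'm2) cat \<Rightarrow> ('o, 'm, 'o2, 'm2) ftor \<Rightarrow> bool" where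
  "is_functor A B F \<longleftrightarrow>
     (\<forall>x\<in>Ob A. fob F x \<in> Ob B \<and> far F (ident A x) = ident B (fob F x)) \<and>
     (\<forall>u\<in>Ar A. far F u \<in> Ar B \<and> src B (far F u) = fob F (src A u)
                              \<and> tgt B (far F u) = fob F (tgt A u)) \<and>
     (\<forall>u\<in>Ar A. \<forall>v\<in>Ar A. src A v = tgt A u \<longrightarrow> far F (cmp A v u) = cmp B (far F v) (far F u))"

text \<open>Functors are pairs of total HOL functions, so equality of functors out of \<open>A\<close> is agreement
  on the objects and arrows of \<open>A\<close>.\<close>

definition feq :: "('o, 'm) cat \<Rightarrow> ('o, 'm, 'o2, 'm2) ftor \<Rightarrow> ('o, 'm, 'o2, 'm2) ftor \<Rightarrow> bool" where
  "feq A F G \<longleftrightarrow> (\<forall>x\<in>Ob A. fob F x = fob G x) \<and> (\<forall>u\<in>Ar A. far F u = far G u)"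

definition fcomp ::
  "('o2, 'm2, 'o3, 'm3) ftor \<Rightarrow> ('o, 'm, 'o2, 'm2) ftor \<Rightarrow> ('o, 'm, 'o3, 'm3) ftor" (infixr "\<circ>\<circ>" 55)
  where "G \<circ>\<circ> F = \<lparr>fob = fob G \<circ> fob F, far = far G \<circ> far F\<rparr>"

definition nat_trans ::
  "('o, 'm) cat \<Rightarrow> ('o2, 'm2) cat \<Rightarrow> ('o, 'm, 'o2, 'm2) ftor \<Rightarrow> ('o, 'm, 'o2, 'm2) ftor
     \<Rightarrow> ('o \<Rightarrow> 'm2) \<Rightarrow> bool" where
  "nat_trans A B F G \<alpha> \<longleftrightarrow>
     (\<forall>x\<in>Ob A. \<alpha> x \<in> Ar B \<and> src B (\<alpha> x) = fob F x \<and> tgt B (\<alpha> x) = fob G x) \<and>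
     (\<forall>u\<in>Ar A. cmp B (\<alpha> (tgt A u)) (far F u) = cmp B (far G u) (\<alpha> (src A u)))"


section \<open>2-pullbacks and coequalizers in Cat\<close>

text \<open>A strictly commuting square \<open>f p = g q\<close> of functors is a 2-pullback if for every category \<open>W\<close>
  the induced functor from \<open>Cat(W,P)\<close> to the strict pullback of \<open>Cat(W,A)\<close> and \<open>Cat(W,B)\<close> over
  \<open>Cat(W,C)\<close> is an isomorphism, i.e. bijective on functors (1-cells) and on natural
  transformations (2-cells). HOL cannot quantify over types inside a definition, so the types of
  objects and arrows of the test categories \<open>W\<close> are a parameter of \<open>two_pullback\<close>; by
  \<open>two_pullback_all_test_types\<close> below, test categories in \<open>nat\<close> already give the universal
  property for test categories in arbitrary types.\<close>

definition commuting_square ::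
  "('po, 'pm) cat \<Rightarrow> ('ao, 'am) cat \<Rightarrow> ('bo, 'bm) cat \<Rightarrow> ('co, 'cm) cat
     \<Rightarrow> ('po, 'pm, 'ao, 'am) ftor \<Rightarrow> ('po, 'pm, 'bo, 'bm) ftor
     \<Rightarrow> ('ao, 'am, 'co, 'cm) ftor \<Rightarrow> ('bo, 'bm, 'co, 'cm) ftor \<Rightarrow> bool" where
  "commuting_square P A B C p q f g \<longleftrightarrow>
     category P \<and> category A \<and> category B \<and> category C \<and>
     is_functor P A p \<and> is_functor P B q \<and> is_functor A C f \<and> is_functor B C g \<and>
     feq P (f \<circ>\<circ> p) (g \<circ>\<circ> q)"

definition two_pullback_property ::
  "('w, 'v) cat \<Rightarrow> ('po, 'pm) cat \<Rightarrow> ('ao, 'am) cat \<Rightarrow> ('bo, 'bm) cat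
     \<Rightarrow> ('po, 'pm, 'ao, 'am) ftor \<Rightarrow> ('po, 'pm, 'bo, 'bm) ftor
     \<Rightarrow> ('ao, 'am, 'co, 'cm) ftor \<Rightarrow> ('bo, 'bm, 'co, 'cm) ftor \<Rightarrow> bool" where
  "two_pullback_property W P A B p q f g \<longleftrightarrow>
       (\<forall>H K. is_functor W A H \<and> is_functor W B K \<and> feq W (f \<circ>\<circ> H) (g \<circ>\<circ> K) \<longrightarrow>
          (\<exists>L. is_functor W P L \<and> feq W (p \<circ>\<circ> L) H \<and> feq W (q \<circ>\<circ> L) K \<and>
             (\<forall>L'. is_functor W P L' \<and> feq W (p \<circ>\<circ> L') H \<and> feq W (q \<circ>\<circ> L') K \<longrightarrow> feq W L' L))) \<and>
       (\<forall>L L' \<alpha> \<beta>. is_functor W P L \<and> is_functor W P L' \<and>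
          nat_trans W A (p \<circ>\<circ> L) (p \<circ>\<circ> L') \<alpha> \<and> nat_trans W B (q \<circ>\<circ> L) (q \<circ>\<circ> L') \<beta> \<and>
          (\<forall>x\<in>Ob W. far f (\<alpha> x) = far g (\<beta> x)) \<longrightarrow>
          (\<exists>\<gamma>. nat_trans W P L L' \<gamma> \<and> (\<forall>x\<in>Ob W. far p (\<gamma> x) = \<alpha> x \<and> far q (\<gamma> x) = \<beta> x) \<and>
             (\<forall>\<gamma>'. nat_trans W P L L' \<gamma>' \<and> (\<forall>x\<in>Ob W. far p (\<gamma>' x) = \<alpha> x \<and> far q (\<gamma>' x) = \<beta> x)
                \<longrightarrow> (\<forall>x\<in>Ob W. \<gamma>' x = \<gamma> x))))"

definition two_pullback ::
  "('w, 'v) cat itself \<Rightarrow> ('po, 'pm) cat \<Rightarrow> ('ao, 'am) cat \<Rightarrow> ('bo, 'bm) cat \<Rightarrow> ('co, 'cm) cat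
     \<Rightarrow> ('po, 'pm, 'ao, 'am) ftor \<Rightarrow> ('po, 'pm, 'bo, 'bm) ftor
     \<Rightarrow> ('ao, 'am, 'co, 'cm) ftor \<Rightarrow> ('bo, 'bm, 'co, 'cm) ftor \<Rightarrow> bool" where
  "two_pullback test_type P A B C p q f g \<longleftrightarrow>
     commuting_square P A B C p q f g \<and>
     (\<forall>W :: ('w, 'v) cat. category W \<longrightarrow> two_pullback_property W P A B p q f g)"

definition terminal_cat :: "(nat, nat) cat" where
  "terminal_cat = \<lparr>Ob = {0}, Ar = {0}, src = id, tgt = id, ident = id, cmp = \<lambda>v u. u\<rparr>"

definition arrow_cat :: "(nat, nat) cat" where
  "arrow_cat = \<lparr>Ob = {0, 1}, Ar = {0, 1, 2}, src = \<lambda>m. if m = 1 then 1 else 0,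
     tgt = \<lambda>m. if m = 0 then 0 else 1, ident = id, cmp = \<lambda>v u. if v = u then u else 2\<rparr>"

definition pick_ob :: "('o, 'm) cat \<Rightarrow> 'o \<Rightarrow> (nat, nat, 'o, 'm) ftor" where
  "pick_ob A x = \<lparr>fob = \<lambda>_. x, far = \<lambda>_. ident A x\<rparr>"

definition pick_ar :: "('o, 'm) cat \<Rightarrow> 'm \<Rightarrow> (nat, nat, 'o, 'm) ftor" where
  "pick_ar A u = \<lparr>fob = \<lambda>i. if i = 0 then src A u else tgt A u,
     far = \<lambda>i. if i = 0 then ident A (src A u) else if i = 1 then ident A (tgt A u) else u\<rparr>"

lemma category_terminal_cat: "category terminal_cat"
  by (auto simp: terminal_cat_def category_def)

lemma category_arrow_cat: "category arrow_cat"
  by (simp add: arrow_cat_def category_def)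

lemma category_ident_ident: "category A \<Longrightarrow> x \<in> Ob A \<Longrightarrow> cmp A (ident A x) (ident A x) = ident A x"
  unfolding category_def by metis

lemma functor_pick_ob: "category A \<Longrightarrow> x \<in> Ob A \<Longrightarrow> is_functor terminal_cat A (pick_ob A x)"
  using category_ident_ident[of A x]
  by (auto simp: terminal_cat_def is_functor_def pick_ob_def category_def)

lemma functor_pick_ar: "category A \<Longrightarrow> u \<in> Ar A \<Longrightarrow> is_functor arrow_cat A (pick_ar A u)"
  using category_ident_ident[of A "src A u"] category_ident_ident[of A "tgt A u"]
  by (auto simp: arrow_cat_def is_functor_def pick_ar_def category_def)

lemma functor_fcomp: "is_functor A B F \<Longrightarrow> is_functor B C G \<Longrightarrow> is_functor A C (G \<circ>\<circ> F)"
  by (simp add: is_functor_def fcomp_def)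

lemma fcomp_sel [simp]: "fob (G \<circ>\<circ> F) = fob G \<circ> fob F" "far (G \<circ>\<circ> F) = far G \<circ> far F"
  by (simp_all add: fcomp_def)

lemma feq_pick_ar:
  "category A \<Longrightarrow> is_functor A B F \<Longrightarrow> u \<in> Ar A \<Longrightarrow>
   feq arrow_cat (F \<circ>\<circ> pick_ar A u) (pick_ar B (far F u))"
  by (auto simp: category_def is_functor_def feq_def arrow_cat_def pick_ar_def)

lemma feq_pick_ob:
  "category A \<Longrightarrow> is_functor A B F \<Longrightarrow> x \<in> Ob A \<Longrightarrow>
   feq terminal_cat (F \<circ>\<circ> pick_ob A x) (pick_ob B (fob F x))"
  by (auto simp: category_def is_functor_def feq_def terminal_cat_def pick_ob_def)

lemma feq_sym: "feq A F G \<Longrightarrow> feq A G F" by (simp add: feq_def)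
lemma feq_trans: "feq A F G \<Longrightarrow> feq A G H \<Longrightarrow> feq A F H" by (simp add: feq_def)

definition pointwise_pullback ::
  "('po, 'pm) cat \<Rightarrow> ('ao, 'am) cat \<Rightarrow> ('bo, 'bm) cat
     \<Rightarrow> ('po, 'pm, 'ao, 'am) ftor \<Rightarrow> ('po, 'pm, 'bo, 'bm) ftor
     \<Rightarrow> ('ao, 'am, 'co, 'cm) ftor \<Rightarrow> ('bo, 'bm, 'co, 'cm) ftor \<Rightarrow> bool" where
  "pointwise_pullback P A B p q f g \<longleftrightarrow>
     (\<forall>x\<in>Ob A. \<forall>y\<in>Ob B. fob f x = fob g y \<longrightarrow> (\<exists>!z. z \<in> Ob P \<and> fob p z = x \<and> fob q z = y)) \<and>
     (\<forall>u\<in>Ar A. \<forall>v\<in>Ar B. far f u = far g v \<longrightarrow> (\<exists>!w. w \<in> Ar P \<and> far p w = u \<and> far q w = v))"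

lemma pointwise_of_nat:
  assumes sq: "commuting_square P A B C p q f g"
    and W: "\<And>W :: (nat, nat) cat. category W \<Longrightarrow> two_pullback_property W P A B p q f g"
  shows "pointwise_pullback P A B p q f g"
proof -
  have cat: "category P" "category A" "category B" "category C"
    and fn: "is_functor P A p" "is_functor P B q" "is_functor A C f" "is_functor B C g"
    using sq by (auto simp: commuting_square_def)
  show ?thesis unfolding pointwise_pullback_def
  proof (intro conjI ballI impI)
    fix x y assume xy: "x \<in> Ob A" "y \<in> Ob B" "fob f x = fob g y"
    have "feq terminal_cat (f \<circ>\<circ> pick_ob A x) (g \<circ>\<circ> pick_ob B y)"
      using feq_pick_ob[OF cat(2) fn(3) xy(1)] feq_pick_ob[OF cat(3) fn(4) xy(2)] xy(3)
      by (metis feq_sym feq_trans)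
    then obtain L where L: "is_functor terminal_cat P L" "feq terminal_cat (p \<circ>\<circ> L) (pick_ob A x)"
      "feq terminal_cat (q \<circ>\<circ> L) (pick_ob B y)"
      and U: "\<And>L'. is_functor terminal_cat P L' \<Longrightarrow> feq terminal_cat (p \<circ>\<circ> L') (pick_ob A x) \<Longrightarrow>
         feq terminal_cat (q \<circ>\<circ> L') (pick_ob B y) \<Longrightarrow> feq terminal_cat L' L"
      using W[OF category_terminal_cat] functor_pick_ob[OF cat(2) xy(1)] functor_pick_ob[OF cat(3) xy(2)]
      unfolding two_pullback_property_def by metis
    show "\<exists>!z. z \<in> Ob P \<and> fob p z = x \<and> fob q z = y"
    proof (rule ex1I[of _ "fob L 0"])
      show "fob L 0 \<in> Ob P \<and> fob p (fob L 0) = x \<and> fob q (fob L 0) = y"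
        using L by (auto simp: is_functor_def feq_def terminal_cat_def pick_ob_def)
      fix z assume z: "z \<in> Ob P \<and> fob p z = x \<and> fob q z = y"
      then have "feq terminal_cat (pick_ob P z) L"
        using U[OF functor_pick_ob[OF cat(1)]] feq_pick_ob[OF cat(1) fn(1)] feq_pick_ob[OF cat(1) fn(2)]
        by blast
      then show "z = fob L 0" by (simp add: feq_def terminal_cat_def pick_ob_def)
    qed
  next
    fix u v assume uv: "u \<in> Ar A" "v \<in> Ar B" "far f u = far g v"
    have "feq arrow_cat (f \<circ>\<circ> pick_ar A u) (g \<circ>\<circ> pick_ar B v)"
      using feq_pick_ar[OF cat(2) fn(3) uv(1)] feq_pick_ar[OF cat(3) fn(4) uv(2)] uv(3)
      by (metis feq_sym feq_trans)
    then obtain L where L: "is_functor arrow_cat P L" "feq arrow_cat (p \<circ>\<circ> L) (pick_ar A u)"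
      "feq arrow_cat (q \<circ>\<circ> L) (pick_ar B v)"
      and U: "\<And>L'. is_functor arrow_cat P L' \<Longrightarrow> feq arrow_cat (p \<circ>\<circ> L') (pick_ar A u) \<Longrightarrow>
         feq arrow_cat (q \<circ>\<circ> L') (pick_ar B v) \<Longrightarrow> feq arrow_cat L' L"
      using W[OF category_arrow_cat] functor_pick_ar[OF cat(2) uv(1)] functor_pick_ar[OF cat(3) uv(2)]
      unfolding two_pullback_property_def by metis
    show "\<exists>!w. w \<in> Ar P \<and> far p w = u \<and> far q w = v"
    proof (rule ex1I[of _ "far L 2"])
      show "far L 2 \<in> Ar P \<and> far p (far L 2) = u \<and> far q (far L 2) = v"
        using L by (auto simp: is_functor_def feq_def arrow_cat_def pick_ar_def)
      fix w assume w: "w \<in> Ar P \<and> far p w = u \<and> far q w = v"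
      then have "feq arrow_cat (pick_ar P w) L"
        using U[OF functor_pick_ar[OF cat(1)]] feq_pick_ar[OF cat(1) fn(1)] feq_pick_ar[OF cat(1) fn(2)]
        by blast
      then show "w = far L 2" by (simp add: feq_def arrow_cat_def pick_ar_def)
    qed
  qed
qed

lemma property_of_pointwise:
  assumes sq: "commuting_square P A B C p q f g" and pw: "pointwise_pullback P A B p q f g" and W: "category W"
  shows "two_pullback_property W P A B p q f g"
proof -
  have cat: "category P" "category A" "category B" "category C"
    and fn: "is_functor P A p" "is_functor P B q" "is_functor A C f" "is_functor B C g"
    using sq by (auto simp: commuting_square_def)
  have comm_ob: "fob f (fob p x) = fob g (fob q x)" if "x \<in> Ob P" for x
    using sq that by (auto simp: commuting_square_def feq_def)
  have comm_ar: "far f (far p x) = far g (far q x)" if "x \<in> Ar P" for x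
    using sq that by (auto simp: commuting_square_def feq_def)
  have uo: "z = z'" if "z \<in> Ob P" "z' \<in> Ob P" "fob p z = fob p z'" "fob q z = fob q z'" for z z'
  proof -
    have "fob p z' \<in> Ob A" "fob q z' \<in> Ob B" using fn that by (auto simp: is_functor_def)
    then show ?thesis using pw comm_ob[OF that(2)] that unfolding pointwise_pullback_def by blast
  qed
  have ua: "z = z'" if "z \<in> Ar P" "z' \<in> Ar P" "far p z = far p z'" "far q z = far q z'" for z z'
  proof -
    have "far p z' \<in> Ar A" "far q z' \<in> Ar B" using fn that by (auto simp: is_functor_def)
    then show ?thesis using pw comm_ar[OF that(2)] that unfolding pointwise_pullback_def by blast
  qed
  have P1: "src P u \<in> Ob P" "tgt P u \<in> Ob P" if "u \<in> Ar P" for u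
    using cat(1) that by (auto simp: category_def)
  have P2: "ident P x \<in> Ar P" "src P (ident P x) = x" "tgt P (ident P x) = x" if "x \<in> Ob P" for x
    using cat(1) that by (auto simp: category_def)
  have P3: "cmp P v u \<in> Ar P" "src P (cmp P v u) = src P u" "tgt P (cmp P v u) = tgt P v"
    if "u \<in> Ar P" "v \<in> Ar P" "src P v = tgt P u" for u v
    using cat(1) that unfolding category_def by metis+
  have W1: "src W u \<in> Ob W" "tgt W u \<in> Ob W" if "u \<in> Ar W" for u
    using W that by (auto simp: category_def)
  have W2: "ident W x \<in> Ar W" "src W (ident W x) = x" "tgt W (ident W x) = x" if "x \<in> Ob W" for x
    using W that by (auto simp: category_def)
  have W3: "cmp W v u \<in> Ar W" "src W (cmp W v u) = src W u" "tgt W (cmp W v u) = tgt W v"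
    if "u \<in> Ar W" "v \<in> Ar W" "src W v = tgt W u" for u v
    using W that unfolding category_def by metis+
  have F1: "fob p z \<in> Ob A" "far p (ident P z) = ident A (fob p z)"
      "fob q z \<in> Ob B" "far q (ident P z) = ident B (fob q z)" if "z \<in> Ob P" for z
    using fn that by (auto simp: is_functor_def)
  have F2: "far p u \<in> Ar A" "src A (far p u) = fob p (src P u)" "tgt A (far p u) = fob p (tgt P u)"
      "far q u \<in> Ar B" "src B (far q u) = fob q (src P u)" "tgt B (far q u) = fob q (tgt P u)"
      if "u \<in> Ar P" for u
    using fn that by (auto simp: is_functor_def)
  have F3: "far p (cmp P v u) = cmp A (far p v) (far p u)" "far q (cmp P v u) = cmp B (far q v) (far q u)"
      if "u \<in> Ar P" "v \<in> Ar P" "src P v = tgt P u" for u v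
    using fn that by (auto simp: is_functor_def)
  show ?thesis unfolding two_pullback_property_def
  proof (intro conjI allI impI; elim conjE)
    fix H K assume H: "is_functor W A H" and K: "is_functor W B K" and e: "feq W (f \<circ>\<circ> H) (g \<circ>\<circ> K)"
    have "\<forall>x\<in>Ob W. \<exists>z. z \<in> Ob P \<and> fob p z = fob H x \<and> fob q z = fob K x"
    proof
      fix x assume x: "x \<in> Ob W"
      then have "fob H x \<in> Ob A" "fob K x \<in> Ob B" "fob f (fob H x) = fob g (fob K x)"
        using H K e by (auto simp: is_functor_def feq_def)
      then show "\<exists>z. z \<in> Ob P \<and> fob p z = fob H x \<and> fob q z = fob K x"
        using pw unfolding pointwise_pullback_def by blast
    qed
    then obtain lo where lo: "\<And>x. x \<in> Ob W \<Longrightarrow> lo x \<in> Ob P"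
      "\<And>x. x \<in> Ob W \<Longrightarrow> fob p (lo x) = fob H x" "\<And>x. x \<in> Ob W \<Longrightarrow> fob q (lo x) = fob K x"
      by metis
    have "\<forall>x\<in>Ar W. \<exists>z. z \<in> Ar P \<and> far p z = far H x \<and> far q z = far K x"
    proof
      fix x assume x: "x \<in> Ar W"
      then have "far H x \<in> Ar A" "far K x \<in> Ar B" "far f (far H x) = far g (far K x)"
        using H K e by (auto simp: is_functor_def feq_def)
      then show "\<exists>z. z \<in> Ar P \<and> far p z = far H x \<and> far q z = far K x"
        using pw unfolding pointwise_pullback_def by blast
    qed
    then obtain la where la: "\<And>x. x \<in> Ar W \<Longrightarrow> la x \<in> Ar P"
      "\<And>x. x \<in> Ar W \<Longrightarrow> far p (la x) = far H x" "\<And>x. x \<in> Ar W \<Longrightarrow> far q (la x) = far K x"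
      by metis
    let ?L = "\<lparr>fob = lo, far = la\<rparr>"
    have H': "src A (far H u) = fob H (src W u)" "tgt A (far H u) = fob H (tgt W u)"
       "src B (far K u) = fob K (src W u)" "tgt B (far K u) = fob K (tgt W u)" if "u \<in> Ar W" for u
       using H K that by (auto simp: is_functor_def)
    have st: "src P (la u) = lo (src W u)" "tgt P (la u) = lo (tgt W u)" if u: "u \<in> Ar W" for u
      using u by (auto intro!: uo simp: P1 W1 la lo H' simp flip: F2)
    have id: "la (ident W x) = ident P (lo x)" if x: "x \<in> Ob W" for x
    proof (rule ua)
      have "far H (ident W x) = ident A (fob H x)" "far K (ident W x) = ident B (fob K x)"
        using H K x by (auto simp: is_functor_def)
      then show "far p (la (ident W x)) = far p (ident P (lo x))"
        "far q (la (ident W x)) = far q (ident P (lo x))"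
        using x by (simp_all add: la lo W2 F1)
    qed (use x in \<open>auto simp: la lo W2 P2\<close>)
    have co: "la (cmp W v u) = cmp P (la v) (la u)" if uv: "u \<in> Ar W" "v \<in> Ar W" "src W v = tgt W u" for u v
    proof (rule ua)
      have s: "src P (la v) = tgt P (la u)" using uv st by simp
      have "far H (cmp W v u) = cmp A (far H v) (far H u)" "far K (cmp W v u) = cmp B (far K v) (far K u)"
        using H K uv by (auto simp: is_functor_def)
      then show "far p (la (cmp W v u)) = far p (cmp P (la v) (la u))"
        "far q (la (cmp W v u)) = far q (cmp P (la v) (la u))"
        using uv s by (simp_all add: la W3 F3)
      show "cmp P (la v) (la u) \<in> Ar P" using uv s by (simp add: la P3)
    qed (use uv in \<open>auto simp: la W3\<close>)
    have fL: "is_functor W P ?L" using st id co lo la by (auto simp: is_functor_def)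
    show "\<exists>L. is_functor W P L \<and> feq W (p \<circ>\<circ> L) H \<and> feq W (q \<circ>\<circ> L) K \<and>
             (\<forall>L'. is_functor W P L' \<and> feq W (p \<circ>\<circ> L') H \<and> feq W (q \<circ>\<circ> L') K \<longrightarrow> feq W L' L)"
    proof (intro exI[of _ ?L] conjI allI impI; (elim conjE)?)
      fix L' assume L': "is_functor W P L'" "feq W (p \<circ>\<circ> L') H" "feq W (q \<circ>\<circ> L') K"
      show "feq W L' ?L" unfolding feq_def
        using L' by (auto simp: feq_def is_functor_def la lo intro!: uo ua)
    qed (use fL in \<open>auto simp: feq_def lo la\<close>)
  next
    fix L L' \<alpha> \<beta> assume L: "is_functor W P L" "is_functor W P L'"
      and \<alpha>: "nat_trans W A (p \<circ>\<circ> L) (p \<circ>\<circ> L') \<alpha>" and \<beta>: "nat_trans W B (q \<circ>\<circ> L) (q \<circ>\<circ> L') \<beta>"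
      and e: "\<forall>x\<in>Ob W. far f (\<alpha> x) = far g (\<beta> x)"
    have "\<forall>x\<in>Ob W. \<exists>z. z \<in> Ar P \<and> far p z = \<alpha> x \<and> far q z = \<beta> x"
    proof
      fix x assume x: "x \<in> Ob W"
      then have "\<alpha> x \<in> Ar A" "\<beta> x \<in> Ar B" "far f (\<alpha> x) = far g (\<beta> x)"
        using \<alpha> \<beta> e by (auto simp: nat_trans_def)
      then show "\<exists>z. z \<in> Ar P \<and> far p z = \<alpha> x \<and> far q z = \<beta> x"
        using pw unfolding pointwise_pullback_def by blast
    qed
    then obtain \<gamma> where \<gamma>: "\<And>x. x \<in> Ob W \<Longrightarrow> \<gamma> x \<in> Ar P"
      "\<And>x. x \<in> Ob W \<Longrightarrow> far p (\<gamma> x) = \<alpha> x" "\<And>x. x \<in> Ob W \<Longrightarrow> far q (\<gamma> x) = \<beta> x"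
      by metis
    have ab: "src A (\<alpha> x) = fob p (fob L x)" "tgt A (\<alpha> x) = fob p (fob L' x)"
        "src B (\<beta> x) = fob q (fob L x)" "tgt B (\<beta> x) = fob q (fob L' x)" if "x \<in> Ob W" for x
      using \<alpha> \<beta> that by (auto simp: nat_trans_def)
    have Lo: "fob L x \<in> Ob P" "fob L' x \<in> Ob P" if "x \<in> Ob W" for x
      using L that by (auto simp: is_functor_def)
    have La: "far L x \<in> Ar P" "far L' x \<in> Ar P" "src P (far L x) = fob L (src W x)"
      "tgt P (far L x) = fob L (tgt W x)" "src P (far L' x) = fob L' (src W x)"
      "tgt P (far L' x) = fob L' (tgt W x)" if "x \<in> Ar W" for x
      using L that by (auto simp: is_functor_def)
    have st: "src P (\<gamma> x) = fob L x" "tgt P (\<gamma> x) = fob L' x" if x: "x \<in> Ob W" for x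
      using x by (auto intro!: uo simp: P1 \<gamma> Lo ab simp flip: F2)
    have nt: "cmp P (\<gamma> (tgt W u)) (far L u) = cmp P (far L' u) (\<gamma> (src W u))" if u: "u \<in> Ar W" for u
    proof (rule ua)
      have s: "src P (\<gamma> (tgt W u)) = tgt P (far L u)" "src P (far L' u) = tgt P (\<gamma> (src W u))"
        using u by (simp_all add: st W1 La)
      have "cmp A (\<alpha> (tgt W u)) (far p (far L u)) = cmp A (far p (far L' u)) (\<alpha> (src W u))"
        "cmp B (\<beta> (tgt W u)) (far q (far L u)) = cmp B (far q (far L' u)) (\<beta> (src W u))"
        using \<alpha> \<beta> u by (auto simp: nat_trans_def)
      then show "far p (cmp P (\<gamma> (tgt W u)) (far L u)) = far p (cmp P (far L' u) (\<gamma> (src W u)))"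
        "far q (cmp P (\<gamma> (tgt W u)) (far L u)) = far q (cmp P (far L' u) (\<gamma> (src W u)))"
        using s u by (simp_all add: F3 La \<gamma> W1)
      show "cmp P (\<gamma> (tgt W u)) (far L u) \<in> Ar P" "cmp P (far L' u) (\<gamma> (src W u)) \<in> Ar P"
        using s u by (simp_all add: P3 La \<gamma> W1)
    qed
    show "\<exists>\<gamma>. nat_trans W P L L' \<gamma> \<and> (\<forall>x\<in>Ob W. far p (\<gamma> x) = \<alpha> x \<and> far q (\<gamma> x) = \<beta> x) \<and>
             (\<forall>\<gamma>'. nat_trans W P L L' \<gamma>' \<and> (\<forall>x\<in>Ob W. far p (\<gamma>' x) = \<alpha> x \<and> far q (\<gamma>' x) = \<beta> x)
                \<longrightarrow> (\<forall>x\<in>Ob W. \<gamma>' x = \<gamma> x))"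
      by (rule exI[of _ \<gamma>]) (use st nt \<gamma> ua in \<open>auto simp: nat_trans_def\<close>)
  qed
qed

lemma two_pullback_all_test_types:
  assumes "two_pullback TYPE((nat, nat) cat) P A B C p q f g"
  shows "two_pullback TYPE(('w, 'v) cat) P A B C p q f g"
  using assms pointwise_of_nat property_of_pointwise unfolding two_pullback_def by metis

definition coequalizer ::
  "('z, 'y) cat itself \<Rightarrow> ('so, 'sm) cat \<Rightarrow> ('bo, 'bm) cat \<Rightarrow> ('qo, 'qm) cat
     \<Rightarrow> ('so, 'sm, 'bo, 'bm) ftor \<Rightarrow> ('so, 'sm, 'bo, 'bm) ftor \<Rightarrow> ('bo, 'bm, 'qo, 'qm) ftor \<Rightarrow> bool" where
  "coequalizer test_type S B Q F G q \<longleftrightarrow>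
     category S \<and> category B \<and> category Q \<and>
     is_functor S B F \<and> is_functor S B G \<and> is_functor B Q q \<and> feq S (q \<circ>\<circ> F) (q \<circ>\<circ> G) \<and>
     (\<forall>(Z :: ('z, 'y) cat) H. category Z \<and> is_functor B Z H \<and> feq S (H \<circ>\<circ> F) (H \<circ>\<circ> G) \<longrightarrow>
        (\<exists>K. is_functor Q Z K \<and> feq B (K \<circ>\<circ> q) H \<and>
           (\<forall>K'. is_functor Q Z K' \<and> feq B (K' \<circ>\<circ> q) H \<longrightarrow> feq Q K' K)))"


section \<open>Operads in sets and action operads\<close>

text \<open>In \<open>opmu O ks p qs\<close> the list \<open>ks = [k\<^sub>1, \<dots>, k\<^sub>n]\<close> records the arities:
  \<open>p \<in> O(n)\<close> with \<open>n = length ks\<close>, and \<open>qs = [q\<^sub>1, \<dots>, q\<^sub>n]\<close> with \<open>q\<^sub>i \<in> O(k\<^sub>i)\<close>.\<close>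

record 'a operad_data =
  ops :: "nat \<Rightarrow> 'a set"
  opid :: 'a
  opmu :: "nat list \<Rightarrow> 'a \<Rightarrow> 'a list \<Rightarrow> 'a"

definition ops_list :: "(nat \<Rightarrow> 'a set) \<Rightarrow> nat list \<Rightarrow> 'a list \<Rightarrow> bool" where
  "ops_list S ks qs \<longleftrightarrow> list_all2 (\<lambda>k q. q \<in> S k) ks qs"

definition operad :: "'a operad_data \<Rightarrow> bool" where
  "operad O' \<longleftrightarrow>
     opid O' \<in> ops O' 1 \<and>
     (\<forall>ks p qs. p \<in> ops O' (length ks) \<and> ops_list (ops O') ks qs \<longrightarrow>
        opmu O' ks p qs \<in> ops O' (sum_list ks)) \<and>
     (\<forall>k. \<forall>q\<in>ops O' k. opmu O' [k] (opid O') [q] = q) \<and>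
     (\<forall>n. \<forall>p\<in>ops O' n. opmu O' (replicate n 1) p (replicate n (opid O')) = p) \<and>
     (\<forall>jss p qs rss. p \<in> ops O' (length jss) \<and> ops_list (ops O') (map length jss) qs \<and>
        list_all2 (ops_list (ops O')) jss rss \<longrightarrow>
        opmu O' (concat jss) (opmu O' (map length jss) p qs) (concat rss) =
        opmu O' (map sum_list jss) p
          (map (\<lambda>i. opmu O' (jss ! i) (qs ! i) (rss ! i)) [0..<length jss]))"

definition operad_map :: "'a operad_data \<Rightarrow> 'b operad_data \<Rightarrow> (nat \<Rightarrow> 'a \<Rightarrow> 'b) \<Rightarrow> bool" where
  "operad_map O' O'' \<phi> \<longleftrightarrow>
     (\<forall>n. \<forall>p\<in>ops O' n. \<phi> n p \<in> ops O'' n) \<and>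
     \<phi> 1 (opid O') = opid O'' \<and>
     (\<forall>ks p qs. p \<in> ops O' (length ks) \<and> ops_list (ops O') ks qs \<longrightarrow>
        \<phi> (sum_list ks) (opmu O' ks p qs) = opmu O'' ks (\<phi> (length ks) p) (map2 \<phi> ks qs))"

text \<open>Permutations of \<open>n\<close> letters are permutations of \<open>{0,\<dots>,n-1}\<close> (rather than
  \<open>{1,\<dots>,n}\<close>), as functions on \<open>nat\<close> that are the identity outside. A position
  \<open>x < k\<^sub>0 + \<dots> + k\<^sub>n\<^sub>-\<^sub>1\<close> is \<open>blk_start ks i + a\<close> with \<open>i = blk ks x\<close> and \<open>a < k\<^sub>i\<close>.\<close>

definition perm_group :: "nat \<Rightarrow> (nat \<Rightarrow> nat) monoid" where
  "perm_group n = \<lparr>carrier = {\<sigma>. \<sigma> permutes {..<n}}, monoid.mult = (\<circ>), one = id\<rparr>"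

definition blk_start :: "nat list \<Rightarrow> nat \<Rightarrow> nat" where
  "blk_start ks i = sum_list (take i ks)"

definition blk :: "nat list \<Rightarrow> nat \<Rightarrow> nat" where
  "blk ks x = (LEAST i. x < blk_start ks (Suc i))"

definition block_sum :: "nat list \<Rightarrow> (nat \<Rightarrow> nat) list \<Rightarrow> nat \<Rightarrow> nat" where
  "block_sum ks \<tau>s x =
     (if x < sum_list ks
      then blk_start ks (blk ks x) + (\<tau>s ! blk ks x) (x - blk_start ks (blk ks x)) else x)"

definition block_perm :: "nat list \<Rightarrow> (nat \<Rightarrow> nat) \<Rightarrow> nat \<Rightarrow> nat" where
  "block_perm ks \<sigma> x =
     (if x < sum_list ks
      then (\<Sum>i\<in>{i. i < length ks \<and> \<sigma> i < \<sigma> (blk ks x)}. ks ! i) + (x - blk_start ks (blk ks x))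
      else x)"

definition perm_operad :: "(nat \<Rightarrow> nat) operad_data" where
  "perm_operad = \<lparr>ops = \<lambda>n. carrier (perm_group n), opid = id,
     opmu = \<lambda>ks \<sigma> \<tau>s. block_perm ks \<sigma> \<circ> block_sum ks \<tau>s\<rparr>"

record 'l action_operad_data =
  grp :: "nat \<Rightarrow> 'l monoid"
  aid :: 'l
  amu :: "nat list \<Rightarrow> 'l \<Rightarrow> 'l list \<Rightarrow> 'l"
  aproj :: "nat \<Rightarrow> 'l \<Rightarrow> nat \<Rightarrow> nat"

definition underlying_operad :: "'l action_operad_data \<Rightarrow> 'l operad_data" where
  "underlying_operad \<Lambda> = \<lparr>ops = \<lambda>n. carrier (grp \<Lambda> n), opid = aid \<Lambda>, opmu = amu \<Lambda>\<rparr>"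

text \<open>\<open>g \<cdot> (x\<^sub>1, \<dots>, x\<^sub>n) = (x\<^bsub>g\<^sup>-\<^sup>1(1)\<^esub>, \<dots>, x\<^bsub>g\<^sup>-\<^sup>1(n)\<^esub>)\<close>, for \<open>n = length xs\<close>.\<close>

definition act :: "'l action_operad_data \<Rightarrow> 'l \<Rightarrow> 'x list \<Rightarrow> 'x list" where
  "act \<Lambda> g xs = permute_list (inv_into UNIV (aproj \<Lambda> (length xs) g)) xs"

text \<open>In the last condition \<open>act \<Lambda> g ks\<close> lists the arities \<open>k\<^bsub>g\<^sup>-\<^sup>1(i)\<^esub>\<close> of the
  operations \<open>f\<^sub>i'\<close>.\<close>

definition action_operad :: "'l action_operad_data \<Rightarrow> bool" where
  "action_operad \<Lambda> \<longleftrightarrow>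
     operad (underlying_operad \<Lambda>) \<and>
     (\<forall>n. group (grp \<Lambda> n)) \<and>
     operad_map (underlying_operad \<Lambda>) perm_operad (aproj \<Lambda>) \<and>
     (\<forall>n. aproj \<Lambda> n \<in> hom (grp \<Lambda> n) (perm_group n)) \<and>
     (\<forall>ks g g' fs fs'.
        g \<in> carrier (grp \<Lambda> (length ks)) \<and> g' \<in> carrier (grp \<Lambda> (length ks)) \<and>
        ops_list (\<lambda>k. carrier (grp \<Lambda> k)) ks fs \<and>
        ops_list (\<lambda>k. carrier (grp \<Lambda> k)) (act \<Lambda> g ks) fs' \<longrightarrow>
        amu \<Lambda> (act \<Lambda> g ks) g' fs' \<otimes>\<^bsub>grp \<Lambda> (sum_list ks)\<^esub> amu \<Lambda> ks g fs =
        amu \<Lambda> ks (g' \<otimes>\<^bsub>grp \<Lambda> (length ks)\<^esub> g)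
          (map (\<lambda>i. fs' ! aproj \<Lambda> (length ks) g i \<otimes>\<^bsub>grp \<Lambda> (ks ! i)\<^esub> fs ! i) [0..<length ks]))"


section \<open>The endofunctor, unit and multiplication\<close>

definition indisc :: "'l set \<Rightarrow> ('l, 'l \<times> 'l) cat" where
  "indisc S = \<lparr>Ob = S, Ar = S \<times> S, src = fst, tgt = snd, ident = \<lambda>p. (p, p),
     cmp = \<lambda>v u. (fst u, snd v)\<rparr>"

definition disc :: "'l set \<Rightarrow> ('l, 'l) cat" where
  "disc S = \<lparr>Ob = S, Ar = S, src = id, tgt = id, ident = id, cmp = \<lambda>v u. u\<rparr>"

definition prod_cat :: "('o, 'm) cat \<Rightarrow> ('o2, 'm2) cat \<Rightarrow> ('o \<times> 'o2, 'm \<times> 'm2) cat" where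
  "prod_cat A B = \<lparr>Ob = Ob A \<times> Ob B, Ar = Ar A \<times> Ar B,
     src = map_prod (src A) (src B), tgt = map_prod (tgt A) (tgt B),
     ident = map_prod (ident A) (ident B),
     cmp = \<lambda>v u. (cmp A (fst v) (fst u), cmp B (snd v) (snd u))\<rparr>"

definition pow_cat :: "nat \<Rightarrow> ('o, 'm) cat \<Rightarrow> ('o list, 'm list) cat" where
  "pow_cat n X = \<lparr>Ob = {xs. length xs = n \<and> set xs \<subseteq> Ob X}, Ar = {us. length us = n \<and> set us \<subseteq> Ar X},
     src = map (src X), tgt = map (tgt X), ident = map (ident X), cmp = map2 (cmp X)\<rparr>"

definition coprod_cat :: "('i \<Rightarrow> ('o, 'm) cat) \<Rightarrow> ('i \<times> 'o, 'i \<times> 'm) cat" where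
  "coprod_cat A = \<lparr>Ob = Sigma UNIV (\<lambda>i. Ob (A i)), Ar = Sigma UNIV (\<lambda>i. Ar (A i)),
     src = \<lambda>(i, u). (i, src (A i) u), tgt = \<lambda>(i, u). (i, tgt (A i) u),
     ident = \<lambda>(i, x). (i, ident (A i) x),
     cmp = \<lambda>(j, v) (i, u). (i, cmp (A i) v u)\<rparr>"

text \<open>The quotient of a category by equivalence relations on its objects and on its arrows. This is
  only meaningful for suitable relations, such as the orbit relations of a group action that is
  free on objects: then sources, targets, identities and composites of classes, computed on all
  representatives at once, are again classes.\<close>

definition quot_cat :: "('o, 'm) cat \<Rightarrow> 'o rel \<Rightarrow> 'm rel \<Rightarrow> ('o set, 'm set) cat" where
  "quot_cat B R S = \<lparr>Ob = Ob B // R, Ar = Ar B // S,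
     src = (`) (src B), tgt = (`) (tgt B), ident = (`) (ident B),
     cmp = \<lambda>E D. {cmp B v u | v u. v \<in> E \<and> u \<in> D \<and> src B v = tgt B u}\<rparr>"

text \<open>\<open>EL \<Lambda> n\<close> is the category \<open>E\<Lambda>(n)\<close>. The two relations below identify
  \<open>(p \<cdot> g, x)\<close> with \<open>(p, g \<cdot> x)\<close>; as \<open>\<Lambda>(n)\<close> is a group they are already equivalence relations.
  That \<open>tensor \<Lambda> n X\<close> is the coequalizer in Cat defining \<open>E\<Lambda>(n) \<otimes>\<^bsub>\<Lambda>(n)\<^esub> X\<^sup>n\<close> is the lemma
  \<open>tensor_coequalizer\<close> at the end of this theory.\<close>

definition EL :: "'l action_operad_data \<Rightarrow> nat \<Rightarrow> ('l, 'l \<times> 'l) cat" where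
  "EL \<Lambda> n = indisc (carrier (grp \<Lambda> n))"

definition rel_ob :: "'l action_operad_data \<Rightarrow> nat \<Rightarrow> ('l \<times> 'x list) rel" where
  "rel_ob \<Lambda> n = {((p \<otimes>\<^bsub>grp \<Lambda> n\<^esub> g, xs), (p, act \<Lambda> g xs)) | p g xs.
     p \<in> carrier (grp \<Lambda> n) \<and> g \<in> carrier (grp \<Lambda> n) \<and> length xs = n}"

definition rel_ar :: "'l action_operad_data \<Rightarrow> nat \<Rightarrow> (('l \<times> 'l) \<times> 'u list) rel" where
  "rel_ar \<Lambda> n = {(((p \<otimes>\<^bsub>grp \<Lambda> n\<^esub> g, p' \<otimes>\<^bsub>grp \<Lambda> n\<^esub> g), us), ((p, p'), act \<Lambda> g us)) | p p' g us.
     p \<in> carrier (grp \<Lambda> n) \<and> p' \<in> carrier (grp \<Lambda> n) \<and> g \<in> carrier (grp \<Lambda> n) \<and> length us = n}"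

definition tensor ::
  "'l action_operad_data \<Rightarrow> nat \<Rightarrow> ('o, 'm) cat
     \<Rightarrow> (('l \<times> 'o list) set, (('l \<times> 'l) \<times> 'm list) set) cat" where
  "tensor \<Lambda> n X = quot_cat (prod_cat (EL \<Lambda> n) (pow_cat n X)) (rel_ob \<Lambda> n) (rel_ar \<Lambda> n)"

type_synonym ('l, 'o) tob = "nat \<times> ('l \<times> 'o list) set"
type_synonym ('l, 'm) tar = "nat \<times> (('l \<times> 'l) \<times> 'm list) set"

definition T :: "'l action_operad_data \<Rightarrow> ('o, 'm) cat \<Rightarrow> (('l, 'o) tob, ('l, 'm) tar) cat" where
  "T \<Lambda> X = coprod_cat (\<lambda>n. tensor \<Lambda> n X)"

definition T_map ::
  "('o, 'm, 'o2, 'm2) ftor \<Rightarrow> (('l, 'o) tob, ('l, 'm) tar, ('l, 'o2) tob, ('l, 'm2) tar) ftor" where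
  "T_map F = \<lparr>fob = \<lambda>(n, c). (n, (\<lambda>(p, xs). (p, map (fob F) xs)) ` c),
              far = \<lambda>(n, c). (n, (\<lambda>(e, us). (e, map (far F) us)) ` c)\<rparr>"

text \<open>\<open>br_ob \<Lambda> p [x\<^sub>1, \<dots>, x\<^sub>n]\<close> is the object \<open>[p; x\<^sub>1, \<dots>, x\<^sub>n]\<close>, and \<open>br_ar\<close> is the
  analogous notation for arrows; the arity \<open>n\<close> is the length of the list.\<close>

definition br_ob :: "'l action_operad_data \<Rightarrow> 'l \<Rightarrow> 'x list \<Rightarrow> ('l, 'x) tob" where
  "br_ob \<Lambda> p xs = (length xs, rel_ob \<Lambda> (length xs) `` {(p, xs)})"

definition br_ar :: "'l action_operad_data \<Rightarrow> 'l \<times> 'l \<Rightarrow> 'u list \<Rightarrow> ('l, 'u) tar" where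
  "br_ar \<Lambda> e us = (length us, rel_ar \<Lambda> (length us) `` {(e, us)})"

definition T_unit :: "'l action_operad_data \<Rightarrow> ('o, 'm, ('l, 'o) tob, ('l, 'm) tar) ftor" where
  "T_unit \<Lambda> = \<lparr>fob = \<lambda>x. br_ob \<Lambda> (aid \<Lambda>) [x], far = \<lambda>u. br_ar \<Lambda> (aid \<Lambda>, aid \<Lambda>) [u]\<rparr>"

text \<open>\<open>[p; [q\<^sub>1; xs\<^sub>1], \<dots>, [q\<^sub>n; xs\<^sub>n]] \<mapsto> [\<mu>(p; q\<^sub>1, \<dots>, q\<^sub>n); xs\<^sub>1, \<dots>, xs\<^sub>n]\<close>, and likewise on
  arrows, where \<open>\<mu>\<close> acts on source and target of the arrows of \<open>E\<Lambda>\<close>. In both cases the class on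
  the right does not depend on the chosen representatives.\<close>

definition T_mult ::
  "'l action_operad_data \<Rightarrow>
     (('l, ('l, 'o) tob) tob, ('l, ('l, 'm) tar) tar, ('l, 'o) tob, ('l, 'm) tar) ftor" where
  "T_mult \<Lambda> = \<lparr>
     fob = \<lambda>z. THE w. \<exists>p qs xss.
       p \<in> carrier (grp \<Lambda> (length xss)) \<and>
       ops_list (\<lambda>k. carrier (grp \<Lambda> k)) (map length xss) qs \<and>
       z = br_ob \<Lambda> p (map2 (br_ob \<Lambda>) qs xss) \<and>
       w = br_ob \<Lambda> (amu \<Lambda> (map length xss) p qs) (concat xss),
     far = \<lambda>z. THE w. \<exists>p p' qs qs' uss.
       p \<in> carrier (grp \<Lambda> (length uss)) \<and> p' \<in> carrier (grp \<Lambda> (length uss)) \<and>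
       ops_list (\<lambda>k. carrier (grp \<Lambda> k)) (map length uss) qs \<and>
       ops_list (\<lambda>k. carrier (grp \<Lambda> k)) (map length uss) qs' \<and>
       z = br_ar \<Lambda> (p, p') (map2 (br_ar \<Lambda>) (zip qs qs') uss) \<and>
       w = br_ar \<Lambda> (amu \<Lambda> (map length uss) p qs, amu \<Lambda> (map length uss) p' qs') (concat uss)\<rparr>"


section \<open>The tensor product is a coequalizer\<close>

locale free_cat_action = group G for G (structure) +
  fixes B :: "('o, 'm) cat" and ao :: "'a \<Rightarrow> 'o \<Rightarrow> 'o" and am :: "'a \<Rightarrow> 'm \<Rightarrow> 'm"
    and R :: "'o rel" and S :: "'m rel"
  assumes B: "category B"
    and ao_closed: "g \<in> carrier G \<Longrightarrow> x \<in> Ob B \<Longrightarrow> ao g x \<in> Ob B"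
    and am_closed: "g \<in> carrier G \<Longrightarrow> u \<in> Ar B \<Longrightarrow> am g u \<in> Ar B"
    and ao_one: "x \<in> Ob B \<Longrightarrow> ao \<one> x = x"
    and am_one: "u \<in> Ar B \<Longrightarrow> am \<one> u = u"
    and ao_mult: "g \<in> carrier G \<Longrightarrow> h \<in> carrier G \<Longrightarrow> x \<in> Ob B \<Longrightarrow> ao (g \<otimes> h) x = ao g (ao h x)"
    and am_mult: "g \<in> carrier G \<Longrightarrow> h \<in> carrier G \<Longrightarrow> u \<in> Ar B \<Longrightarrow> am (g \<otimes> h) u = am g (am h u)"
    and src_am: "g \<in> carrier G \<Longrightarrow> u \<in> Ar B \<Longrightarrow> src B (am g u) = ao g (src B u)"
    and tgt_am: "g \<in> carrier G \<Longrightarrow> u \<in> Ar B \<Longrightarrow> tgt B (am g u) = ao g (tgt B u)"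
    and ident_ao: "g \<in> carrier G \<Longrightarrow> x \<in> Ob B \<Longrightarrow> ident B (ao g x) = am g (ident B x)"
    and cmp_am: "g \<in> carrier G \<Longrightarrow> u \<in> Ar B \<Longrightarrow> v \<in> Ar B \<Longrightarrow> src B v = tgt B u \<Longrightarrow>
        cmp B (am g v) (am g u) = am g (cmp B v u)"
    and free: "g \<in> carrier G \<Longrightarrow> x \<in> Ob B \<Longrightarrow> ao g x = x \<Longrightarrow> g = \<one>"
    and R: "x \<in> Ob B \<Longrightarrow> R `` {x} = (\<lambda>g. ao g x) ` carrier G"
    and S: "u \<in> Ar B \<Longrightarrow> S `` {u} = (\<lambda>g. am g u) ` carrier G"
begin

abbreviation "Q \<equiv> quot_cat B R S"

definition proj :: "('o, 'm, 'o set, 'm set) ftor" where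
  "proj = \<lparr>fob = \<lambda>x. R `` {x}, far = \<lambda>u. S `` {u}\<rparr>"

lemma B1: "u \<in> Ar B \<Longrightarrow> src B u \<in> Ob B" "u \<in> Ar B \<Longrightarrow> tgt B u \<in> Ob B"
  using B by (auto simp: category_def)
lemma B2: assumes "x \<in> Ob B" shows "ident B x \<in> Ar B" "src B (ident B x) = x" "tgt B (ident B x) = x"
  using B assms by (auto simp: category_def)
lemma B3: assumes "u \<in> Ar B" "v \<in> Ar B" "src B v = tgt B u"
  shows "cmp B v u \<in> Ar B" "src B (cmp B v u) = src B u" "tgt B (cmp B v u) = tgt B v"
  using B assms unfolding category_def by metis+
lemma B4: assumes "u \<in> Ar B"
  shows "cmp B u (ident B (src B u)) = u" "cmp B (ident B (tgt B u)) u = u"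
  using B assms by (auto simp: category_def)
lemma B5: assumes "u \<in> Ar B" "v \<in> Ar B" "w \<in> Ar B" "src B v = tgt B u" "src B w = tgt B v"
  shows "cmp B w (cmp B v u) = cmp B (cmp B w v) u"
  using B assms unfolding category_def by metis

lemma orb_shift:
  assumes "g \<in> carrier G"
  shows "x \<in> Ob B \<Longrightarrow> R `` {ao g x} = R `` {x}" "u \<in> Ar B \<Longrightarrow> S `` {am g u} = S `` {u}"
proof -
  have e: "(\<lambda>h. h \<otimes> g) ` carrier G = carrier G"
  proof
    show "carrier G \<subseteq> (\<lambda>h. h \<otimes> g) ` carrier G"
    proof
      fix k assume k: "k \<in> carrier G"
      have "k = (k \<otimes> inv g) \<otimes> g" using k assms by (simp add: m_assoc)
      then show "k \<in> (\<lambda>h. h \<otimes> g) ` carrier G" using k assms by blast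
    qed
  qed (use assms in auto)
  show "R `` {ao g x} = R `` {x}" if x: "x \<in> Ob B"
  proof -
    have "R `` {ao g x} = (\<lambda>h. ao (h \<otimes> g) x) ` carrier G"
      using x assms by (simp add: R ao_closed ao_mult cong: image_cong)
    also have "\<dots> = (\<lambda>h. ao h x) ` ((\<lambda>h. h \<otimes> g) ` carrier G)" by (simp add: image_image)
    finally show ?thesis using x by (simp add: e R)
  qed
  show "S `` {am g u} = S `` {u}" if u: "u \<in> Ar B"
  proof -
    have "S `` {am g u} = (\<lambda>h. am (h \<otimes> g) u) ` carrier G"
      using u assms by (simp add: S am_closed am_mult cong: image_cong)
    also have "\<dots> = (\<lambda>h. am h u) ` ((\<lambda>h. h \<otimes> g) ` carrier G)" by (simp add: image_image)
    finally show ?thesis using u by (simp add: e S)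
  qed
qed

lemma self: "x \<in> Ob B \<Longrightarrow> x \<in> R `` {x}" "u \<in> Ar B \<Longrightarrow> u \<in> S `` {u}"
  by (simp_all only: R S) (metis ao_one image_eqI one_closed, metis am_one image_eqI one_closed)

lemma R_eqD: "x \<in> Ob B \<Longrightarrow> y \<in> Ob B \<Longrightarrow> R `` {x} = R `` {y} \<Longrightarrow> \<exists>g\<in>carrier G. x = ao g y"
  using self(1)[of x] R[of y] by auto

lemma free2: assumes "g \<in> carrier G" "h \<in> carrier G" "x \<in> Ob B" "ao g x = ao h x" shows "g = h"
proof -
  have "ao (inv h \<otimes> g) x = ao (inv h) (ao h x)" using assms by (simp add: ao_mult)
  also have "\<dots> = ao (inv h \<otimes> h) x" using assms by (simp only: ao_mult inv_closed)
  also have "\<dots> = x" using assms by (simp add: ao_one)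
  finally have "ao (inv h \<otimes> g) x = x" .
  then have "inv h \<otimes> g = \<one>" using assms by (intro free[of _ x]) simp_all
  then show ?thesis using assms by (metis inv_equality inv_inv inv_closed)
qed

lemma Q_Ob: "Ob Q = (\<lambda>x. R `` {x}) ` Ob B" by (auto simp: quot_cat_def quotient_def)
lemma Q_Ar: "Ar Q = (\<lambda>u. S `` {u}) ` Ar B" by (auto simp: quot_cat_def quotient_def)
lemma Q_src: "u \<in> Ar B \<Longrightarrow> src Q (S `` {u}) = R `` {src B u}"
  by (simp add: quot_cat_def S R B1 image_image src_am cong: image_cong)
lemma Q_tgt: "u \<in> Ar B \<Longrightarrow> tgt Q (S `` {u}) = R `` {tgt B u}"
  by (simp add: quot_cat_def S R B1 image_image tgt_am cong: image_cong)
lemma Q_ident: "x \<in> Ob B \<Longrightarrow> ident Q (R `` {x}) = S `` {ident B x}"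
  by (simp add: quot_cat_def S R B2 image_image ident_ao cong: image_cong)
lemma Q_cmp: assumes "u \<in> Ar B" "v \<in> Ar B" "src B v = tgt B u"
  shows "cmp Q (S `` {v}) (S `` {u}) = S `` {cmp B v u}"
proof -
  have "{cmp B v' u' | v' u'. v' \<in> (\<lambda>g. am g v) ` carrier G \<and> u' \<in> (\<lambda>g. am g u) ` carrier G \<and> src B v' = tgt B u'}
    = (\<lambda>g. am g (cmp B v u)) ` carrier G" (is "?L = ?R")
  proof
    show "?L \<subseteq> ?R"
    proof clarsimp
      fix g h assume gh: "g \<in> carrier G" "h \<in> carrier G" "src B (am g v) = tgt B (am h u)"
      then have "g = h" using assms by (intro free2[of g h "tgt B u"]) (simp_all add: src_am tgt_am B1)
      then show "cmp B (am g v) (am h u) \<in> (\<lambda>g. am g (cmp B v u)) ` carrier G"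
        using gh assms by (simp add: cmp_am)
    qed
    show "?R \<subseteq> ?L"
    proof clarsimp
      fix g assume g: "g \<in> carrier G"
      show "\<exists>v' u'. am g (cmp B v u) = cmp B v' u' \<and> v' \<in> (\<lambda>g. am g v) ` carrier G \<and>
         u' \<in> (\<lambda>g. am g u) ` carrier G \<and> src B v' = tgt B u'"
        by (rule exI[of _ "am g v"], rule exI[of _ "am g u"]) (use g assms in \<open>simp add: cmp_am src_am tgt_am\<close>)
    qed
  qed
  then show ?thesis using assms by (simp add: quot_cat_def S B3)
qed

lemma Q_composable:
  assumes "D \<in> Ar Q" "v \<in> Ar B" "src Q (S `` {v}) = tgt Q D"
  obtains u where "u \<in> Ar B" "D = S `` {u}" "src B v = tgt B u"
proof -
  obtain u where u: "u \<in> Ar B" "D = S `` {u}" using assms by (auto simp: Q_Ar)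
  then obtain g where "g \<in> carrier G" "src B v = ao g (tgt B u)"
    using assms R_eqD[of "src B v" "tgt B u"] by (auto simp: Q_src Q_tgt B1)
  then show thesis using u that[of "am g u"] by (simp add: am_closed orb_shift tgt_am)
qed

lemma Q_cases: assumes "E \<in> Ar Q" obtains v where "v \<in> Ar B" "E = S `` {v}"
  using assms by (auto simp: Q_Ar)

lemma category_Q: "category Q"
  unfolding category_def
proof (intro conjI ballI impI)
  fix u assume u: "u \<in> Ar Q"
  then show "src Q u \<in> Ob Q" "tgt Q u \<in> Ob Q" by (auto simp: Q_Ar Q_Ob Q_src Q_tgt B1)
  show "cmp Q u (ident Q (src Q u)) = u" "cmp Q (ident Q (tgt Q u)) u = u"
    using u by (auto simp: Q_Ar Q_src Q_tgt Q_ident Q_cmp B1 B2 B4)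
next
  fix x assume "x \<in> Ob Q"
  then show "ident Q x \<in> Ar Q" "src Q (ident Q x) = x" "tgt Q (ident Q x) = x"
    by (auto simp: Q_Ar Q_Ob Q_src Q_tgt Q_ident B2)
next
  fix D E assume a: "D \<in> Ar Q" "E \<in> Ar Q" "src Q E = tgt Q D"
  then obtain v where v: "v \<in> Ar B" "E = S `` {v}" by (auto simp: Q_Ar)
  then obtain u where u: "u \<in> Ar B" "D = S `` {u}" "src B v = tgt B u" using Q_composable a by metis
  show "cmp Q E D \<in> Ar Q" "src Q (cmp Q E D) = src Q D" "tgt Q (cmp Q E D) = tgt Q E"
    using u v by (auto simp: Q_cmp Q_Ar B3 Q_src Q_tgt)
next
  fix D E F assume a: "D \<in> Ar Q" "E \<in> Ar Q" "F \<in> Ar Q" "src Q E = tgt Q D" "src Q F = tgt Q E"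
  then obtain w where w: "w \<in> Ar B" "F = S `` {w}" by (auto simp: Q_Ar)
  then obtain v where v: "v \<in> Ar B" "E = S `` {v}" "src B w = tgt B v" using Q_composable a by metis
  then obtain u where u: "u \<in> Ar B" "D = S `` {u}" "src B v = tgt B u" using Q_composable a by metis
  show "cmp Q F (cmp Q E D) = cmp Q (cmp Q F E) D"
    using u v w by (simp add: Q_cmp B3 B5)
qed

lemma functor_proj: "is_functor B Q proj"
  by (auto simp: is_functor_def proj_def Q_Ob Q_Ar Q_src Q_tgt Q_ident Q_cmp)

lemma proj_am: "g \<in> carrier G \<Longrightarrow> x \<in> Ob B \<Longrightarrow> fob proj (ao g x) = fob proj x"
  "g \<in> carrier G \<Longrightarrow> u \<in> Ar B \<Longrightarrow> far proj (am g u) = far proj u"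
  by (simp_all add: proj_def orb_shift)

lemma proj_universal:
  assumes H: "is_functor B Z H"
    and io: "\<And>g x. g \<in> carrier G \<Longrightarrow> x \<in> Ob B \<Longrightarrow> fob H (ao g x) = fob H x"
    and ia: "\<And>g u. g \<in> carrier G \<Longrightarrow> u \<in> Ar B \<Longrightarrow> far H (am g u) = far H u"
  shows "\<exists>K. is_functor Q Z K \<and> feq B (K \<circ>\<circ> proj) H \<and>
           (\<forall>K'. is_functor Q Z K' \<and> feq B (K' \<circ>\<circ> proj) H \<longrightarrow> feq Q K' K)"
proof -
  define K where "K = \<lparr>fob = \<lambda>c. fob H (SOME x. x \<in> c), far = \<lambda>c. far H (SOME u. u \<in> c)\<rparr>"
  have Ko: "fob K (R `` {x}) = fob H x" if x: "x \<in> Ob B" for x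
  proof -
    have "(SOME y. y \<in> R `` {x}) \<in> R `` {x}" using self(1)[OF x] by (rule someI)
    then show ?thesis unfolding K_def using x io by (auto simp only: R) simp
  qed
  have Ka: "far K (S `` {u}) = far H u" if u: "u \<in> Ar B" for u
  proof -
    have "(SOME y. y \<in> S `` {u}) \<in> S `` {u}" using self(2)[OF u] by (rule someI)
    then show ?thesis unfolding K_def using u ia by (auto simp only: S) simp
  qed
  have H1: "fob H x \<in> Ob Z" "far H (ident B x) = ident Z (fob H x)" if "x \<in> Ob B" for x
    using H that by (auto simp: is_functor_def)
  have H2: "far H u \<in> Ar Z" "src Z (far H u) = fob H (src B u)" "tgt Z (far H u) = fob H (tgt B u)"
    if "u \<in> Ar B" for u using H that by (auto simp: is_functor_def)
  have H3: "far H (cmp B v u) = cmp Z (far H v) (far H u)"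
    if "u \<in> Ar B" "v \<in> Ar B" "src B v = tgt B u" for u v using H that by (auto simp: is_functor_def)
  have "is_functor Q Z K" unfolding is_functor_def
  proof (intro conjI ballI impI)
    fix D E assume a: "D \<in> Ar Q" "E \<in> Ar Q" "src Q E = tgt Q D"
    then obtain v where v: "v \<in> Ar B" "E = S `` {v}" by (auto simp: Q_Ar)
    then obtain u where u: "u \<in> Ar B" "D = S `` {u}" "src B v = tgt B u" using Q_composable a by metis
    show "far K (cmp Q E D) = cmp Z (far K E) (far K D)"
      using u v by (simp add: Q_cmp Ka B3 H3)
  qed (auto simp: Q_Ob Q_Ar Q_src Q_tgt Q_ident Ko Ka H1 H2 B1 B2)
  moreover have "feq B (K \<circ>\<circ> proj) H" by (simp add: feq_def proj_def Ko Ka)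
  moreover have "feq Q K' K" if "feq B (K' \<circ>\<circ> proj) H" for K'
    using that by (auto simp: feq_def proj_def Q_Ob Q_Ar Ko Ka)
  ultimately show ?thesis by blast
qed

end

lemma category_indisc: "category (indisc S)" by (auto simp: indisc_def category_def)
lemma category_disc: "category (disc S)" by (auto simp: disc_def category_def)

lemma category_prod:
  assumes "category A" "category B" shows "category (prod_cat A B)"
  using assms unfolding category_def prod_cat_def by simp

lemma category_pow:
  assumes "category X" shows "category (pow_cat n X)"
proof -
  have X1: "\<And>u. u \<in> Ar X \<Longrightarrow> src X u \<in> Ob X \<and> tgt X u \<in> Ob X"
    and X2: "\<And>x. x \<in> Ob X \<Longrightarrow> ident X x \<in> Ar X \<and> src X (ident X x) = x \<and> tgt X (ident X x) = x"
    and X3: "\<And>u v. u \<in> Ar X \<Longrightarrow> v \<in> Ar X \<Longrightarrow> src X v = tgt X u \<Longrightarrow>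
        cmp X v u \<in> Ar X \<and> src X (cmp X v u) = src X u \<and> tgt X (cmp X v u) = tgt X v"
    and X4: "\<And>u. u \<in> Ar X \<Longrightarrow> cmp X u (ident X (src X u)) = u \<and> cmp X (ident X (tgt X u)) u = u"
    and X5: "\<And>u v w. u \<in> Ar X \<Longrightarrow> v \<in> Ar X \<Longrightarrow> w \<in> Ar X \<Longrightarrow> src X v = tgt X u \<Longrightarrow> src X w = tgt X v \<Longrightarrow>
        cmp X w (cmp X v u) = cmp X (cmp X w v) u"
    using assms unfolding category_def by blast+
  show ?thesis unfolding category_def
  proof (intro conjI ballI impI)
    fix u assume u: "u \<in> Ar (pow_cat n X)"
    show "src (pow_cat n X) u \<in> Ob (pow_cat n X)" "tgt (pow_cat n X) u \<in> Ob (pow_cat n X)"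
      using u X1 by (auto simp: pow_cat_def)
    show "cmp (pow_cat n X) u (ident (pow_cat n X) (src (pow_cat n X) u)) = u"
      "cmp (pow_cat n X) (ident (pow_cat n X) (tgt (pow_cat n X) u)) u = u"
      using u X4 by (auto simp: pow_cat_def list_eq_iff_nth_eq subset_iff)
  next
    fix x assume "x \<in> Ob (pow_cat n X)"
    then show "ident (pow_cat n X) x \<in> Ar (pow_cat n X)"
      "src (pow_cat n X) (ident (pow_cat n X) x) = x" "tgt (pow_cat n X) (ident (pow_cat n X) x) = x"
      using X2 by (auto simp: pow_cat_def subset_iff intro!: map_idI)
  next
    fix u v assume uv: "u \<in> Ar (pow_cat n X)" "v \<in> Ar (pow_cat n X)"
      "src (pow_cat n X) v = tgt (pow_cat n X) u"
    then have l: "length u = n" "length v = n"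
      and m: "\<And>i. i < n \<Longrightarrow> u ! i \<in> Ar X \<and> v ! i \<in> Ar X \<and> src X (v ! i) = tgt X (u ! i)"
      by (auto simp: pow_cat_def list_eq_iff_nth_eq)
    show "cmp (pow_cat n X) v u \<in> Ar (pow_cat n X)"
      "src (pow_cat n X) (cmp (pow_cat n X) v u) = src (pow_cat n X) u"
      "tgt (pow_cat n X) (cmp (pow_cat n X) v u) = tgt (pow_cat n X) v"
      using l m X3 by (auto simp: pow_cat_def list_eq_iff_nth_eq set_conv_nth)
  next
    fix u v w assume uv: "u \<in> Ar (pow_cat n X)" "v \<in> Ar (pow_cat n X)" "w \<in> Ar (pow_cat n X)"
      "src (pow_cat n X) v = tgt (pow_cat n X) u" "src (pow_cat n X) w = tgt (pow_cat n X) v"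
    then have l: "length u = n" "length v = n" "length w = n"
      and m: "\<And>i. i < n \<Longrightarrow> u ! i \<in> Ar X \<and> v ! i \<in> Ar X \<and> w ! i \<in> Ar X \<and>
        src X (v ! i) = tgt X (u ! i) \<and> src X (w ! i) = tgt X (v ! i)"
      by (auto simp: pow_cat_def list_eq_iff_nth_eq)
    show "cmp (pow_cat n X) w (cmp (pow_cat n X) v u) = cmp (pow_cat n X) (cmp (pow_cat n X) w v) u"
      using l m X5 by (auto simp: pow_cat_def list_eq_iff_nth_eq)
  qed
qed

locale act_op =
  fixes \<Lambda> :: "'l action_operad_data"
  assumes AO: "action_operad \<Lambda>"
begin

lemma grp: "group (grp \<Lambda> n)" using AO by (simp add: action_operad_def)

lemma aproj_permutes: "g \<in> carrier (grp \<Lambda> n) \<Longrightarrow> aproj \<Lambda> n g permutes {..<n}"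
  using AO by (auto simp: action_operad_def hom_def perm_group_def)

lemma aproj_mult: "g \<in> carrier (grp \<Lambda> n) \<Longrightarrow> h \<in> carrier (grp \<Lambda> n) \<Longrightarrow>
    aproj \<Lambda> n (g \<otimes>\<^bsub>grp \<Lambda> n\<^esub> h) = aproj \<Lambda> n g \<circ> aproj \<Lambda> n h"
  using AO by (auto simp: action_operad_def hom_def perm_group_def)

lemma aproj_one: "aproj \<Lambda> n \<one>\<^bsub>grp \<Lambda> n\<^esub> = id"
proof -
  interpret group "grp \<Lambda> n" by (rule grp)
  let ?s = "aproj \<Lambda> n \<one>\<^bsub>grp \<Lambda> n\<^esub>"
  have "?s \<circ> ?s = ?s" using aproj_mult[of "\<one>\<^bsub>grp \<Lambda> n\<^esub>" n "\<one>\<^bsub>grp \<Lambda> n\<^esub>"] by simp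
  moreover have "inj ?s" using aproj_permutes[of "\<one>\<^bsub>grp \<Lambda> n\<^esub>" n] by (simp add: permutes_inj)
  ultimately show ?thesis by (auto simp: fun_eq_iff dest: injD)
qed

lemma length_act [simp]: "length (act \<Lambda> g xs) = length xs" by (simp add: act_def)

lemma inv_permutes: "g \<in> carrier (grp \<Lambda> n) \<Longrightarrow> inv_into UNIV (aproj \<Lambda> n g) permutes {..<n}"
  by (simp add: aproj_permutes permutes_inv)

lemma act_one: "act \<Lambda> \<one>\<^bsub>grp \<Lambda> (length xs)\<^esub> xs = xs"
  by (simp add: act_def aproj_one)

lemma act_mult:
  assumes "g \<in> carrier (grp \<Lambda> (length xs))" "h \<in> carrier (grp \<Lambda> (length xs))"
  shows "act \<Lambda> (g \<otimes>\<^bsub>grp \<Lambda> (length xs)\<^esub> h) xs = act \<Lambda> g (act \<Lambda> h xs)"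
proof -
  have "inv_into UNIV (aproj \<Lambda> (length xs) g \<circ> aproj \<Lambda> (length xs) h) =
    inv_into UNIV (aproj \<Lambda> (length xs) h) \<circ> inv_into UNIV (aproj \<Lambda> (length xs) g)"
    using assms by (intro o_inv_distrib) (auto intro: permutes_bij aproj_permutes)
  then show ?thesis
    using assms by (simp add: act_def aproj_mult permute_list_compose inv_permutes)
qed

lemma act_map:
  assumes "g \<in> carrier (grp \<Lambda> (length xs))"
  shows "act \<Lambda> g (map f xs) = map f (act \<Lambda> g xs)"
  using assms by (simp add: act_def permute_list_map inv_permutes)

lemma set_act:
  assumes "g \<in> carrier (grp \<Lambda> (length xs))" shows "set (act \<Lambda> g xs) = set xs"
  using assms by (simp add: act_def inv_permutes)

lemma act_zip:
  assumes "g \<in> carrier (grp \<Lambda> (length xs))" "length xs = length ys"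
  shows "act \<Lambda> g (zip xs ys) = zip (act \<Lambda> g xs) (act \<Lambda> g ys)"
  using assms by (simp add: act_def permute_list_zip[OF inv_permutes])

lemma cancel [simp]:
  assumes "p \<in> carrier (grp \<Lambda> m)" "g \<in> carrier (grp \<Lambda> m)"
  shows "p \<otimes>\<^bsub>grp \<Lambda> m\<^esub> g \<otimes>\<^bsub>grp \<Lambda> m\<^esub> inv\<^bsub>grp \<Lambda> m\<^esub> g = p"
    "p \<otimes>\<^bsub>grp \<Lambda> m\<^esub> inv\<^bsub>grp \<Lambda> m\<^esub> g \<otimes>\<^bsub>grp \<Lambda> m\<^esub> g = p"
proof -
  interpret group "grp \<Lambda> m" by (rule grp)
  show "p \<otimes>\<^bsub>grp \<Lambda> m\<^esub> g \<otimes>\<^bsub>grp \<Lambda> m\<^esub> inv\<^bsub>grp \<Lambda> m\<^esub> g = p"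
    "p \<otimes>\<^bsub>grp \<Lambda> m\<^esub> inv\<^bsub>grp \<Lambda> m\<^esub> g \<otimes>\<^bsub>grp \<Lambda> m\<^esub> g = p"
    using assms by (simp_all add: m_assoc)
qed

definition aob :: "nat \<Rightarrow> 'l \<Rightarrow> 'l \<times> 'x list \<Rightarrow> 'l \<times> 'x list" where
  "aob n g = (\<lambda>(p, xs). (p \<otimes>\<^bsub>grp \<Lambda> n\<^esub> inv\<^bsub>grp \<Lambda> n\<^esub> g, act \<Lambda> g xs))"

definition aar :: "nat \<Rightarrow> 'l \<Rightarrow> ('l \<times> 'l) \<times> 'x list \<Rightarrow> ('l \<times> 'l) \<times> 'x list" where
  "aar n g = (\<lambda>((p, p'), xs). ((p \<otimes>\<^bsub>grp \<Lambda> n\<^esub> inv\<^bsub>grp \<Lambda> n\<^esub> g, p' \<otimes>\<^bsub>grp \<Lambda> n\<^esub> inv\<^bsub>grp \<Lambda> n\<^esub> g), act \<Lambda> g xs))"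

lemma closed [simp]:
  assumes "p \<in> carrier (grp \<Lambda> m)" "g \<in> carrier (grp \<Lambda> m)"
  shows "p \<otimes>\<^bsub>grp \<Lambda> m\<^esub> g \<in> carrier (grp \<Lambda> m)" "inv\<^bsub>grp \<Lambda> m\<^esub> g \<in> carrier (grp \<Lambda> m)"
  using assms group.inv_closed[OF grp] monoid.m_closed[OF group.is_monoid[OF grp]] by auto

lemma free_right:
  assumes "p \<in> carrier (grp \<Lambda> n)" "g \<in> carrier (grp \<Lambda> n)" "p \<otimes>\<^bsub>grp \<Lambda> n\<^esub> inv\<^bsub>grp \<Lambda> n\<^esub> g = p"
  shows "g = \<one>\<^bsub>grp \<Lambda> n\<^esub>"
proof -
  interpret group "grp \<Lambda> n" by (rule grp)
  have "p = p \<otimes>\<^bsub>grp \<Lambda> n\<^esub> g" using assms cancel(2)[of p n g] by simp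
  then show ?thesis using assms using l_cancel_one[of p g] by simp
qed

lemma aob_right:
  assumes "p \<in> carrier (grp \<Lambda> n)" "g \<in> carrier (grp \<Lambda> n)"
  shows "aob n g (p \<otimes>\<^bsub>grp \<Lambda> n\<^esub> g, xs) = (p, act \<Lambda> g xs)"
  using assms by (simp add: aob_def)

lemma aar_right:
  assumes "p \<in> carrier (grp \<Lambda> n)" "p' \<in> carrier (grp \<Lambda> n)" "g \<in> carrier (grp \<Lambda> n)"
  shows "aar n g ((p \<otimes>\<^bsub>grp \<Lambda> n\<^esub> g, p' \<otimes>\<^bsub>grp \<Lambda> n\<^esub> g), us) = ((p, p'), act \<Lambda> g us)"
  using assms by (simp add: aar_def)

lemma rel_ob_class:
  assumes "p \<in> carrier (grp \<Lambda> n)" "length xs = n"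
  shows "rel_ob \<Lambda> n `` {(p, xs)} = (\<lambda>g. aob n g (p, xs)) ` carrier (grp \<Lambda> n)"
proof -
  interpret group "grp \<Lambda> n" by (rule grp)
  show ?thesis
  proof
    show "rel_ob \<Lambda> n `` {(p, xs)} \<subseteq> (\<lambda>g. aob n g (p, xs)) ` carrier (grp \<Lambda> n)"
      using assms by (auto simp: rel_ob_def aob_def intro!: image_eqI)
    show "(\<lambda>g. aob n g (p, xs)) ` carrier (grp \<Lambda> n) \<subseteq> rel_ob \<Lambda> n `` {(p, xs)}"
    proof
      fix y assume "y \<in> (\<lambda>g. aob n g (p, xs)) ` carrier (grp \<Lambda> n)"
      then obtain g where g: "g \<in> carrier (grp \<Lambda> n)"
        and y: "y = (p \<otimes>\<^bsub>grp \<Lambda> n\<^esub> inv\<^bsub>grp \<Lambda> n\<^esub> g, act \<Lambda> g xs)" by (auto simp: aob_def)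
      have "((p \<otimes>\<^bsub>grp \<Lambda> n\<^esub> inv\<^bsub>grp \<Lambda> n\<^esub> g \<otimes>\<^bsub>grp \<Lambda> n\<^esub> g, xs), y) \<in> rel_ob \<Lambda> n"
        unfolding rel_ob_def y using g assms closed by blast
      then show "y \<in> rel_ob \<Lambda> n `` {(p, xs)}" using g assms(1) by simp
    qed
  qed
qed

lemma rel_ar_class:
  assumes "p \<in> carrier (grp \<Lambda> n)" "p' \<in> carrier (grp \<Lambda> n)" "length xs = n"
  shows "rel_ar \<Lambda> n `` {((p, p'), xs)} = (\<lambda>g. aar n g ((p, p'), xs)) ` carrier (grp \<Lambda> n)"
proof -
  interpret group "grp \<Lambda> n" by (rule grp)
  show ?thesis
  proof
    show "rel_ar \<Lambda> n `` {((p, p'), xs)} \<subseteq> (\<lambda>g. aar n g ((p, p'), xs)) ` carrier (grp \<Lambda> n)"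
      using assms by (auto simp: rel_ar_def aar_def intro!: image_eqI)
    show "(\<lambda>g. aar n g ((p, p'), xs)) ` carrier (grp \<Lambda> n) \<subseteq> rel_ar \<Lambda> n `` {((p, p'), xs)}"
    proof
      fix y assume "y \<in> (\<lambda>g. aar n g ((p, p'), xs)) ` carrier (grp \<Lambda> n)"
      then obtain g where g: "g \<in> carrier (grp \<Lambda> n)"
        and y: "y = ((p \<otimes>\<^bsub>grp \<Lambda> n\<^esub> inv\<^bsub>grp \<Lambda> n\<^esub> g, p' \<otimes>\<^bsub>grp \<Lambda> n\<^esub> inv\<^bsub>grp \<Lambda> n\<^esub> g), act \<Lambda> g xs)" by (auto simp: aar_def)
      have "(((p \<otimes>\<^bsub>grp \<Lambda> n\<^esub> inv\<^bsub>grp \<Lambda> n\<^esub> g \<otimes>\<^bsub>grp \<Lambda> n\<^esub> g, p' \<otimes>\<^bsub>grp \<Lambda> n\<^esub> inv\<^bsub>grp \<Lambda> n\<^esub> g \<otimes>\<^bsub>grp \<Lambda> n\<^esub> g), xs), y) \<in> rel_ar \<Lambda> n"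
        unfolding rel_ar_def y using g assms closed by blast
      then show "y \<in> rel_ar \<Lambda> n `` {((p, p'), xs)}" using g assms(1,2) by simp
    qed
  qed
qed

lemma free_cat_action_tensor:
  fixes X :: "('a, 'b) cat"
  assumes X: "category X"
  shows "free_cat_action (grp \<Lambda> n) (prod_cat (EL \<Lambda> n) (pow_cat n X)) (aob n) (aar n)
    (rel_ob \<Lambda> n) (rel_ar \<Lambda> n)"
proof -
  interpret group "grp \<Lambda> n" by (rule grp)
  let ?B = "prod_cat (EL \<Lambda> n) (pow_cat n X)"
  note d = prod_cat_def EL_def indisc_def pow_cat_def aob_def aar_def
  show ?thesis
  proof
    show "category ?B"
      using X by (simp add: category_prod EL_def category_indisc category_pow)
    fix g assume g: "g \<in> carrier (grp \<Lambda> n)"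
    {
      fix x assume x: "x \<in> Ob ?B"
      obtain p xs where p: "x = (p, xs)" "p \<in> carrier (grp \<Lambda> n)" "length xs = n" "set xs \<subseteq> Ob X"
        using x by (auto simp: d)
      have c: "g \<in> carrier (grp \<Lambda> (length xs))" using g p by simp
      show "aob n g x \<in> Ob ?B" using p g set_act[OF c] by (simp add: d)
      show "ident ?B (aob n g x) = aar n g (ident ?B x)"
        using p g by (simp add: d act_map[OF c])
      show "g = \<one>\<^bsub>grp \<Lambda> n\<^esub>" if "aob n g x = x"
      proof (rule free_right)
        show "p \<otimes>\<^bsub>grp \<Lambda> n\<^esub> inv\<^bsub>grp \<Lambda> n\<^esub> g = p" using that unfolding p(1) aob_def prod.case prod.inject by (rule conjunct1)
      qed (rule p g)+
      fix h assume h: "h \<in> carrier (grp \<Lambda> n)"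
      then have c': "h \<in> carrier (grp \<Lambda> (length xs))" using p by simp
      show "aob n (g \<otimes>\<^bsub>grp \<Lambda> n\<^esub> h) x = aob n g (aob n h x)"
        unfolding p(1) aob_def prod.case using p(2) g h act_mult[OF c c', unfolded p(3)]
          by (simp add: inv_mult_group m_assoc)
    }
    {
      fix x assume x: "x \<in> Ar ?B"
      obtain p p' us where p: "x = ((p, p'), us)" "p \<in> carrier (grp \<Lambda> n)" "p' \<in> carrier (grp \<Lambda> n)"
        "length us = n" "set us \<subseteq> Ar X"
        using x by (auto simp: d)
      have c: "g \<in> carrier (grp \<Lambda> (length us))" using g p by simp
      show "aar n g x \<in> Ar ?B" using p g set_act[OF c] by (simp add: d)
      show "src ?B (aar n g x) = aob n g (src ?B x)" "tgt ?B (aar n g x) = aob n g (tgt ?B x)"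
        using p g by (simp_all add: d act_map[OF c])
      {
        fix h assume h: "h \<in> carrier (grp \<Lambda> n)"
        then have c': "h \<in> carrier (grp \<Lambda> (length us))" using p by simp
        show "aar n (g \<otimes>\<^bsub>grp \<Lambda> n\<^esub> h) x = aar n g (aar n h x)"
          unfolding p(1) aar_def prod.case using p(2,3) g h act_mult[OF c c', unfolded p(4)]
            by (simp add: inv_mult_group m_assoc)
      }
      fix y assume y: "y \<in> Ar ?B"
      obtain q q' vs where q: "y = ((q, q'), vs)" "q \<in> carrier (grp \<Lambda> n)" "q' \<in> carrier (grp \<Lambda> n)"
        "length vs = n" "set vs \<subseteq> Ar X"
        using y by (auto simp: d)
      have "act \<Lambda> g (zip vs us) = zip (act \<Lambda> g vs) (act \<Lambda> g us)"
        using act_zip[of g vs us] g p q by simp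
      moreover have "act \<Lambda> g (map f (zip vs us)) = map f (act \<Lambda> g (zip vs us))" for f :: "_ \<Rightarrow> 'b"
        using act_map[of g "zip vs us" f] g p q by simp
      ultimately show "cmp ?B (aar n g y) (aar n g x) = aar n g (cmp ?B y x)"
        using p q g by (simp add: d)
    }
  next
    fix x assume x: "x \<in> Ob ?B"
    then show "aob n \<one>\<^bsub>grp \<Lambda> n\<^esub> x = x" by (auto simp: d act_one monoid.r_one[OF group.is_monoid[OF grp]] monoid.inv_one[OF group.is_monoid[OF grp]])
    show "rel_ob \<Lambda> n `` {x} = (\<lambda>g. aob n g x) ` carrier (grp \<Lambda> n)"
      using x rel_ob_class[of "fst x" n "snd x"]
      by (simp add: prod_cat_def EL_def indisc_def pow_cat_def mem_Times_iff)
  next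
    fix x assume x: "x \<in> Ar ?B"
    then show "aar n \<one>\<^bsub>grp \<Lambda> n\<^esub> x = x" by (auto simp: d act_one monoid.r_one[OF group.is_monoid[OF grp]] monoid.inv_one[OF group.is_monoid[OF grp]])
    show "rel_ar \<Lambda> n `` {x} = (\<lambda>g. aar n g x) ` carrier (grp \<Lambda> n)"
      using x rel_ar_class[of "fst (fst x)" n "snd (fst x)" "snd x"]
      by (simp add: prod_cat_def EL_def indisc_def pow_cat_def mem_Times_iff)
  qed
qed

definition right_act :: "nat \<Rightarrow> ('l \<times> ('l \<times> 'o list), ('l \<times> 'l) \<times> ('l \<times> 'm list),
    'l \<times> 'o list, ('l \<times> 'l) \<times> 'm list) ftor" where
  "right_act n = \<lparr>fob = \<lambda>(p, g, xs). (p \<otimes>\<^bsub>grp \<Lambda> n\<^esub> g, xs),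
     far = \<lambda>((p, p'), g, us). ((p \<otimes>\<^bsub>grp \<Lambda> n\<^esub> g, p' \<otimes>\<^bsub>grp \<Lambda> n\<^esub> g), us)\<rparr>"

definition left_act :: "nat \<Rightarrow> ('l \<times> ('l \<times> 'o list), ('l \<times> 'l) \<times> ('l \<times> 'm list),
    'l \<times> 'o list, ('l \<times> 'l) \<times> 'm list) ftor" where
  "left_act n = \<lparr>fob = \<lambda>(p, g, xs). (p, act \<Lambda> g xs), far = \<lambda>(e, g, us). (e, act \<Lambda> g us)\<rparr>"

definition tensor_proj :: "nat \<Rightarrow> ('l \<times> 'o list, ('l \<times> 'l) \<times> 'm list,
    ('l \<times> 'o list) set, (('l \<times> 'l) \<times> 'm list) set) ftor" where
  "tensor_proj n = \<lparr>fob = \<lambda>x. rel_ob \<Lambda> n `` {x}, far = \<lambda>u. rel_ar \<Lambda> n `` {u}\<rparr>"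

lemma tensor_coequalizer:
  assumes X: "category X"
  shows "coequalizer TYPE(('z, 'y) cat)
    (prod_cat (EL \<Lambda> n) (prod_cat (disc (carrier (grp \<Lambda> n))) (pow_cat n X)))
    (prod_cat (EL \<Lambda> n) (pow_cat n X)) (tensor \<Lambda> n X) (right_act n) (left_act n) (tensor_proj n)"
proof -
  interpret group "grp \<Lambda> n" by (rule grp)
  interpret fa: free_cat_action "grp \<Lambda> n" "prod_cat (EL \<Lambda> n) (pow_cat n X)" "aob n" "aar n"
    "rel_ob \<Lambda> n" "rel_ar \<Lambda> n" using X by (rule free_cat_action_tensor)
  let ?S = "prod_cat (EL \<Lambda> n) (prod_cat (disc (carrier (grp \<Lambda> n))) (pow_cat n X))"
  let ?B = "prod_cat (EL \<Lambda> n) (pow_cat n X)"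
  have pr: "fa.proj = tensor_proj n" by (simp add: fa.proj_def tensor_proj_def)
  have tq: "quot_cat ?B (rel_ob \<Lambda> n) (rel_ar \<Lambda> n) = tensor \<Lambda> n X" by (simp add: tensor_def)
  have inv: "(\<forall>g\<in>carrier (grp \<Lambda> n). (\<forall>x\<in>Ob ?B. fob H (aob n g x) = fob H x) \<and>
       (\<forall>u\<in>Ar ?B. far H (aar n g u) = far H u))"
    if H: "feq ?S (H \<circ>\<circ> right_act n) (H \<circ>\<circ> left_act n)" for H :: "(_, _, 'h, 'i) ftor"
  proof (intro ballI conjI)
    fix g x assume g: "g \<in> carrier (grp \<Lambda> n)" and x: "x \<in> Ob ?B"
    obtain p xs where p: "x = (p, xs)" by fastforce
    have "(p \<otimes>\<^bsub>grp \<Lambda> n\<^esub> inv\<^bsub>grp \<Lambda> n\<^esub> g, g, xs) \<in> Ob ?S"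
      using g x p by (auto simp: prod_cat_def EL_def indisc_def disc_def)
    then have "fob (H \<circ>\<circ> right_act n) (p \<otimes>\<^bsub>grp \<Lambda> n\<^esub> inv\<^bsub>grp \<Lambda> n\<^esub> g, g, xs) =
       fob (H \<circ>\<circ> left_act n) (p \<otimes>\<^bsub>grp \<Lambda> n\<^esub> inv\<^bsub>grp \<Lambda> n\<^esub> g, g, xs)"
      using H unfolding feq_def by blast
    then show "fob H (aob n g x) = fob H x" using g x p
      by (auto simp: right_act_def left_act_def aob_def prod_cat_def EL_def indisc_def)
  next
    fix g x assume g: "g \<in> carrier (grp \<Lambda> n)" and x: "x \<in> Ar ?B"
    obtain p p' xs where p: "x = ((p, p'), xs)" by (metis surj_pair)
    have "((p \<otimes>\<^bsub>grp \<Lambda> n\<^esub> inv\<^bsub>grp \<Lambda> n\<^esub> g, p' \<otimes>\<^bsub>grp \<Lambda> n\<^esub> inv\<^bsub>grp \<Lambda> n\<^esub> g), g, xs) \<in> Ar ?S"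
      using g x p by (auto simp: prod_cat_def EL_def indisc_def disc_def)
    then have "far (H \<circ>\<circ> right_act n) ((p \<otimes>\<^bsub>grp \<Lambda> n\<^esub> inv\<^bsub>grp \<Lambda> n\<^esub> g, p' \<otimes>\<^bsub>grp \<Lambda> n\<^esub> inv\<^bsub>grp \<Lambda> n\<^esub> g), g, xs) =
       far (H \<circ>\<circ> left_act n) ((p \<otimes>\<^bsub>grp \<Lambda> n\<^esub> inv\<^bsub>grp \<Lambda> n\<^esub> g, p' \<otimes>\<^bsub>grp \<Lambda> n\<^esub> inv\<^bsub>grp \<Lambda> n\<^esub> g), g, xs)"
      using H unfolding feq_def by blast
    then show "far H (aar n g x) = far H x" using g x p
      by (auto simp: right_act_def left_act_def aar_def prod_cat_def EL_def indisc_def)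
  qed
  have S: "category ?S" using X by (simp add: category_prod category_disc EL_def category_indisc category_pow)
  have r: "is_functor ?S ?B (right_act n)"
    by (auto simp: is_functor_def right_act_def prod_cat_def EL_def indisc_def disc_def)
  have l: "is_functor ?S ?B (left_act n)"
    by (auto simp: is_functor_def left_act_def prod_cat_def EL_def indisc_def disc_def pow_cat_def
          set_act act_map act_zip)
  have co: "feq ?S (tensor_proj n \<circ>\<circ> right_act n) (tensor_proj n \<circ>\<circ> left_act n)"
    (is "feq _ ?r ?l")
    unfolding feq_def
  proof (intro conjI ballI)
    fix x assume x: "x \<in> Ob ?S"
    then obtain p g xs where p: "x = (p, g, xs)" "p \<in> carrier (grp \<Lambda> n)" "g \<in> carrier (grp \<Lambda> n)" "xs \<in> Ob (pow_cat n X)"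
      by (auto simp: prod_cat_def EL_def indisc_def disc_def)
    have "(p \<otimes>\<^bsub>grp \<Lambda> n\<^esub> g, xs) \<in> Ob ?B" using p by (auto simp: prod_cat_def EL_def indisc_def)
    from fa.proj_am(1)[OF p(3) this, symmetric] p(1)
    show "fob ?r x = fob ?l x"
      by (simp add: pr right_act_def left_act_def aob_right[OF p(2,3)])
  next
    fix x assume x: "x \<in> Ar ?S"
    then obtain p p' g xs where p: "x = ((p, p'), g, xs)" "p \<in> carrier (grp \<Lambda> n)" "p' \<in> carrier (grp \<Lambda> n)"
       "g \<in> carrier (grp \<Lambda> n)" "xs \<in> Ar (pow_cat n X)"
      by (auto simp: prod_cat_def EL_def indisc_def disc_def)
    have "((p \<otimes>\<^bsub>grp \<Lambda> n\<^esub> g, p' \<otimes>\<^bsub>grp \<Lambda> n\<^esub> g), xs) \<in> Ar ?B" using p by (auto simp: prod_cat_def EL_def indisc_def)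
    from fa.proj_am(2)[OF p(4) this, symmetric] p(1)
    show "far ?r x = far ?l x"
      by (simp add: pr right_act_def left_act_def aar_right[OF p(2-4)])
  qed
  show ?thesis unfolding coequalizer_def
  proof (intro conjI allI impI; (elim conjE)?)
    fix Z :: "('z, 'y) cat" and H
    assume H: "is_functor ?B Z H" "feq ?S (H \<circ>\<circ> right_act n) (H \<circ>\<circ> left_act n)"
    show "\<exists>K. is_functor (tensor \<Lambda> n X) Z K \<and> feq ?B (K \<circ>\<circ> tensor_proj n) H \<and>
      (\<forall>K'. is_functor (tensor \<Lambda> n X) Z K' \<and> feq ?B (K' \<circ>\<circ> tensor_proj n) H \<longrightarrow> feq (tensor \<Lambda> n X) K' K)"
      by (rule fa.proj_universal[unfolded pr tq]) (use H inv[OF H(2)] in blast)+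
  qed (rule S fa.B fa.category_Q[unfolded tq] r l fa.functor_proj[unfolded pr tq] co)+
qed

end

end

theory Submission
  imports Defs
begin

text \<open>The free action of \<open>\<Lambda>(n)\<close> on \<open>E\<Lambda>(n)\<close> makes \<open>T X\<close> easy to describe: its arrows of arity
  \<open>n\<close> correspond to pairs of some \<open>g \<in> \<Lambda>(n)\<close> and a list of \<open>n\<close> arrows of \<open>X\<close>. In these terms \<open>T F\<close> applies
  \<open>F\<close> to the list, the unit is \<open>u \<mapsto> (1, [u])\<close>, and the multiplication is
  \<open>(g, [(h\<^sub>1, us\<^sub>1), \<dots>, (h\<^sub>n, us\<^sub>n)]) \<mapsto> (\<mu>(g; h\<^sub>1, \<dots>, h\<^sub>n), us\<^sub>1 \<dots> us\<^sub>n)\<close>. A square of categories is a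
  2-pullback as soon as it is a pullback on arrows, and for the three kinds of squares this is now
  immediate; for the multiplication, a list of arrows of \<open>X\<close> is cut into blocks in the way
  prescribed by its image in \<open>Y\<close>. That the multiplication has the stated form rests on the
  compatibility of \<open>\<mu>\<close> with the projection to the symmetric groups and with the group
  structures.\<close>

subsection \<open>Pullbacks of categories and of lists\<close>

text \<open>Objects are carried along by their identities: the unique arrow over a matching pair of
  identities has as its source the object that is wanted.\<close>

lemma two_pullback_of_arrows:
  assumes sq: "commuting_square P A B C p q f g"
    and ar: "\<And>u v. u \<in> Ar A \<Longrightarrow> v \<in> Ar B \<Longrightarrow> far f u = far g v \<Longrightarrow>
      \<exists>!w. w \<in> Ar P \<and> far p w = u \<and> far q w = v"
  shows "two_pullback TYPE(('w, 'v) cat) P A B C p q f g"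
proof -
  have cat: "category P" "category A" "category B" "category C"
    and fn: "is_functor P A p" "is_functor P B q" "is_functor A C f" "is_functor B C g"
    using sq by (auto simp: commuting_square_def)
  have id: "ident P z \<in> Ar P" "far p (ident P z) = ident A (fob p z)" "far q (ident P z) = ident B (fob q z)"
    "src P (ident P z) = z" if "z \<in> Ob P" for z
    using cat(1) fn that by (auto simp: category_def is_functor_def)
  have "\<exists>!z. z \<in> Ob P \<and> fob p z = x \<and> fob q z = y"
    if xy: "x \<in> Ob A" "y \<in> Ob B" "fob f x = fob g y" for x y
  proof -
    have i: "ident A x \<in> Ar A" "ident B y \<in> Ar B" "src A (ident A x) = x" "src B (ident B y) = y"
      using cat xy by (auto simp: category_def)
    have "far f (ident A x) = far g (ident B y)" using fn xy by (simp add: is_functor_def)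
    from ar[OF i(1,2) this] obtain w where w: "w \<in> Ar P" "far p w = ident A x" "far q w = ident B y"
      and uniq: "\<And>w'. w' \<in> Ar P \<Longrightarrow> far p w' = ident A x \<Longrightarrow> far q w' = ident B y \<Longrightarrow> w' = w"
      by metis
    have s: "src P w \<in> Ob P" using w cat(1) by (auto simp: category_def)
    have "src A (far p w) = fob p (src P w)" "src B (far q w) = fob q (src P w)"
      using fn w(1) by (auto simp: is_functor_def)
    then have "fob p (src P w) = x" "fob q (src P w) = y" using w i by simp_all
    \<comment> \<open>For uniqueness, the identity of any object over \<open>x\<close> and
      \<open>y\<close> is an arrow over the two identities, hence equals \<open>w\<close>, and its
      source is that object.\<close>
    with s show ?thesis by (intro ex1I[of _ "src P w"]) (metis id uniq)+
  qed
  then have "pointwise_pullback P A B p q f g"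
    using ar unfolding pointwise_pullback_def by blast
  then show ?thesis using sq property_of_pointwise unfolding two_pullback_def by blast
qed

text \<open>The value of a functor on an object is the source of its value on the identity.
  Commutation of squares can thus be checked on arrows, where normal forms are at hand.\<close>

lemma feq_of_arrows:
  assumes "category A" "is_functor A B F" "is_functor A B G" "category B"
    and ar: "\<And>u. u \<in> Ar A \<Longrightarrow> far F u = far G u"
  shows "feq A F G"
proof -
  have "fob F x = fob G x" if x: "x \<in> Ob A" for x
  proof -
    have i: "ident A x \<in> Ar A" "src A (ident A x) = x" using assms x by (auto simp: category_def)
    have "src B (far F (ident A x)) = fob F x" "src B (far G (ident A x)) = fob G x"
      using assms(2,3) i by (auto simp: is_functor_def)
    then show ?thesis using ar[OF i(1)] by simp
  qed
  then show ?thesis using ar by (simp add: feq_def)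
qed

lemma category_coprod:
  assumes "\<And>i. category (A i)" shows "category (coprod_cat A)"
  using assms unfolding category_def coprod_cat_def by fastforce

text \<open>Equal images force equal lengths, and the unique fillers are then chosen entry by
  entry.\<close>

lemma list_pullback:
  assumes ex1: "\<And>x y. x \<in> A \<Longrightarrow> y \<in> B \<Longrightarrow> f x = g y \<Longrightarrow> \<exists>!z. z \<in> P \<and> p z = x \<and> q z = y"
    and "set xs \<subseteq> A" "set ys \<subseteq> B" "map f xs = map g ys"
  shows "\<exists>!zs. set zs \<subseteq> P \<and> map p zs = xs \<and> map q zs = ys"
proof -
  have "length xs = length ys" using assms(4) by (rule map_eq_imp_length_eq)
  then show ?thesis using assms(2-4)
  proof (induction xs ys rule: list_induct2)
    case Nil
    show ?case by (rule ex1I[of _ "[]"]) simp_all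
  next
    case (Cons x xs y ys)
    then have "\<exists>!zs. set zs \<subseteq> P \<and> map p zs = xs \<and> map q zs = ys" by simp
    then obtain zs where zs: "set zs \<subseteq> P" "map p zs = xs" "map q zs = ys"
      and uniq_zs: "\<And>zs'. set zs' \<subseteq> P \<Longrightarrow> map p zs' = xs \<Longrightarrow> map q zs' = ys \<Longrightarrow> zs' = zs" by blast
    have "\<exists>!z. z \<in> P \<and> p z = x \<and> q z = y" using Cons.prems by (intro ex1) simp_all
    then obtain z where z: "z \<in> P" "p z = x" "q z = y"
      and uniq_z: "\<And>z'. z' \<in> P \<Longrightarrow> p z' = x \<Longrightarrow> q z' = y \<Longrightarrow> z' = z" by blast
    show ?case
    proof (rule ex1I[of _ "z # zs"])
      fix ws assume "set ws \<subseteq> P \<and> map p ws = x # xs \<and> map q ws = y # ys"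
      then show "ws = z # zs" using uniq_z uniq_zs by (cases ws) auto
    qed (use z zs in simp)
  qed
qed

subsection \<open>Lists cut into blocks\<close>

lemma blk_start_Suc: "i < length ks \<Longrightarrow> blk_start ks (Suc i) = blk_start ks i + ks ! i"
  by (simp add: blk_start_def take_Suc_conv_app_nth)

lemma blk_start_mono: "i \<le> j \<Longrightarrow> blk_start ks i \<le> blk_start ks j"
  by (metis blk_start_def le_add1 le_Suc_ex sum_list_append take_add)

lemma blk_start_less_sum: "i < length ks \<Longrightarrow> a < ks ! i \<Longrightarrow> blk_start ks i + a < sum_list ks"
  using blk_start_mono[of "Suc i" "length ks" ks] blk_start_Suc[of i ks] by (simp add: blk_start_def)

text \<open>Together with \<open>blk_start_cases\<close> this makes pairs of a block number and an
  offset within that block into coordinates for the positions below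
  \<open>sum_list ks\<close>.\<close>

lemma blk_blk_start:
  assumes "i < length ks" "a < ks ! i" shows "blk ks (blk_start ks i + a) = i"
  unfolding blk_def
proof (rule Least_equality)
  show "blk_start ks i + a < blk_start ks (Suc i)" using assms by (simp add: blk_start_Suc)
  fix j assume "blk_start ks i + a < blk_start ks (Suc j)"
  \<comment> \<open>If \<open>j < i\<close>, block \<open>j\<close> would end no later than block
    \<open>i\<close> starts, so the position could not lie before that end.\<close>
  then show "i \<le> j" using blk_start_mono[of "Suc j" i ks] by (meson le_add1 not_le not_less_eq_eq order.strict_trans1)
qed

lemma blk_start_cases:
  assumes "x < sum_list ks"
  obtains i a where "i < length ks" "a < ks ! i" "x = blk_start ks i + a"
  using assms
proof (induction ks arbitrary: x thesis)
  case (Cons k ks)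
  show ?case
  proof (cases "x < k")
    case True
    then show ?thesis using Cons.prems(1)[of 0 x] by (simp add: blk_start_def)
  next
    case False
    then have "x - k < sum_list ks" using Cons.prems(2) by simp
    then obtain i a where "i < length ks" "a < ks ! i" "x - k = blk_start ks i + a"
      using Cons.IH by metis
    then show ?thesis using False Cons.prems(1)[of "Suc i" a] by (simp add: blk_start_def)
  qed
qed simp

text \<open>Ties the arithmetic of positions in block permutations to concatenation of
  lists.\<close>

lemma nth_concat_blk:
  "i < length xss \<Longrightarrow> a < length (xss ! i) \<Longrightarrow>
    concat xss ! (blk_start (map length xss) i + a) = xss ! i ! a"
proof (induction xss arbitrary: i)
  case (Cons xs xss)
  then show ?case by (cases i) (simp_all add: blk_start_def nth_append)
qed simp

lemma blk_start_sum: "m \<le> length ks \<Longrightarrow> blk_start ks m = (\<Sum>j<m. ks ! j)"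
  by (induction m) (simp_all add: blk_start_Suc, simp add: blk_start_def)

text \<open>The block lengths are all that concatenation forgets. This gives uniqueness of the
  filler in the squares of the multiplication.\<close>

lemma concat_unique:
  assumes "concat xss = concat yss" "map length xss = map length yss" shows "xss = yss"
proof -
  have "length xss = length yss" using assms(2) by (rule map_eq_imp_length_eq)
  then show ?thesis using assms by (induction xss yss rule: list_induct2) auto
qed

text \<open>The list \<open>us\<close> is cut where its image is cut. This gives existence of the
  filler in the squares of the multiplication.\<close>

lemma map_eq_concat:
  assumes "map f us = concat vss"
  obtains uss where "us = concat uss" "map (map f) uss = vss"
  using assms
proof (induction vss arbitrary: us thesis)
  case (Cons vs vss)
  then have "map f us = vs @ concat vss" by simp
  then obtain a b where "us = a @ b" "map f a = vs" "map f b = concat vss"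
    by (auto simp: map_eq_append_conv)
  with Cons.IH[of b] Cons.prems(1) show ?case by (metis concat.simps(2) list.simps(9))
qed simp

context act_op
begin

subsection \<open>Composition in an action operad and the action on lists\<close>

abbreviation args :: "nat list \<Rightarrow> 'l list \<Rightarrow> bool" where
  "args \<equiv> ops_list (\<lambda>k. carrier (grp \<Lambda> k))"

lemma args_iff: "args ks qs \<longleftrightarrow> length qs = length ks \<and> (\<forall>i<length ks. qs ! i \<in> carrier (grp \<Lambda> (ks ! i)))"
  unfolding ops_list_def list_all2_conv_all_nth by metis

lemma amu_closed:
  "p \<in> carrier (grp \<Lambda> (length ks)) \<Longrightarrow> args ks qs \<Longrightarrow> amu \<Lambda> ks p qs \<in> carrier (grp \<Lambda> (sum_list ks))"
  using AO by (simp add: action_operad_def operad_def underlying_operad_def)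

lemma aproj_amu:
  "p \<in> carrier (grp \<Lambda> (length ks)) \<Longrightarrow> args ks qs \<Longrightarrow> aproj \<Lambda> (sum_list ks) (amu \<Lambda> ks p qs) =
    block_perm ks (aproj \<Lambda> (length ks) p) \<circ> block_sum ks (map2 (aproj \<Lambda>) ks qs)"
  using AO by (simp add: action_operad_def operad_map_def underlying_operad_def perm_operad_def)

lemma amu_mult:
  assumes "g \<in> carrier (grp \<Lambda> (length ks))" "g' \<in> carrier (grp \<Lambda> (length ks))"
    "args ks fs" "args (act \<Lambda> g ks) fs'"
  shows "amu \<Lambda> (act \<Lambda> g ks) g' fs' \<otimes>\<^bsub>grp \<Lambda> (sum_list ks)\<^esub> amu \<Lambda> ks g fs =
    amu \<Lambda> ks (g' \<otimes>\<^bsub>grp \<Lambda> (length ks)\<^esub> g)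
      (map (\<lambda>i. fs' ! aproj \<Lambda> (length ks) g i \<otimes>\<^bsub>grp \<Lambda> (ks ! i)\<^esub> fs ! i) [0..<length ks])"
  using AO assms unfolding action_operad_def by blast

section \<open>Entries and block positions of permuted lists\<close>

lemma aproj_less:
  "g \<in> carrier (grp \<Lambda> n) \<Longrightarrow> i < n \<Longrightarrow> aproj \<Lambda> n g i < n"
  using permutes_in_image[OF aproj_permutes] by blast

text \<open>The definition of \<open>act\<close> reads entries through the inverse permutation;
  addressing them by \<open>aproj\<close> instead keeps inverses out of the later
  computations.\<close>

lemma nth_act:
  assumes "g \<in> carrier (grp \<Lambda> (length xs))" "i < length xs"
  shows "act \<Lambda> g xs ! aproj \<Lambda> (length xs) g i = xs ! i"
  using assms by (simp add: act_def permute_list_nth inv_permutes aproj_less permutes_inverses[OF aproj_permutes])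

text \<open>Every position is the image of some position under the permutation, so the entries at
  images determine the list.\<close>

lemma act_eqI:
  assumes g: "g \<in> carrier (grp \<Lambda> (length xs))" and l: "length ys = length xs"
    and e: "\<And>i. i < length xs \<Longrightarrow> ys ! aproj \<Lambda> (length xs) g i = xs ! i"
  shows "act \<Lambda> g xs = ys"
proof (rule nth_equalityI)
  fix j assume "j < length (act \<Lambda> g xs)"
  then have j: "j < length xs" by simp
  let ?i = "inv_into UNIV (aproj \<Lambda> (length xs) g) j"
  have "?i < length xs" using permutes_in_image[OF inv_permutes[OF g]] j by blast
  moreover have "aproj \<Lambda> (length xs) g ?i = j" using permutes_inverses[OF aproj_permutes[OF g]] by simp
  ultimately show "act \<Lambda> g xs ! j = ys ! j" using e[of ?i] nth_act[OF g, of ?i] by simp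
qed (use l in simp)

text \<open>The right-hand side is the offset used by \<open>block_perm\<close>, so a block
  permutation sends the start of block \<open>i\<close> to the start of the corresponding block of
  the permuted list.\<close>

lemma blk_start_act:
  assumes g: "g \<in> carrier (grp \<Lambda> (length ks))" and i: "i < length ks"
  shows "blk_start (act \<Lambda> g ks) (aproj \<Lambda> (length ks) g i) =
    (\<Sum>j\<in>{j. j < length ks \<and> aproj \<Lambda> (length ks) g j < aproj \<Lambda> (length ks) g i}. ks ! j)"
proof -
  let ?s = "aproj \<Lambda> (length ks) g"
  have p: "?s permutes {..<length ks}" using g by (rule aproj_permutes)
  have s: "?s i < length ks" using g i by (rule aproj_less)
  \<comment> \<open>The permutation matches the blocks placed before block \<open>i\<close> with the
    positions below its image; reindexing turns the sum over them into an initial sum of the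
    permuted list.\<close>
  have "bij_betw ?s {j. j < length ks \<and> ?s j < ?s i} {..<?s i}"
  proof (intro bij_betw_imageI)
    show "inj_on ?s {j. j < length ks \<and> ?s j < ?s i}" using permutes_inj[OF p] by (rule inj_on_subset) simp
    show "?s ` {j. j < length ks \<and> ?s j < ?s i} = {..<?s i}"
    proof (intro subset_antisym subsetI)
      fix m assume "m \<in> {..<?s i}"
      then have m: "m < ?s i" by simp
      then have "m \<in> ?s ` {..<length ks}" using permutes_image[OF p] s by simp
      then show "m \<in> ?s ` {j. j < length ks \<and> ?s j < ?s i}" using m by auto
    qed auto
  qed
  then have "(\<Sum>j<?s i. act \<Lambda> g ks ! j) = (\<Sum>j\<in>{j. j < length ks \<and> ?s j < ?s i}. act \<Lambda> g ks ! ?s j)"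
    by (rule sum.reindex_bij_betw[symmetric])
  also have "\<dots> = (\<Sum>j\<in>{j. j < length ks \<and> ?s j < ?s i}. ks ! j)"
    using g by (intro sum.cong) (auto simp: nth_act)
  finally show ?thesis using s by (simp add: blk_start_sum)
qed

text \<open>Since the projection to permutations preserves operadic composition, a composite acts in
  two stages: first the \<open>qs\<close> permute within the blocks, then \<open>p\<close> permutes
  the blocks.\<close>

lemma act_concat:
  assumes p: "p \<in> carrier (grp \<Lambda> (length xss))" and qs: "args (map length xss) qs"
  shows "act \<Lambda> (amu \<Lambda> (map length xss) p qs) (concat xss) = concat (act \<Lambda> p (map2 (act \<Lambda>) qs xss))"
proof -
  let ?ks = "map length xss" and ?yss = "map2 (act \<Lambda>) qs xss" and ?n = "length xss"
  let ?s = "aproj \<Lambda> ?n p"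
  have lq: "length qs = ?n" and q: "\<And>i. i < ?n \<Longrightarrow> qs ! i \<in> carrier (grp \<Lambda> (length (xss ! i)))"
    using qs by (simp_all add: args_iff)
  have ly: "length ?yss = ?n" "map length ?yss = ?ks"
    using lq by (auto simp: list_eq_iff_nth_eq)
  have N: "sum_list ?ks = length (concat xss)" by (simp add: length_concat)
  have mu: "amu \<Lambda> ?ks p qs \<in> carrier (grp \<Lambda> (length (concat xss)))"
    using amu_closed[of p ?ks qs] p qs N by simp
  have lact: "map length (act \<Lambda> p ?yss) = act \<Lambda> p ?ks"
    using act_map[of p ?yss length] p ly by simp
  show ?thesis
  proof (rule act_eqI[OF mu])
    \<comment> \<open>Permuting the blocks preserves the multiset of their lengths, hence the total
      length.\<close>
    have "mset (act \<Lambda> p ?yss) = mset ?yss"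
      using p ly by (simp add: act_def inv_permutes)
    then have "sum_list (map length (act \<Lambda> p ?yss)) = sum_list (map length ?yss)"
      by (metis mset_map sum_mset_sum_list)
    then show "length (concat (act \<Lambda> p ?yss)) = length (concat xss)"
      using ly N by (simp add: length_concat)
    fix x assume "x < length (concat xss)"
    then obtain i a where i: "i < ?n" "a < length (xss ! i)" and x: "x = blk_start ?ks i + a"
      using blk_start_cases[of x ?ks] N by auto
    let ?t = "aproj \<Lambda> (length (xss ! i)) (qs ! i)"
    have t: "?t a < length (xss ! i)" using q i by (simp add: aproj_less)
    have s: "?s i < ?n" using p i by (simp add: aproj_less)
    \<comment> \<open>Position \<open>a\<close> of block \<open>i\<close> is first moved to
      \<open>?t a\<close> inside its block, and then with the whole block to block
      \<open>?s i\<close>.\<close>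
    have "block_sum ?ks (map2 (aproj \<Lambda>) ?ks qs) x = blk_start ?ks i + ?t a"
      using i lq blk_start_less_sum[of i ?ks a] by (simp add: block_sum_def x blk_blk_start)
    then have pi: "aproj \<Lambda> (length (concat xss)) (amu \<Lambda> ?ks p qs) x =
        blk_start (map length (act \<Lambda> p ?yss)) (?s i) + ?t a"
      using i t aproj_amu[of p ?ks qs] p qs N blk_start_less_sum[of i ?ks "?t a"] blk_start_act[of p ?ks i]
      by (simp add: block_perm_def blk_blk_start lact)
    have y: "act \<Lambda> p ?yss ! ?s i = act \<Lambda> (qs ! i) (xss ! i)"
      using nth_act[of p ?yss i] p ly i lq by simp
    have "concat (act \<Lambda> p ?yss) ! aproj \<Lambda> (length (concat xss)) (amu \<Lambda> ?ks p qs) x =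
        act \<Lambda> (qs ! i) (xss ! i) ! ?t a"
      unfolding pi using s t ly y by (subst nth_concat_blk) simp_all
    also have "\<dots> = xss ! i ! a" using nth_act q i by blast
    also have "\<dots> = concat xss ! x" using i by (simp add: x nth_concat_blk)
    finally show "concat (act \<Lambda> p ?yss) ! aproj \<Lambda> (length (concat xss)) (amu \<Lambda> ?ks p qs) x = concat xss ! x" .
  qed
qed

text \<open>The compatibility axiom, applied to group units throughout, shows that this composite is
  idempotent, and the unit is the only idempotent of a group.\<close>

lemma amu_one:
  "amu \<Lambda> ks \<one>\<^bsub>grp \<Lambda> (length ks)\<^esub> (map (\<lambda>k. \<one>\<^bsub>grp \<Lambda> k\<^esub>) ks) = \<one>\<^bsub>grp \<Lambda> (sum_list ks)\<^esub>"
    (is "?e = _")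
proof -
  have o: "\<one>\<^bsub>grp \<Lambda> n\<^esub> \<in> carrier (grp \<Lambda> n)" for n using grp by (simp add: group.is_monoid)
  have oo: "\<one>\<^bsub>grp \<Lambda> n\<^esub> \<otimes>\<^bsub>grp \<Lambda> n\<^esub> \<one>\<^bsub>grp \<Lambda> n\<^esub> = \<one>\<^bsub>grp \<Lambda> n\<^esub>" for n
    using grp[of n] by (simp add: group.is_monoid)
  have a: "args ks (map (\<lambda>k. \<one>\<^bsub>grp \<Lambda> k\<^esub>) ks)" by (simp add: args_iff o)
  have m: "map (\<lambda>i. map (\<lambda>k. \<one>\<^bsub>grp \<Lambda> k\<^esub>) ks ! aproj \<Lambda> (length ks) \<one>\<^bsub>grp \<Lambda> (length ks)\<^esub> i
      \<otimes>\<^bsub>grp \<Lambda> (ks ! i)\<^esub> map (\<lambda>k. \<one>\<^bsub>grp \<Lambda> k\<^esub>) ks ! i) [0..<length ks] = map (\<lambda>k. \<one>\<^bsub>grp \<Lambda> k\<^esub>) ks"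
    by (rule nth_equalityI) (simp_all add: aproj_one oo)
  have "?e \<otimes>\<^bsub>grp \<Lambda> (sum_list ks)\<^esub> ?e = ?e"
    using amu_mult[OF o o a, of "map (\<lambda>k. \<one>\<^bsub>grp \<Lambda> k\<^esub>) ks"] a
    by (simp add: act_one oo m)
  then show ?thesis using group.l_cancel_one[OF grp] amu_closed[OF o a] by blast
qed

lemma one_closed [simp]: "\<one>\<^bsub>grp \<Lambda> n\<^esub> \<in> carrier (grp \<Lambda> n)"
  using grp by (simp add: group.is_monoid)

subsection \<open>The category T X\<close>

lemma Ob_T: "x \<in> Ob (T \<Lambda> X) \<longleftrightarrow>
    (\<exists>p xs. p \<in> carrier (grp \<Lambda> (length xs)) \<and> set xs \<subseteq> Ob X \<and> x = br_ob \<Lambda> p xs)"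
  by (cases x) (auto simp: T_def coprod_cat_def tensor_def quot_cat_def quotient_def prod_cat_def
    EL_def indisc_def pow_cat_def br_ob_def)

lemma Ar_T: "u \<in> Ar (T \<Lambda> X) \<longleftrightarrow>
    (\<exists>p p' us. p \<in> carrier (grp \<Lambda> (length us)) \<and> p' \<in> carrier (grp \<Lambda> (length us)) \<and>
      set us \<subseteq> Ar X \<and> u = br_ar \<Lambda> (p, p') us)"
  by (cases u) (auto simp: T_def coprod_cat_def tensor_def quot_cat_def quotient_def prod_cat_def
    EL_def indisc_def pow_cat_def br_ar_def)

lemma br_ob_in_T: "p \<in> carrier (grp \<Lambda> (length xs)) \<Longrightarrow> set xs \<subseteq> Ob X \<Longrightarrow> br_ob \<Lambda> p xs \<in> Ob (T \<Lambda> X)"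
  unfolding Ob_T by blast

lemma br_ar_in_T: "p \<in> carrier (grp \<Lambda> (length us)) \<Longrightarrow> p' \<in> carrier (grp \<Lambda> (length us)) \<Longrightarrow>
    set us \<subseteq> Ar X \<Longrightarrow> br_ar \<Lambda> (p, p') us \<in> Ar (T \<Lambda> X)"
  unfolding Ar_T by blast

lemma category_T: assumes "category X" shows "category (T \<Lambda> X)"
  unfolding T_def
proof (rule category_coprod)
  fix n
  interpret free_cat_action "grp \<Lambda> n" "prod_cat (EL \<Lambda> n) (pow_cat n X)" "aob n" "aar n"
    "rel_ob \<Lambda> n" "rel_ar \<Lambda> n" using assms by (rule free_cat_action_tensor)
  show "category (tensor \<Lambda> n X)" unfolding tensor_def by (rule category_Q)
qed

lemma src_tgt_br:
  assumes "category X" "p \<in> carrier (grp \<Lambda> (length us))" "p' \<in> carrier (grp \<Lambda> (length us))" "set us \<subseteq> Ar X"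
  shows "src (T \<Lambda> X) (br_ar \<Lambda> (p, p') us) = br_ob \<Lambda> p (map (src X) us)"
    "tgt (T \<Lambda> X) (br_ar \<Lambda> (p, p') us) = br_ob \<Lambda> p' (map (tgt X) us)"
proof -
  let ?n = "length us" let ?B = "prod_cat (EL \<Lambda> ?n) (pow_cat ?n X)"
  interpret free_cat_action "grp \<Lambda> ?n" ?B "aob ?n" "aar ?n" "rel_ob \<Lambda> ?n" "rel_ar \<Lambda> ?n"
    using assms(1) by (rule free_cat_action_tensor)
  have "((p, p'), us) \<in> Ar ?B" using assms by (simp add: prod_cat_def EL_def indisc_def pow_cat_def)
  note Q_src[OF this] Q_tgt[OF this]
  then show "src (T \<Lambda> X) (br_ar \<Lambda> (p, p') us) = br_ob \<Lambda> p (map (src X) us)"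
    "tgt (T \<Lambda> X) (br_ar \<Lambda> (p, p') us) = br_ob \<Lambda> p' (map (tgt X) us)"
    by (simp_all add: T_def coprod_cat_def br_ob_def br_ar_def tensor_def)
      (simp_all add: prod_cat_def EL_def indisc_def pow_cat_def)
qed

lemma ident_br:
  assumes "category X" "p \<in> carrier (grp \<Lambda> (length xs))" "set xs \<subseteq> Ob X"
  shows "ident (T \<Lambda> X) (br_ob \<Lambda> p xs) = br_ar \<Lambda> (p, p) (map (ident X) xs)"
proof -
  let ?n = "length xs" let ?B = "prod_cat (EL \<Lambda> ?n) (pow_cat ?n X)"
  interpret free_cat_action "grp \<Lambda> ?n" ?B "aob ?n" "aar ?n" "rel_ob \<Lambda> ?n" "rel_ar \<Lambda> ?n"
    using assms(1) by (rule free_cat_action_tensor)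
  have "(p, xs) \<in> Ob ?B" using assms by (simp add: prod_cat_def EL_def indisc_def pow_cat_def)
  from Q_ident[OF this] show ?thesis
    by (simp add: T_def coprod_cat_def br_ob_def br_ar_def tensor_def)
      (simp add: prod_cat_def EL_def indisc_def pow_cat_def)
qed

lemma cmp_br:
  assumes "category X" "length vs = length us" "p \<in> carrier (grp \<Lambda> (length us))"
    "p' \<in> carrier (grp \<Lambda> (length us))" "p'' \<in> carrier (grp \<Lambda> (length us))"
    "set us \<subseteq> Ar X" "set vs \<subseteq> Ar X" "map (src X) vs = map (tgt X) us"
  shows "cmp (T \<Lambda> X) (br_ar \<Lambda> (p', p'') vs) (br_ar \<Lambda> (p, p') us) = br_ar \<Lambda> (p, p'') (map2 (cmp X) vs us)"
proof -
  let ?n = "length us" let ?B = "prod_cat (EL \<Lambda> ?n) (pow_cat ?n X)"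
  interpret free_cat_action "grp \<Lambda> ?n" ?B "aob ?n" "aar ?n" "rel_ob \<Lambda> ?n" "rel_ar \<Lambda> ?n"
    using assms(1) by (rule free_cat_action_tensor)
  have "((p, p'), us) \<in> Ar ?B" "((p', p''), vs) \<in> Ar ?B" "src ?B ((p', p''), vs) = tgt ?B ((p, p'), us)"
    using assms by (simp_all add: prod_cat_def EL_def indisc_def pow_cat_def)
  from Q_cmp[OF this] assms(2) show ?thesis
    by (simp add: T_def coprod_cat_def br_ob_def br_ar_def tensor_def)
      (simp add: prod_cat_def EL_def indisc_def pow_cat_def)
qed

text \<open>Composability in \<open>T \<Lambda> X\<close> is equality of classes only. Translating a
  representative of \<open>D\<close> by a group element makes its target equal to the source of a
  chosen representative of \<open>E\<close>, so the two share the middle operation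
  \<open>p'\<close>.\<close>

lemma composable_br:
  assumes "category X" "D \<in> Ar (T \<Lambda> X)" "E \<in> Ar (T \<Lambda> X)" "src (T \<Lambda> X) E = tgt (T \<Lambda> X) D"
  obtains p p' p'' us vs where "p \<in> carrier (grp \<Lambda> (length us))"
    "p' \<in> carrier (grp \<Lambda> (length us))" "p'' \<in> carrier (grp \<Lambda> (length us))" "length vs = length us"
    "set us \<subseteq> Ar X" "set vs \<subseteq> Ar X" "map (src X) vs = map (tgt X) us"
    "D = br_ar \<Lambda> (p, p') us" "E = br_ar \<Lambda> (p', p'') vs"
proof -
  obtain r p'' vs where E: "r \<in> carrier (grp \<Lambda> (length vs))" "p'' \<in> carrier (grp \<Lambda> (length vs))"
    "set vs \<subseteq> Ar X" "E = br_ar \<Lambda> (r, p'') vs" using assms(3) Ar_T by metis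
  let ?n = "length vs" let ?B = "prod_cat (EL \<Lambda> ?n) (pow_cat ?n X)"
  interpret free_cat_action "grp \<Lambda> ?n" ?B "aob ?n" "aar ?n" "rel_ob \<Lambda> ?n" "rel_ar \<Lambda> ?n"
    using assms(1) by (rule free_cat_action_tensor)
  have e: "((r, p''), vs) \<in> Ar ?B" using E by (simp add: prod_cat_def EL_def indisc_def pow_cat_def)
  obtain n c where D: "D = (n, c)" by fastforce
  \<comment> \<open>Source and target keep the arity, hence both arrows have the same one.\<close>
  have n: "n = ?n" using assms(4) by (simp add: D E(4) T_def coprod_cat_def br_ar_def)
  have "c \<in> Ar Q" using assms(2) by (simp add: D n T_def coprod_cat_def tensor_def)
  moreover have "src Q (rel_ar \<Lambda> ?n `` {((r, p''), vs)}) = tgt Q c"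
    using assms(4) by (simp add: D n E(4) T_def coprod_cat_def br_ar_def tensor_def)
  ultimately obtain u where u: "u \<in> Ar ?B" "c = rel_ar \<Lambda> ?n `` {u}" "src ?B ((r, p''), vs) = tgt ?B u"
    using Q_composable[OF _ e] by metis
  then obtain p us where us: "u = ((p, r), us)" "p \<in> carrier (grp \<Lambda> ?n)" "length us = ?n"
    "set us \<subseteq> Ar X" "map (src X) vs = map (tgt X) us"
    by (auto simp: prod_cat_def EL_def indisc_def pow_cat_def)
  show thesis
    by (rule that[of p us r p'' vs]) (use us E u(2) D n in \<open>simp_all add: br_ar_def\<close>)
qed

text \<open>Functoriality is reduced to bracket representatives. For composition, pairs with a
  common middle operation suffice, by \<open>composable_br\<close>.\<close>

lemma functor_from_T:
  assumes X: "category X"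
    and ob: "\<And>p xs. p \<in> carrier (grp \<Lambda> (length xs)) \<Longrightarrow> set xs \<subseteq> Ob X \<Longrightarrow>
      fob F (br_ob \<Lambda> p xs) \<in> Ob Z \<and>
      far F (br_ar \<Lambda> (p, p) (map (ident X) xs)) = ident Z (fob F (br_ob \<Lambda> p xs))"
    and ar: "\<And>p p' us. p \<in> carrier (grp \<Lambda> (length us)) \<Longrightarrow> p' \<in> carrier (grp \<Lambda> (length us)) \<Longrightarrow>
      set us \<subseteq> Ar X \<Longrightarrow> far F (br_ar \<Lambda> (p, p') us) \<in> Ar Z \<and>
      src Z (far F (br_ar \<Lambda> (p, p') us)) = fob F (br_ob \<Lambda> p (map (src X) us)) \<and>
      tgt Z (far F (br_ar \<Lambda> (p, p') us)) = fob F (br_ob \<Lambda> p' (map (tgt X) us))"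
    and cmp: "\<And>p p' p'' us vs. p \<in> carrier (grp \<Lambda> (length us)) \<Longrightarrow>
      p' \<in> carrier (grp \<Lambda> (length us)) \<Longrightarrow> p'' \<in> carrier (grp \<Lambda> (length us)) \<Longrightarrow>
      length vs = length us \<Longrightarrow> set us \<subseteq> Ar X \<Longrightarrow> set vs \<subseteq> Ar X \<Longrightarrow>
      map (src X) vs = map (tgt X) us \<Longrightarrow> far F (br_ar \<Lambda> (p, p'') (map2 (cmp X) vs us)) =
        cmp Z (far F (br_ar \<Lambda> (p', p'') vs)) (far F (br_ar \<Lambda> (p, p') us))"
  shows "is_functor (T \<Lambda> X) Z F"
  unfolding is_functor_def
proof (intro conjI ballI impI)
  fix x assume "x \<in> Ob (T \<Lambda> X)"
  then obtain p xs where "p \<in> carrier (grp \<Lambda> (length xs))" "set xs \<subseteq> Ob X" "x = br_ob \<Lambda> p xs"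
    by (auto simp: Ob_T)
  then show "fob F x \<in> Ob Z" "far F (ident (T \<Lambda> X) x) = ident Z (fob F x)"
    using ob X by (simp_all add: ident_br)
next
  fix u assume "u \<in> Ar (T \<Lambda> X)"
  then obtain p p' us where "p \<in> carrier (grp \<Lambda> (length us))" "p' \<in> carrier (grp \<Lambda> (length us))"
    "set us \<subseteq> Ar X" "u = br_ar \<Lambda> (p, p') us" unfolding Ar_T by blast
  then show "far F u \<in> Ar Z" "src Z (far F u) = fob F (src (T \<Lambda> X) u)"
    "tgt Z (far F u) = fob F (tgt (T \<Lambda> X) u)"
    using ar X by (simp_all add: src_tgt_br)
next
  fix D E assume "D \<in> Ar (T \<Lambda> X)" "E \<in> Ar (T \<Lambda> X)" "src (T \<Lambda> X) E = tgt (T \<Lambda> X) D"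
  with X obtain p p' p'' us vs where
    r: "p \<in> carrier (grp \<Lambda> (length us))" "p' \<in> carrier (grp \<Lambda> (length us))"
    "p'' \<in> carrier (grp \<Lambda> (length us))" "length vs = length us" "set us \<subseteq> Ar X" "set vs \<subseteq> Ar X"
    "map (src X) vs = map (tgt X) us" and DE: "D = br_ar \<Lambda> (p, p') us" "E = br_ar \<Lambda> (p', p'') vs"
    by (rule composable_br)
  have "cmp (T \<Lambda> X) E D = br_ar \<Lambda> (p, p'') (map2 (cmp X) vs us)"
    unfolding DE by (rule cmp_br) (fact X r)+
  then show "far F (cmp (T \<Lambda> X) E D) = cmp Z (far F E) (far F D)"
    using cmp[OF r] DE by simp
qed

subsection \<open>The functor T F\<close>

text \<open>\<open>T_map\<close> takes the image of a whole class. As \<open>act\<close> commutes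
  with \<open>map\<close>, the image of an orbit is again a full orbit.\<close>

lemma fob_T_map:
  assumes "p \<in> carrier (grp \<Lambda> (length xs))"
  shows "fob (T_map F) (br_ob \<Lambda> p xs) = br_ob \<Lambda> p (map (fob F) xs)"
  using assms by (simp add: T_map_def br_ob_def rel_ob_class image_image aob_def act_map cong: image_cong)

lemma far_T_map:
  assumes "p \<in> carrier (grp \<Lambda> (length us))" "p' \<in> carrier (grp \<Lambda> (length us))"
  shows "far (T_map F) (br_ar \<Lambda> (p, p') us) = br_ar \<Lambda> (p, p') (map (far F) us)"
  using assms by (simp add: T_map_def br_ar_def rel_ar_class image_image aar_def act_map cong: image_cong)

lemma functor_T_map:
  assumes A: "category A" and B: "category B" and F: "is_functor A B F"
  shows "is_functor (T \<Lambda> A) (T \<Lambda> B) (T_map F)"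
proof (rule functor_from_T[OF A])
  have o: "set (map (fob F) xs) \<subseteq> Ob B" if "set xs \<subseteq> Ob A" for xs
    using F that by (auto simp: is_functor_def)
  have a: "set (map (far F) us) \<subseteq> Ar B" if "set us \<subseteq> Ar A" for us
    using F that by (auto simp: is_functor_def)
  {
    fix p xs assume p: "p \<in> carrier (grp \<Lambda> (length xs))" and xs: "set xs \<subseteq> Ob A"
    have "map (far F \<circ> ident A) xs = map (ident B \<circ> fob F) xs"
      using F xs by (auto simp: is_functor_def)
    moreover have "br_ob \<Lambda> p (map (fob F) xs) \<in> Ob (T \<Lambda> B)"
      using p o[OF xs] by (intro br_ob_in_T) simp_all
    ultimately show "fob (T_map F) (br_ob \<Lambda> p xs) \<in> Ob (T \<Lambda> B) \<and>
      far (T_map F) (br_ar \<Lambda> (p, p) (map (ident A) xs)) = ident (T \<Lambda> B) (fob (T_map F) (br_ob \<Lambda> p xs))"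
      using far_T_map[of p "map (ident A) xs" p F] ident_br[OF B, of p "map (fob F) xs"] p o[OF xs]
      by (simp only: length_map map_map fob_T_map)
  next
    fix p p' us
    assume p: "p \<in> carrier (grp \<Lambda> (length us))" "p' \<in> carrier (grp \<Lambda> (length us))" and us: "set us \<subseteq> Ar A"
    have "map (src B \<circ> far F) us = map (fob F \<circ> src A) us" "map (tgt B \<circ> far F) us = map (fob F \<circ> tgt A) us"
      using F us by (auto simp: is_functor_def)
    moreover have "br_ar \<Lambda> (p, p') (map (far F) us) \<in> Ar (T \<Lambda> B)"
      using p a[OF us] by (intro br_ar_in_T) simp_all
    ultimately show "far (T_map F) (br_ar \<Lambda> (p, p') us) \<in> Ar (T \<Lambda> B) \<and>
      src (T \<Lambda> B) (far (T_map F) (br_ar \<Lambda> (p, p') us)) = fob (T_map F) (br_ob \<Lambda> p (map (src A) us)) \<and>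
      tgt (T \<Lambda> B) (far (T_map F) (br_ar \<Lambda> (p, p') us)) = fob (T_map F) (br_ob \<Lambda> p' (map (tgt A) us))"
      using p src_tgt_br[OF B, of p "map (far F) us" p'] a[OF us] by (simp only: length_map map_map fob_T_map far_T_map)
  next
    fix p p' p'' us vs
    assume p: "p \<in> carrier (grp \<Lambda> (length us))" "p' \<in> carrier (grp \<Lambda> (length us))"
      "p'' \<in> carrier (grp \<Lambda> (length us))" and l: "length vs = length us"
      and us: "set us \<subseteq> Ar A" and vs: "set vs \<subseteq> Ar A" and e: "map (src A) vs = map (tgt A) us"
    have i: "us ! i \<in> Ar A" "vs ! i \<in> Ar A" "src A (vs ! i) = tgt A (us ! i)" if "i < length us" for i
      using us vs l that nth_map[of i vs "src A"] nth_map[of i us "tgt A"] e by (auto dest: nth_mem)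
    have "map (far F) (map2 (cmp A) vs us) = map2 (cmp B) (map (far F) vs) (map (far F) us)"
      using F i l by (auto intro!: nth_equalityI simp: is_functor_def)
    moreover have "map (src B) (map (far F) vs) = map (tgt B) (map (far F) us)"
      using F i l by (auto intro!: nth_equalityI simp: is_functor_def)
    ultimately show "far (T_map F) (br_ar \<Lambda> (p, p'') (map2 (cmp A) vs us)) =
        cmp (T \<Lambda> B) (far (T_map F) (br_ar \<Lambda> (p', p'') vs)) (far (T_map F) (br_ar \<Lambda> (p, p') us))"
      using p l cmp_br[OF B, of "map (far F) vs" "map (far F) us" p p' p''] a[OF us] a[OF vs]
        far_T_map[of p "map2 (cmp A) vs us" p'' F] by (simp only: length_map length_zip min.idem far_T_map)
  }
qed

subsection \<open>Normal forms\<close>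

text \<open>Since \<open>[p; xs] = [1; p \<cdot> xs]\<close> and \<open>[(p, p'); us] = [(1, p' p\<^sup>-\<^sup>1); p \<cdot> us]\<close>, every object of
  \<open>T X\<close> is \<open>nob xs\<close> for a unique list \<open>xs\<close>, and every arrow is \<open>nar g us\<close> for a unique \<open>g\<close> and \<open>us\<close>.\<close>

definition nf_ob :: "('l, 'o) tob \<Rightarrow> 'o list" where
  "nf_ob = (\<lambda>(n, c). the_elem ((\<lambda>(p, xs). act \<Lambda> p xs) ` c))"

definition nf_ar :: "('l, 'm) tar \<Rightarrow> 'l \<times> 'm list" where
  "nf_ar = (\<lambda>(n, c). the_elem ((\<lambda>((p, p'), us). (p' \<otimes>\<^bsub>grp \<Lambda> n\<^esub> inv\<^bsub>grp \<Lambda> n\<^esub> p, act \<Lambda> p us)) ` c))"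

definition nob :: "'o list \<Rightarrow> ('l, 'o) tob" where
  "nob xs = br_ob \<Lambda> \<one>\<^bsub>grp \<Lambda> (length xs)\<^esub> xs"

definition nar :: "'l \<Rightarrow> 'm list \<Rightarrow> ('l, 'm) tar" where
  "nar g us = br_ar \<Lambda> (\<one>\<^bsub>grp \<Lambda> (length us)\<^esub>, g) us"

lemma act_inv_act:
  assumes "p \<in> carrier (grp \<Lambda> (length xs))" "g \<in> carrier (grp \<Lambda> (length xs))"
  shows "act \<Lambda> (p \<otimes>\<^bsub>grp \<Lambda> (length xs)\<^esub> inv\<^bsub>grp \<Lambda> (length xs)\<^esub> g) (act \<Lambda> g xs) = act \<Lambda> p xs"
proof -
  have i: "inv\<^bsub>grp \<Lambda> (length xs)\<^esub> g \<in> carrier (grp \<Lambda> (length xs))" using closed(2)[OF assms(2,2)] .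
  show ?thesis
    using act_mult[of "p \<otimes>\<^bsub>grp \<Lambda> (length xs)\<^esub> inv\<^bsub>grp \<Lambda> (length xs)\<^esub> g" xs g, symmetric] assms closed(1)[OF assms(1) i]
    by (simp only: cancel)
qed

text \<open>Any representative consists of \<open>p \<otimes> inv g\<close> and
  \<open>act \<Lambda> g xs\<close> for some \<open>g\<close>, and the two factors cancel. Hence the
  image in \<open>nf_ob\<close> is a singleton and \<open>the_elem\<close> is meaningful.\<close>

lemma nf_ob_br:
  assumes "p \<in> carrier (grp \<Lambda> (length xs))"
  shows "nf_ob (br_ob \<Lambda> p xs) = act \<Lambda> p xs"
proof -
  let ?n = "length xs"
  have "(\<lambda>(p, xs). act \<Lambda> p xs) ` rel_ob \<Lambda> ?n `` {(p, xs)} = (\<lambda>g. act \<Lambda> p xs) ` carrier (grp \<Lambda> ?n)"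
    unfolding rel_ob_class[OF assms refl] image_image aob_def prod.case
    by (rule image_cong[OF refl]) (rule act_inv_act[OF assms])
  also have "\<dots> = {act \<Lambda> p xs}" using assms by blast
  finally show ?thesis by (simp add: nf_ob_def br_ob_def)
qed

text \<open>Changing the representative multiplies both endpoints on the right by the same
  \<open>inv g\<close>, which cancels in the quotient of the endpoints; the list part is as for
  objects.\<close>

lemma nf_ar_br:
  assumes p: "p \<in> carrier (grp \<Lambda> (length us))" and p': "p' \<in> carrier (grp \<Lambda> (length us))"
  shows "nf_ar (br_ar \<Lambda> (p, p') us) =
    (p' \<otimes>\<^bsub>grp \<Lambda> (length us)\<^esub> inv\<^bsub>grp \<Lambda> (length us)\<^esub> p, act \<Lambda> p us)" (is "_ = ?r")
proof -
  let ?n = "length us" let ?f = "\<lambda>((p, p'), us). (p' \<otimes>\<^bsub>grp \<Lambda> ?n\<^esub> inv\<^bsub>grp \<Lambda> ?n\<^esub> p, act \<Lambda> p us)"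
  interpret group "grp \<Lambda> ?n" by (rule grp)
  have "?f (aar ?n g ((p, p'), us)) = ?r" if g: "g \<in> carrier (grp \<Lambda> ?n)" for g
  proof -
    have "p' \<otimes>\<^bsub>grp \<Lambda> ?n\<^esub> inv\<^bsub>grp \<Lambda> ?n\<^esub> g \<otimes>\<^bsub>grp \<Lambda> ?n\<^esub> inv\<^bsub>grp \<Lambda> ?n\<^esub> (p \<otimes>\<^bsub>grp \<Lambda> ?n\<^esub> inv\<^bsub>grp \<Lambda> ?n\<^esub> g) =
      p' \<otimes>\<^bsub>grp \<Lambda> ?n\<^esub> inv\<^bsub>grp \<Lambda> ?n\<^esub> g \<otimes>\<^bsub>grp \<Lambda> ?n\<^esub> g \<otimes>\<^bsub>grp \<Lambda> ?n\<^esub> inv\<^bsub>grp \<Lambda> ?n\<^esub> p"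
      using p p' g by (simp only: inv_mult_group inv_inv inv_closed m_closed m_assoc)
    then show ?thesis using p p' g by (simp only: aar_def prod.case act_inv_act cancel)
  qed
  then have "?f ` rel_ar \<Lambda> ?n `` {((p, p'), us)} = (\<lambda>g. ?r) ` carrier (grp \<Lambda> ?n)"
    unfolding rel_ar_class[OF p p' refl] image_image by (intro image_cong) auto
  also have "\<dots> = {?r}" using p by blast
  finally show ?thesis by (simp add: nf_ar_def br_ar_def)
qed

text \<open>The representative is translated by \<open>p\<close> itself, which brings its operation
  to the unit.\<close>

lemma br_ob_nob:
  fixes xs :: "'o list"
  assumes p: "p \<in> carrier (grp \<Lambda> (length xs))"
  shows "br_ob \<Lambda> p xs = nob (act \<Lambda> p xs)"
proof -
  let ?n = "length xs"
  interpret group "grp \<Lambda> ?n" by (rule grp)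
  \<comment> \<open>The discrete category on the whole type serves as \<open>X\<close>, so that
    \<open>free_cat_action\<close> speaks about all lists with entries of this type.\<close>
  interpret fa: free_cat_action "grp \<Lambda> ?n" "prod_cat (EL \<Lambda> ?n) (pow_cat ?n (disc (UNIV :: 'o set)))"
    "aob ?n" "aar ?n" "rel_ob \<Lambda> ?n" "rel_ar \<Lambda> ?n" by (rule free_cat_action_tensor[OF category_disc])
  have "rel_ob \<Lambda> ?n `` {aob ?n p (p, xs)} = rel_ob \<Lambda> ?n `` {(p, xs)}"
    by (rule fa.orb_shift(1)[OF p]) (use p in \<open>simp add: prod_cat_def EL_def indisc_def pow_cat_def disc_def\<close>)
  then show ?thesis using p by (simp add: nob_def br_ob_def aob_def)
qed

lemma br_ar_nar:
  fixes us :: "'m list"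
  assumes p: "p \<in> carrier (grp \<Lambda> (length us))" and p': "p' \<in> carrier (grp \<Lambda> (length us))"
  shows "br_ar \<Lambda> (p, p') us = nar (p' \<otimes>\<^bsub>grp \<Lambda> (length us)\<^esub> inv\<^bsub>grp \<Lambda> (length us)\<^esub> p) (act \<Lambda> p us)"
proof -
  let ?n = "length us"
  interpret group "grp \<Lambda> ?n" by (rule grp)
  interpret fa: free_cat_action "grp \<Lambda> ?n" "prod_cat (EL \<Lambda> ?n) (pow_cat ?n (disc (UNIV :: 'm set)))"
    "aob ?n" "aar ?n" "rel_ob \<Lambda> ?n" "rel_ar \<Lambda> ?n" by (rule free_cat_action_tensor[OF category_disc])
  have "rel_ar \<Lambda> ?n `` {aar ?n p ((p, p'), us)} = rel_ar \<Lambda> ?n `` {((p, p'), us)}"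
    by (rule fa.orb_shift(2)[OF p]) (use p p' in \<open>simp add: prod_cat_def EL_def indisc_def pow_cat_def disc_def\<close>)
  then show ?thesis using p by (simp add: nar_def br_ar_def aar_def)
qed

lemma nf_ar_nar: "g \<in> carrier (grp \<Lambda> (length us)) \<Longrightarrow> nf_ar (nar g us) = (g, us)"
  using nf_ar_br[OF one_closed, of g us] monoid.r_one[OF group.is_monoid[OF grp], of g "length us"]
    monoid.inv_one[OF group.is_monoid[OF grp], of "length us"]
  by (simp only: nar_def act_one)

text \<open>\<open>nf_ar\<close> is a left inverse of \<open>nar\<close>. With
  \<open>Ar_T_cases\<close>, this identifies the arrows of \<open>T \<Lambda> X\<close> with pairs
  of a group element and a list.\<close>

lemma nar_eq_iff:
  "g \<in> carrier (grp \<Lambda> (length us)) \<Longrightarrow> h \<in> carrier (grp \<Lambda> (length vs)) \<Longrightarrow>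
    nar g us = nar h vs \<longleftrightarrow> g = h \<and> us = vs"
  using nf_ar_nar[of g us] nf_ar_nar[of h vs] by (metis prod.inject)

lemma nar_in_T: "g \<in> carrier (grp \<Lambda> (length us)) \<Longrightarrow> set us \<subseteq> Ar X \<Longrightarrow> nar g us \<in> Ar (T \<Lambda> X)"
  unfolding nar_def by (rule br_ar_in_T[OF one_closed])

lemma Ar_T_cases:
  assumes "u \<in> Ar (T \<Lambda> X)"
  obtains g us where "g \<in> carrier (grp \<Lambda> (length us))" "set us \<subseteq> Ar X" "u = nar g us"
proof -
  obtain p p' us where p: "p \<in> carrier (grp \<Lambda> (length us))" "p' \<in> carrier (grp \<Lambda> (length us))"
    and us: "set us \<subseteq> Ar X" and u: "u = br_ar \<Lambda> (p, p') us" using assms unfolding Ar_T by blast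
  show thesis
  proof (rule that)
    show "u = nar (p' \<otimes>\<^bsub>grp \<Lambda> (length us)\<^esub> inv\<^bsub>grp \<Lambda> (length us)\<^esub> p) (act \<Lambda> p us)"
      unfolding u using p by (rule br_ar_nar)
    show "p' \<otimes>\<^bsub>grp \<Lambda> (length us)\<^esub> inv\<^bsub>grp \<Lambda> (length us)\<^esub> p \<in> carrier (grp \<Lambda> (length (act \<Lambda> p us)))"
      unfolding length_act by (rule closed(1)[OF p(2) closed(2)[OF p(1,1)]])
    show "set (act \<Lambda> p us) \<subseteq> Ar X" using us by (simp only: set_act[OF p(1)])
  qed
qed

lemma far_T_map_nar:
  "g \<in> carrier (grp \<Lambda> (length us)) \<Longrightarrow> far (T_map F) (nar g us) = nar g (map (far F) us)"
  using far_T_map[OF one_closed, of g us F] by (simp add: nar_def)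

subsection \<open>The unit\<close>

lemma aid_closed: "aid \<Lambda> \<in> carrier (grp \<Lambda> (Suc 0))"
  using AO by (simp add: action_operad_def operad_def underlying_operad_def)

lemma functor_T_unit:
  assumes X: "category X" shows "is_functor X (T \<Lambda> X) (T_unit \<Lambda>)"
proof -
  note a = aid_closed
  show ?thesis
    unfolding is_functor_def T_unit_def ftor.simps
  proof (intro conjI ballI impI)
    fix x assume x: "x \<in> Ob X"
    show "br_ob \<Lambda> (aid \<Lambda>) [x] \<in> Ob (T \<Lambda> X)" by (rule br_ob_in_T) (use a x in simp_all)
    show "br_ar \<Lambda> (aid \<Lambda>, aid \<Lambda>) [ident X x] = ident (T \<Lambda> X) (br_ob \<Lambda> (aid \<Lambda>) [x])"
      using ident_br[OF X, of "aid \<Lambda>" "[x]"] a x by simp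
  next
    fix u assume u: "u \<in> Ar X"
    show "br_ar \<Lambda> (aid \<Lambda>, aid \<Lambda>) [u] \<in> Ar (T \<Lambda> X)" by (rule br_ar_in_T) (use a u in simp_all)
    show "src (T \<Lambda> X) (br_ar \<Lambda> (aid \<Lambda>, aid \<Lambda>) [u]) = br_ob \<Lambda> (aid \<Lambda>) [src X u]"
      "tgt (T \<Lambda> X) (br_ar \<Lambda> (aid \<Lambda>, aid \<Lambda>) [u]) = br_ob \<Lambda> (aid \<Lambda>) [tgt X u]"
      using src_tgt_br[OF X, of "aid \<Lambda>" "[u]" "aid \<Lambda>"] a u by simp_all
  next
    fix u v assume "u \<in> Ar X" "v \<in> Ar X" "src X v = tgt X u"
    then show "br_ar \<Lambda> (aid \<Lambda>, aid \<Lambda>) [cmp X v u] =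
        cmp (T \<Lambda> X) (br_ar \<Lambda> (aid \<Lambda>, aid \<Lambda>) [v]) (br_ar \<Lambda> (aid \<Lambda>, aid \<Lambda>) [u])"
      using cmp_br[OF X, of "[v]" "[u]" "aid \<Lambda>" "aid \<Lambda>" "aid \<Lambda>"] a by simp
  qed
qed

text \<open>The operadic identity \<open>aid\<close> stands at both endpoints, so their quotient is
  the group unit; it acts trivially because a permutation of one letter does.\<close>

lemma far_T_unit: "far (T_unit \<Lambda>) u = nar \<one>\<^bsub>grp \<Lambda> (Suc 0)\<^esub> [u]"
proof -
  note a = aid_closed
  have "act \<Lambda> (aid \<Lambda>) [u] = [u]"
    by (rule act_eqI) (use a aproj_less[OF a, of 0] in auto)
  then show ?thesis
    using br_ar_nar[of "aid \<Lambda>" "[u]" "aid \<Lambda>"] a group.r_inv[OF grp a] by (simp add: T_unit_def)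
qed

subsection \<open>The multiplication\<close>

lemma args_Nil [simp]: "args [] qs \<longleftrightarrow> qs = []"
  by (simp add: ops_list_def)

lemma args_Cons [simp]:
  "args (k # ks) (q # qs) \<longleftrightarrow> q \<in> carrier (grp \<Lambda> k) \<and> args ks qs"
  by (simp add: ops_list_def)

lemma args_length: "args ks qs \<Longrightarrow> length qs = length ks"
  by (simp add: args_iff)

text \<open>Arities and arguments are permuted simultaneously, so the same pairs occur.\<close>

lemma args_act:
  assumes p: "p \<in> carrier (grp \<Lambda> (length ks))" and hs: "args ks hs"
  shows "args (act \<Lambda> p ks) (act \<Lambda> p hs)"
proof -
  have "set (zip (act \<Lambda> p ks) (act \<Lambda> p hs)) = set (zip ks hs)"
    using p args_length[OF hs] act_zip[OF p, of hs] set_act[of p "zip ks hs"] by simp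
  then show ?thesis using hs by (simp add: ops_list_def list_all2_iff)
qed

text \<open>Multiplying the right-hand side by \<open>amu \<Lambda> ks p qs\<close> and applying the
  compatibility axiom cancels \<open>p\<close> and every \<open>qs ! i\<close>, leaving
  \<open>amu \<Lambda> ks p' qs'\<close>.\<close>

lemma amu_div:
  assumes p: "p \<in> carrier (grp \<Lambda> (length ks))" "p' \<in> carrier (grp \<Lambda> (length ks))"
    and qs: "args ks qs" "args ks qs'"
  shows "amu \<Lambda> ks p' qs' \<otimes>\<^bsub>grp \<Lambda> (sum_list ks)\<^esub> inv\<^bsub>grp \<Lambda> (sum_list ks)\<^esub> amu \<Lambda> ks p qs =
    amu \<Lambda> (act \<Lambda> p ks) (p' \<otimes>\<^bsub>grp \<Lambda> (length ks)\<^esub> inv\<^bsub>grp \<Lambda> (length ks)\<^esub> p)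
      (act \<Lambda> p (map (\<lambda>i. qs' ! i \<otimes>\<^bsub>grp \<Lambda> (ks ! i)\<^esub> inv\<^bsub>grp \<Lambda> (ks ! i)\<^esub> (qs ! i)) [0..<length ks]))"
    (is "_ = amu \<Lambda> _ ?g (act \<Lambda> p ?hs)")
proof -
  have q: "qs ! i \<in> carrier (grp \<Lambda> (ks ! i))" "qs' ! i \<in> carrier (grp \<Lambda> (ks ! i))" if "i < length ks" for i
    using qs that by (simp_all add: args_iff)
  have g: "?g \<in> carrier (grp \<Lambda> (length ks))" by (rule closed(1)[OF p(2) closed(2)[OF p(1,1)]])
  have hs: "args ks ?hs" using q by (auto simp: args_iff intro: closed(1) closed(2))
  have lh: "length ?hs = length ks" by simp
  \<comment> \<open>The axiom pairs \<open>qs ! i\<close> with the entry at the image of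
    \<open>i\<close> under \<open>p\<close>, which in the permuted list is the quotient at
    \<open>i\<close>.\<close>
  have "map (\<lambda>i. act \<Lambda> p ?hs ! aproj \<Lambda> (length ks) p i \<otimes>\<^bsub>grp \<Lambda> (ks ! i)\<^esub> qs ! i) [0..<length ks] = qs'"
  proof (rule nth_equalityI)
    fix i assume "i < length (map (\<lambda>i. act \<Lambda> p ?hs ! aproj \<Lambda> (length ks) p i \<otimes>\<^bsub>grp \<Lambda> (ks ! i)\<^esub> qs ! i) [0..<length ks])"
    then have i: "i < length ks" by simp
    have "act \<Lambda> p ?hs ! aproj \<Lambda> (length ks) p i = ?hs ! i"
      using nth_act[of p ?hs i] p i by simp
    then show "map (\<lambda>i. act \<Lambda> p ?hs ! aproj \<Lambda> (length ks) p i \<otimes>\<^bsub>grp \<Lambda> (ks ! i)\<^esub> qs ! i) [0..<length ks] ! i = qs' ! i"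
      using i q[OF i] by simp
  qed (use args_length[OF qs(2)] in simp)
  then have e: "amu \<Lambda> (act \<Lambda> p ks) ?g (act \<Lambda> p ?hs) \<otimes>\<^bsub>grp \<Lambda> (sum_list ks)\<^esub> amu \<Lambda> ks p qs = amu \<Lambda> ks p' qs'"
    using amu_mult[OF p(1) g qs(1) args_act[OF p(1) hs]] cancel(2)[OF p(2,1)] by simp
  \<comment> \<open>The composite lies in the group of arity \<open>sum_list ks\<close>, as
    permuting the arities preserves their sum.\<close>
  have c: "amu \<Lambda> (act \<Lambda> p ks) ?g (act \<Lambda> p ?hs) \<in> carrier (grp \<Lambda> (sum_list ks))"
  proof -
    have "mset (act \<Lambda> p ks) = mset ks" using p by (simp add: act_def inv_permutes)
    then have "sum_list (act \<Lambda> p ks) = sum_list ks" by (metis sum_mset_sum_list)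
    then show ?thesis using amu_closed[OF _ args_act[OF p(1) hs], of ?g] g by simp
  qed
  show ?thesis using cancel(1)[OF c amu_closed[OF p(1) qs(1)]] by (simp only: e)
qed

lemma nf_obs: "args (map length xss) qs \<Longrightarrow> map nf_ob (map2 (br_ob \<Lambda>) qs xss) = map2 (act \<Lambda>) qs xss"
  by (rule nth_equalityI) (auto simp: args_iff nf_ob_br)

lemma nf_ars:
  assumes "args (map length uss) qs" "args (map length uss) qs'"
  shows "map (fst \<circ> nf_ar) (map2 (br_ar \<Lambda>) (zip qs qs') uss) =
      map (\<lambda>i. qs' ! i \<otimes>\<^bsub>grp \<Lambda> (map length uss ! i)\<^esub> inv\<^bsub>grp \<Lambda> (map length uss ! i)\<^esub> (qs ! i))
        [0..<length (map length uss)]"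
    "map (snd \<circ> nf_ar) (map2 (br_ar \<Lambda>) (zip qs qs') uss) = map2 (act \<Lambda>) qs uss"
  using assms by (auto intro!: nth_equalityI simp: args_iff nf_ar_br)

text \<open>The right-hand sides of \<open>mult_ob_nf\<close> and \<open>mult_ar_nf\<close> depend on the classes only, so the values of
  the description operators in \<open>T_mult\<close> are well defined.\<close>

lemma mult_ob_nf:
  assumes p: "p \<in> carrier (grp \<Lambda> (length xss))" and qs: "args (map length xss) qs"
  shows "br_ob \<Lambda> (amu \<Lambda> (map length xss) p qs) (concat xss) =
    nob (concat (map nf_ob (nf_ob (br_ob \<Lambda> p (map2 (br_ob \<Lambda>) qs xss)))))"
proof -
  have l: "length (map2 (br_ob \<Lambda>) qs xss) = length xss" using args_length[OF qs] by simp
  have "map nf_ob (nf_ob (br_ob \<Lambda> p (map2 (br_ob \<Lambda>) qs xss))) = act \<Lambda> p (map2 (act \<Lambda>) qs xss)"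
    using p l nf_ob_br[of p "map2 (br_ob \<Lambda>) qs xss"] act_map[of p "map2 (br_ob \<Lambda>) qs xss" nf_ob] nf_obs[OF qs]
    by metis
  moreover have "amu \<Lambda> (map length xss) p qs \<in> carrier (grp \<Lambda> (length (concat xss)))"
    using amu_closed[of p "map length xss" qs] p qs by (simp add: length_concat)
  ultimately show ?thesis by (simp only: br_ob_nob act_concat[OF p qs])
qed

text \<open>The inner arities are recovered as the lengths of the lists in the inner normal forms,
  so that the whole expression is a function of \<open>z\<close>.\<close>

definition mult_nf :: "('l, ('l, 'm) tar) tar \<Rightarrow> ('l, 'm) tar" where
  "mult_nf z = nar (amu \<Lambda> (map (length \<circ> (snd \<circ> nf_ar)) (snd (nf_ar z))) (fst (nf_ar z))
      (map (fst \<circ> nf_ar) (snd (nf_ar z)))) (concat (map (snd \<circ> nf_ar) (snd (nf_ar z))))"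

lemma mult_ar_nf:
  assumes p: "p \<in> carrier (grp \<Lambda> (length uss))" "p' \<in> carrier (grp \<Lambda> (length uss))"
    and qs: "args (map length uss) qs" "args (map length uss) qs'"
  shows "br_ar \<Lambda> (amu \<Lambda> (map length uss) p qs, amu \<Lambda> (map length uss) p' qs') (concat uss) =
    mult_nf (br_ar \<Lambda> (p, p') (map2 (br_ar \<Lambda>) (zip qs qs') uss))"
proof -
  let ?ks = "map length uss" and ?cs = "map2 (br_ar \<Lambda>) (zip qs qs') uss"
  let ?hs = "map (\<lambda>i. qs' ! i \<otimes>\<^bsub>grp \<Lambda> (?ks ! i)\<^esub> inv\<^bsub>grp \<Lambda> (?ks ! i)\<^esub> (qs ! i)) [0..<length ?ks]"
  have l: "length ?cs = length uss" using args_length[OF qs(1)] args_length[OF qs(2)] by simp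
  have pc: "p \<in> carrier (grp \<Lambda> (length ?cs))" "p' \<in> carrier (grp \<Lambda> (length ?cs))" using p l by simp_all
  have pk: "p \<in> carrier (grp \<Lambda> (length ?ks))" "p' \<in> carrier (grp \<Lambda> (length ?ks))" using p by simp_all
  have nf: "nf_ar (br_ar \<Lambda> (p, p') ?cs) =
      (p' \<otimes>\<^bsub>grp \<Lambda> (length ?ks)\<^esub> inv\<^bsub>grp \<Lambda> (length ?ks)\<^esub> p, act \<Lambda> p ?cs)"
    using nf_ar_br[OF pc] l by (simp only: length_map)
  \<comment> \<open>Taking inner normal forms commutes with the outer permutation.\<close>
  have 1: "map (fst \<circ> nf_ar) (act \<Lambda> p ?cs) = act \<Lambda> p ?hs"
    unfolding act_map[OF pc(1), symmetric] nf_ars[OF qs] ..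
  have 2: "map (snd \<circ> nf_ar) (act \<Lambda> p ?cs) = act \<Lambda> p (map2 (act \<Lambda>) qs uss)"
    unfolding act_map[OF pc(1), symmetric] nf_ars[OF qs] ..
  have "map length (map2 (act \<Lambda>) qs uss) = ?ks"
    using args_length[OF qs(1)] by (auto intro!: nth_equalityI)
  then have 3: "map (length \<circ> (snd \<circ> nf_ar)) (act \<Lambda> p ?cs) = act \<Lambda> p ?ks"
    using act_map[of p "map2 (act \<Lambda>) qs uss" length] 2 p(1) args_length[OF qs(1)] by (simp flip: map_map)
  have N: "sum_list ?ks = length (concat uss)" by (simp add: length_concat)
  have m: "amu \<Lambda> ?ks p qs \<in> carrier (grp \<Lambda> (length (concat uss)))"
    "amu \<Lambda> ?ks p' qs' \<in> carrier (grp \<Lambda> (length (concat uss)))"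
    using amu_closed[OF pk(1) qs(1)] amu_closed[OF pk(2) qs(2)] N by simp_all
  \<comment> \<open>The normal form of the left-hand side consists of a quotient of two composites,
    handled by \<open>amu_div\<close>, and a permuted concatenation, handled by
    \<open>act_concat\<close>.\<close>
  show ?thesis
    unfolding mult_nf_def nf fst_conv snd_conv 1 2 3 br_ar_nar[OF m] act_concat[OF p(1) qs(1)]
      amu_div[OF pk qs, symmetric] N ..
qed

lemma fob_T_mult:
  assumes "p \<in> carrier (grp \<Lambda> (length xss))" "args (map length xss) qs"
  shows "fob (T_mult \<Lambda>) (br_ob \<Lambda> p (map2 (br_ob \<Lambda>) qs xss)) = br_ob \<Lambda> (amu \<Lambda> (map length xss) p qs) (concat xss)"
  unfolding T_mult_def ftor.simps
proof (rule the_equality)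
  fix w assume "\<exists>r ss yss. r \<in> carrier (grp \<Lambda> (length yss)) \<and> args (map length yss) ss \<and>
    br_ob \<Lambda> p (map2 (br_ob \<Lambda>) qs xss) = br_ob \<Lambda> r (map2 (br_ob \<Lambda>) ss yss) \<and>
    w = br_ob \<Lambda> (amu \<Lambda> (map length yss) r ss) (concat yss)"
  then show "w = br_ob \<Lambda> (amu \<Lambda> (map length xss) p qs) (concat xss)"
    using mult_ob_nf assms by metis
qed (use assms in blast)

lemma far_T_mult:
  assumes "p \<in> carrier (grp \<Lambda> (length uss))" "p' \<in> carrier (grp \<Lambda> (length uss))"
    "args (map length uss) qs" "args (map length uss) qs'"
  shows "far (T_mult \<Lambda>) (br_ar \<Lambda> (p, p') (map2 (br_ar \<Lambda>) (zip qs qs') uss)) =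
    br_ar \<Lambda> (amu \<Lambda> (map length uss) p qs, amu \<Lambda> (map length uss) p' qs') (concat uss)"
  unfolding T_mult_def ftor.simps
proof (rule the_equality)
  fix w assume "\<exists>r r' ss ss' vss. r \<in> carrier (grp \<Lambda> (length vss)) \<and> r' \<in> carrier (grp \<Lambda> (length vss)) \<and>
    args (map length vss) ss \<and> args (map length vss) ss' \<and>
    br_ar \<Lambda> (p, p') (map2 (br_ar \<Lambda>) (zip qs qs') uss) = br_ar \<Lambda> (r, r') (map2 (br_ar \<Lambda>) (zip ss ss') vss) \<and>
    w = br_ar \<Lambda> (amu \<Lambda> (map length vss) r ss, amu \<Lambda> (map length vss) r' ss') (concat vss)"
  then show "w = br_ar \<Lambda> (amu \<Lambda> (map length uss) p qs, amu \<Lambda> (map length uss) p' qs') (concat uss)"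
    using mult_ar_nf assms by metis
qed (use assms in blast)

text \<open>All source operations in normal form are units, and by \<open>amu_one\<close> so is
  their composite; hence the result is already in normal form.\<close>

lemma far_T_mult_nar:
  assumes g: "g \<in> carrier (grp \<Lambda> (length uss))" and hs: "args (map length uss) hs"
  shows "far (T_mult \<Lambda>) (nar g (map2 nar hs uss)) = nar (amu \<Lambda> (map length uss) g hs) (concat uss)"
proof -
  let ?os = "map (\<lambda>k. \<one>\<^bsub>grp \<Lambda> k\<^esub>) (map length uss)"
  have o: "args (map length uss) ?os" by (simp add: args_iff)
  have l: "length hs = length uss" using args_length[OF hs] by simp
  have "map2 nar hs uss = map2 (br_ar \<Lambda>) (zip ?os hs) uss"
    using l by (auto intro!: nth_equalityI simp: nar_def)
  then have "nar g (map2 nar hs uss) = br_ar \<Lambda> (\<one>\<^bsub>grp \<Lambda> (length uss)\<^esub>, g) (map2 (br_ar \<Lambda>) (zip ?os hs) uss)"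
    using l by (simp add: nar_def)
  then show ?thesis
    using far_T_mult[OF one_closed g o hs] amu_one[of "map length uss"] by (simp add: nar_def length_concat)
qed

section \<open>Representatives for lists of objects and arrows of \<open>T \<Lambda> X\<close>, and
  functoriality of the multiplication\<close>

lemma obs_T_cases:
  assumes "set cs \<subseteq> Ob (T \<Lambda> X)"
  obtains qs xss where "length xss = length cs" "args (map length xss) qs"
    "\<And>xs. xs \<in> set xss \<Longrightarrow> set xs \<subseteq> Ob X" "cs = map2 (br_ob \<Lambda>) qs xss"
  using assms
proof (induction cs arbitrary: thesis)
  case Nil
  show ?case by (rule Nil(1)[of "[]" "[]"]) simp_all
next
  case (Cons c cs)
  have "set cs \<subseteq> Ob (T \<Lambda> X)" using Cons.prems(2) by simp
  from Cons.IH[OF _ this] obtain qs xss where IH: "length xss = length cs" "args (map length xss) qs"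
    "\<And>xs. xs \<in> set xss \<Longrightarrow> set xs \<subseteq> Ob X" "cs = map2 (br_ob \<Lambda>) qs xss"
    by blast
  have "c \<in> Ob (T \<Lambda> X)" using Cons.prems(2) by simp
  then obtain p xs where "p \<in> carrier (grp \<Lambda> (length xs))" "set xs \<subseteq> Ob X" "c = br_ob \<Lambda> p xs"
    unfolding Ob_T by blast
  then show ?case by (intro Cons.prems(1)[of "xs # xss" "p # qs"]) (use IH in auto)
qed

lemma ars_T_cases:
  assumes "set cs \<subseteq> Ar (T \<Lambda> X)"
  obtains qs qs' uss where "length uss = length cs" "args (map length uss) qs" "args (map length uss) qs'"
    "\<And>us. us \<in> set uss \<Longrightarrow> set us \<subseteq> Ar X" "cs = map2 (br_ar \<Lambda>) (zip qs qs') uss"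
  using assms
proof (induction cs arbitrary: thesis)
  case Nil
  show ?case by (rule Nil(1)[of "[]" "[]" "[]"]) simp_all
next
  case (Cons c cs)
  have "set cs \<subseteq> Ar (T \<Lambda> X)" using Cons.prems(2) by simp
  from Cons.IH[OF _ this] obtain qs qs' uss where IH: "length uss = length cs" "args (map length uss) qs" "args (map length uss) qs'"
    "\<And>us. us \<in> set uss \<Longrightarrow> set us \<subseteq> Ar X" "cs = map2 (br_ar \<Lambda>) (zip qs qs') uss"
    by blast
  have "c \<in> Ar (T \<Lambda> X)" using Cons.prems(2) by simp
  then obtain p p' us where "p \<in> carrier (grp \<Lambda> (length us))" "p' \<in> carrier (grp \<Lambda> (length us))"
    "set us \<subseteq> Ar X" "c = br_ar \<Lambda> (p, p') us"
    unfolding Ar_T by blast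
  then show ?case by (intro Cons.prems(1)[of "us # uss" "p # qs" "p' # qs'"]) (use IH in auto)
qed

text \<open>Representatives are chosen by \<open>composable_br\<close> entry by entry, so that one
  list \<open>qs'\<close> provides both the target operations in \<open>cs\<close> and the source
  operations in \<open>ds\<close>.\<close>

lemma composables_T_cases:
  assumes X: "category X" and "length ds = length cs" "set cs \<subseteq> Ar (T \<Lambda> X)" "set ds \<subseteq> Ar (T \<Lambda> X)"
    "map (src (T \<Lambda> X)) ds = map (tgt (T \<Lambda> X)) cs"
  obtains qs qs' qs'' uss vss where "length uss = length cs" "map length vss = map length uss"
    "args (map length uss) qs" "args (map length uss) qs'" "args (map length uss) qs''"
    "\<And>us. us \<in> set uss \<Longrightarrow> set us \<subseteq> Ar X" "\<And>vs. vs \<in> set vss \<Longrightarrow> set vs \<subseteq> Ar X"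
    "map (map (src X)) vss = map (map (tgt X)) uss"
    "cs = map2 (br_ar \<Lambda>) (zip qs qs') uss" "ds = map2 (br_ar \<Lambda>) (zip qs' qs'') vss"
  using assms(2-)
proof (induction ds cs arbitrary: thesis rule: list_induct2)
  case Nil
  show ?case by (rule Nil(1)[of "[]" "[]" "[]" "[]" "[]"]) simp_all
next
  case (Cons d ds c cs)
  have "set cs \<subseteq> Ar (T \<Lambda> X)" "set ds \<subseteq> Ar (T \<Lambda> X)" "map (src (T \<Lambda> X)) ds = map (tgt (T \<Lambda> X)) cs"
    using Cons.prems by simp_all
  from Cons.IH[OF _ this] obtain qs qs' qs'' uss vss where
    IH: "length uss = length cs" "map length vss = map length uss"
    "args (map length uss) qs" "args (map length uss) qs'" "args (map length uss) qs''"
    "\<And>us. us \<in> set uss \<Longrightarrow> set us \<subseteq> Ar X" "\<And>vs. vs \<in> set vss \<Longrightarrow> set vs \<subseteq> Ar X"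
    "map (map (src X)) vss = map (map (tgt X)) uss"
    "cs = map2 (br_ar \<Lambda>) (zip qs qs') uss" "ds = map2 (br_ar \<Lambda>) (zip qs' qs'') vss"
    by blast
  have "c \<in> Ar (T \<Lambda> X)" "d \<in> Ar (T \<Lambda> X)" "src (T \<Lambda> X) d = tgt (T \<Lambda> X) c"
    using Cons.prems by simp_all
  with X obtain p p' p'' us vs where
    c: "p \<in> carrier (grp \<Lambda> (length us))" "p' \<in> carrier (grp \<Lambda> (length us))"
    "p'' \<in> carrier (grp \<Lambda> (length us))" "length vs = length us" "set us \<subseteq> Ar X" "set vs \<subseteq> Ar X"
    "map (src X) vs = map (tgt X) us" "c = br_ar \<Lambda> (p, p') us" "d = br_ar \<Lambda> (p', p'') vs"
    by (rule composable_br)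
  show ?case
    by (rule Cons.prems(1)[of "us # uss" "vs # vss" "p # qs" "p' # qs'" "p'' # qs''"]) (use IH c in auto)
qed

lemma map_src_tgt_brs:
  assumes "category X" "args (map length uss) qs" "args (map length uss) qs'"
    "\<And>us. us \<in> set uss \<Longrightarrow> set us \<subseteq> Ar X"
  shows "map (src (T \<Lambda> X)) (map2 (br_ar \<Lambda>) (zip qs qs') uss) = map2 (br_ob \<Lambda>) qs (map (map (src X)) uss)"
    "map (tgt (T \<Lambda> X)) (map2 (br_ar \<Lambda>) (zip qs qs') uss) = map2 (br_ob \<Lambda>) qs' (map (map (tgt X)) uss)"
  using assms by (auto intro!: nth_equalityI simp: args_iff src_tgt_br)

text \<open>On representatives, sources, targets, identities and composites are formed entrywise and
  so commute with concatenating the blocks; the operations are composed at each endpoint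
  separately.\<close>

lemma functor_T_mult:
  assumes X: "category X"
  shows "is_functor (T \<Lambda> (T \<Lambda> X)) (T \<Lambda> X) (T_mult \<Lambda>)"
proof (rule functor_from_T[OF category_T[OF X]], goal_cases)
  case (1 p cs)
  from 1(2) obtain qs xss where l: "length xss = length cs" and qs: "args (map length xss) qs"
    and xss: "\<And>xs. xs \<in> set xss \<Longrightarrow> set xs \<subseteq> Ob X" and cs: "cs = map2 (br_ob \<Lambda>) qs xss"
    by (rule obs_T_cases) blast
  have p: "p \<in> carrier (grp \<Lambda> (length xss))" using 1 l by simp
  have m: "amu \<Lambda> (map length xss) p qs \<in> carrier (grp \<Lambda> (length (concat xss)))"
    using amu_closed[of p "map length xss" qs] p qs by (simp add: length_concat)
  have s: "set (concat xss) \<subseteq> Ob X" using xss by auto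
  have k: "map length (map (map (ident X)) xss) = map length xss" by simp
  have "map (ident (T \<Lambda> X)) cs = map2 (br_ar \<Lambda>) (zip qs qs) (map (map (ident X)) xss)"
    unfolding cs using qs xss X by (auto intro!: nth_equalityI simp: args_iff ident_br)
  then have "far (T_mult \<Lambda>) (br_ar \<Lambda> (p, p) (map (ident (T \<Lambda> X)) cs)) =
      br_ar \<Lambda> (amu \<Lambda> (map length xss) p qs, amu \<Lambda> (map length xss) p qs) (map (ident X) (concat xss))"
    using far_T_mult[of p "map (map (ident X)) xss" p qs qs] p qs
    unfolding k map_concat length_map by simp
  then show ?case
    using ident_br[OF X m s] br_ob_in_T[OF m s] unfolding cs fob_T_mult[OF p qs] by simp
next
  case (2 p p' cs)
  from 2(3) obtain qs qs' uss where l: "length uss = length cs"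
    and qs: "args (map length uss) qs" "args (map length uss) qs'"
    and uss: "\<And>us. us \<in> set uss \<Longrightarrow> set us \<subseteq> Ar X" and cs: "cs = map2 (br_ar \<Lambda>) (zip qs qs') uss"
    by (rule ars_T_cases) blast
  have p: "p \<in> carrier (grp \<Lambda> (length uss))" "p' \<in> carrier (grp \<Lambda> (length uss))" using 2 l by simp_all
  have m: "amu \<Lambda> (map length uss) p qs \<in> carrier (grp \<Lambda> (length (concat uss)))"
    "amu \<Lambda> (map length uss) p' qs' \<in> carrier (grp \<Lambda> (length (concat uss)))"
    using amu_closed[of p "map length uss" qs] amu_closed[of p' "map length uss" qs'] p qs
    by (simp_all add: length_concat)
  have s: "set (concat uss) \<subseteq> Ar X" using uss by auto
  have k: "map length (map (map h) uss) = map length uss" for h :: "_ \<Rightarrow> 'a" by simp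
  have f: "fob (T_mult \<Lambda>) (br_ob \<Lambda> r (map2 (br_ob \<Lambda>) ss (map (map h) uss))) =
      br_ob \<Lambda> (amu \<Lambda> (map length uss) r ss) (map h (concat uss))"
    if "r \<in> carrier (grp \<Lambda> (length uss))" "args (map length uss) ss" for r ss and h :: "'b \<Rightarrow> 'a"
    using fob_T_mult[of r "map (map h) uss" ss] that unfolding k map_concat length_map by simp
  have c: "map (src (T \<Lambda> X)) cs = map2 (br_ob \<Lambda>) qs (map (map (src X)) uss)"
    "map (tgt (T \<Lambda> X)) cs = map2 (br_ob \<Lambda>) qs' (map (map (tgt X)) uss)"
    unfolding cs by (rule map_src_tgt_brs[OF X qs uss]; assumption)+
  have d: "far (T_mult \<Lambda>) (br_ar \<Lambda> (p, p') cs) =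
      br_ar \<Lambda> (amu \<Lambda> (map length uss) p qs, amu \<Lambda> (map length uss) p' qs') (concat uss)"
    unfolding cs by (rule far_T_mult[OF p qs])
  show ?case
    unfolding c d f[OF p(1) qs(1)] f[OF p(2) qs(2)] using src_tgt_br[OF X m s] br_ar_in_T[OF m s] by simp
next
  case (3 p p' p'' cs ds)
  from X 3(4-7) obtain qs qs' qs'' uss vss where l: "length uss = length cs" and k: "map length vss = map length uss"
    and qs: "args (map length uss) qs" "args (map length uss) qs'" "args (map length uss) qs''"
    and uss: "\<And>us. us \<in> set uss \<Longrightarrow> set us \<subseteq> Ar X" and vss: "\<And>vs. vs \<in> set vss \<Longrightarrow> set vs \<subseteq> Ar X"
    and e: "map (map (src X)) vss = map (map (tgt X)) uss"
    and cs: "cs = map2 (br_ar \<Lambda>) (zip qs qs') uss" and ds: "ds = map2 (br_ar \<Lambda>) (zip qs' qs'') vss"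
    by (rule composables_T_cases) blast
  have lv: "length vss = length uss" using k by (rule map_eq_imp_length_eq)
  have p: "p \<in> carrier (grp \<Lambda> (length uss))" "p' \<in> carrier (grp \<Lambda> (length uss))"
    "p'' \<in> carrier (grp \<Lambda> (length uss))" using 3 l by simp_all
  let ?wss = "map2 (map2 (cmp X)) vss uss"
  have N: "sum_list (map length uss) = length (concat uss)" by (simp add: length_concat)
  have m: "amu \<Lambda> (map length uss) p qs \<in> carrier (grp \<Lambda> (length (concat uss)))"
    "amu \<Lambda> (map length uss) p' qs' \<in> carrier (grp \<Lambda> (length (concat uss)))"
    "amu \<Lambda> (map length uss) p'' qs'' \<in> carrier (grp \<Lambda> (length (concat uss)))"
    using amu_closed[of _ "map length uss"] p qs N by simp_all
  have s: "set (concat uss) \<subseteq> Ar X" "set (concat vss) \<subseteq> Ar X" using uss vss by auto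
  have lc: "length (concat vss) = length (concat uss)" using k by (simp add: length_concat)
  have ec: "map (src X) (concat vss) = map (tgt X) (concat uss)" using e by (simp add: map_concat)
  have nth: "length (vss ! i) = length (uss ! i)" "map (src X) (vss ! i) = map (tgt X) (uss ! i)"
    if "i < length uss" for i
    using that lv k e by (metis nth_map)+
  have wk: "map length ?wss = map length uss"
    using lv nth by (auto intro!: nth_equalityI)
  \<comment> \<open>Corresponding blocks have equal lengths, so composing blockwise and composing
    the concatenations agree.\<close>
  have wc: "concat ?wss = map2 (cmp X) (concat vss) (concat uss)"
    using lv k by (induction vss uss rule: list_induct2) simp_all
  \<comment> \<open>Sharing the operations \<open>qs'\<close> lets each pair of brackets be composed
    on its representatives.\<close>
  have "map2 (cmp (T \<Lambda> X)) ds cs = map2 (br_ar \<Lambda>) (zip qs qs'') ?wss"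
  proof (rule nth_equalityI)
    fix i assume "i < length (map2 (cmp (T \<Lambda> X)) ds cs)"
    then have i: "i < length uss" "i < length cs" "i < length ds" using l by simp_all
    have li: "i < length qs" "i < length qs'" "i < length qs''" "i < length vss"
      using i qs lv by (simp_all add: args_iff)
    have q: "qs ! i \<in> carrier (grp \<Lambda> (length (uss ! i)))" "qs' ! i \<in> carrier (grp \<Lambda> (length (uss ! i)))"
      "qs'' ! i \<in> carrier (grp \<Lambda> (length (uss ! i)))" using i qs by (simp_all add: args_iff)
    have "cmp (T \<Lambda> X) (br_ar \<Lambda> (qs' ! i, qs'' ! i) (vss ! i)) (br_ar \<Lambda> (qs ! i, qs' ! i) (uss ! i)) =
      br_ar \<Lambda> (qs ! i, qs'' ! i) (map2 (cmp X) (vss ! i) (uss ! i))"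
      by (rule cmp_br[OF X]) (use i li nth q uss vss in simp_all)
    then show "map2 (cmp (T \<Lambda> X)) ds cs ! i = map2 (br_ar \<Lambda>) (zip qs qs'') ?wss ! i"
      using i li by (simp add: cs ds)
  qed (use l lv qs in \<open>simp add: cs ds args_iff\<close>)
  then have f: "far (T_mult \<Lambda>) (br_ar \<Lambda> (p, p'') (map2 (cmp (T \<Lambda> X)) ds cs)) =
      br_ar \<Lambda> (amu \<Lambda> (map length uss) p qs, amu \<Lambda> (map length uss) p'' qs'') (map2 (cmp X) (concat vss) (concat uss))"
    using far_T_mult[of p ?wss p'' qs qs''] p qs lv unfolding wk wc by simp
  have g: "far (T_mult \<Lambda>) (br_ar \<Lambda> (p', p'') ds) =
      br_ar \<Lambda> (amu \<Lambda> (map length uss) p' qs', amu \<Lambda> (map length uss) p'' qs'') (concat vss)"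
    using far_T_mult[of p' vss p'' qs' qs''] p qs lv unfolding k ds by simp
  have h: "far (T_mult \<Lambda>) (br_ar \<Lambda> (p, p') cs) =
      br_ar \<Lambda> (amu \<Lambda> (map length uss) p qs, amu \<Lambda> (map length uss) p' qs') (concat uss)"
    unfolding cs by (rule far_T_mult[OF p(1,2) qs(1,2)])
  show ?case
    unfolding f g h by (rule cmp_br[OF X lc m s ec, symmetric])
qed

subsection \<open>Pullbacks\<close>

text \<open>\<open>T_map\<close> keeps the group element of a normal form and applies the functor to
  its list. A matching pair therefore has a common group element and two lists with the same image,
  to which \<open>list_pullback\<close> applies.\<close>

lemma T_preserves_pullback:
  fixes P :: "('po, 'pm) cat" and A :: "('ao, 'am) cat" and B :: "('bo, 'bm) cat" and C :: "('co, 'cm) cat"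
  assumes pb: "two_pullback TYPE((nat, nat) cat) P A B C p q f g"
  shows "two_pullback TYPE(('w, 'v) cat) (T \<Lambda> P) (T \<Lambda> A) (T \<Lambda> B) (T \<Lambda> C)
    (T_map p) (T_map q) (T_map f) (T_map g)"
proof -
  have sq: "commuting_square P A B C p q f g" using pb by (simp add: two_pullback_def)
  then have cat: "category P" "category A" "category B" "category C"
    and fn: "is_functor P A p" "is_functor P B q" "is_functor A C f" "is_functor B C g"
    and comm: "\<And>u. u \<in> Ar P \<Longrightarrow> far f (far p u) = far g (far q u)"
    by (auto simp: commuting_square_def feq_def)
  \<comment> \<open>Test categories in \<open>nat\<close> include the walking arrow, so the
    hypothesis already gives a pullback of sets of arrows.\<close>
  have pw: "\<exists>!w. w \<in> Ar P \<and> far p w = u \<and> far q w = v"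
    if "u \<in> Ar A" "v \<in> Ar B" "far f u = far g v" for u v
    using pointwise_of_nat[OF sq] pb that unfolding two_pullback_def pointwise_pullback_def by blast
  note T_cat = cat[THEN category_T]
  note T_fn = functor_T_map[OF cat(1,2) fn(1)] functor_T_map[OF cat(1,3) fn(2)]
    functor_T_map[OF cat(2,4) fn(3)] functor_T_map[OF cat(3,4) fn(4)]
  show ?thesis
  proof (rule two_pullback_of_arrows)
    have "feq (T \<Lambda> P) (T_map f \<circ>\<circ> T_map p) (T_map g \<circ>\<circ> T_map q)"
    proof (rule feq_of_arrows[OF T_cat(1) functor_fcomp[OF T_fn(1,3)] functor_fcomp[OF T_fn(2,4)] T_cat(4)])
      fix u :: "('l, 'pm) tar" assume "u \<in> Ar (T \<Lambda> P)"
      then obtain a us where a: "a \<in> carrier (grp \<Lambda> (length us))" and us: "set us \<subseteq> Ar P" and u: "u = nar a us"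
        by (rule Ar_T_cases)
      have "map (far f) (map (far p) us) = map (far g) (map (far q) us)" using us comm by auto
      then show "far (T_map f \<circ>\<circ> T_map p) u = far (T_map g \<circ>\<circ> T_map q) u"
        unfolding fcomp_sel o_def u using a by (simp only: far_T_map_nar length_map)
    qed
    then show "commuting_square (T \<Lambda> P) (T \<Lambda> A) (T \<Lambda> B) (T \<Lambda> C) (T_map p) (T_map q) (T_map f) (T_map g)"
      unfolding commuting_square_def using T_cat T_fn by blast
  next
    fix u :: "('l, 'am) tar" and v :: "('l, 'bm) tar"
    assume "u \<in> Ar (T \<Lambda> A)"
    then obtain a us where a: "a \<in> carrier (grp \<Lambda> (length us))" and us: "set us \<subseteq> Ar A" and u: "u = nar a us"
      by (rule Ar_T_cases)
    assume "v \<in> Ar (T \<Lambda> B)"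
    then obtain b vs where b: "b \<in> carrier (grp \<Lambda> (length vs))" and vs: "set vs \<subseteq> Ar B" and v: "v = nar b vs"
      by (rule Ar_T_cases)
    assume "far (T_map f) u = far (T_map g) v"
    then have "nar a (map (far f) us) = nar b (map (far g) vs)"
      unfolding u v far_T_map_nar[OF a] far_T_map_nar[OF b] .
    then have ab: "b = a" and e: "map (far f) us = map (far g) vs"
      using nar_eq_iff[of a "map (far f) us" b "map (far g) vs"] a b by simp_all
    have "\<exists>!ws. set ws \<subseteq> Ar P \<and> map (far p) ws = us \<and> map (far q) ws = vs"
      using pw us vs e by (rule list_pullback)
    then obtain ws where ws: "set ws \<subseteq> Ar P" "map (far p) ws = us" "map (far q) ws = vs"
      and uniq: "\<And>ws'. set ws' \<subseteq> Ar P \<Longrightarrow> map (far p) ws' = us \<Longrightarrow> map (far q) ws' = vs \<Longrightarrow> ws' = ws"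
      by blast
    have aw: "a \<in> carrier (grp \<Lambda> (length ws))" using a ws(2) by auto
    show "\<exists>!w. w \<in> Ar (T \<Lambda> P) \<and> far (T_map p) w = u \<and> far (T_map q) w = v"
    proof (rule ex1I[of _ "nar a ws"])
      show "nar a ws \<in> Ar (T \<Lambda> P) \<and> far (T_map p) (nar a ws) = u \<and> far (T_map q) (nar a ws) = v"
        using nar_in_T[OF aw ws(1)] unfolding far_T_map_nar[OF aw] ws(2,3) u v ab by blast
      fix w assume w: "w \<in> Ar (T \<Lambda> P) \<and> far (T_map p) w = u \<and> far (T_map q) w = v"
      then obtain c ws' where c: "c \<in> carrier (grp \<Lambda> (length ws'))" and ws': "set ws' \<subseteq> Ar P" and weq: "w = nar c ws'"
        by (blast elim: Ar_T_cases)
      have "nar c (map (far p) ws') = nar a us" "nar c (map (far q) ws') = nar b vs"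
        using w unfolding weq far_T_map_nar[OF c] u v by blast+
      then have "c = a" "map (far p) ws' = us" "map (far q) ws' = vs"
        using nar_eq_iff[of c "map (far p) ws'" a us] nar_eq_iff[of c "map (far q) ws'" b vs] a b c by simp_all
      then show "w = nar a ws" using uniq[OF ws'] weq by simp
    qed
  qed
qed

text \<open>The image of \<open>v\<close> under the unit consists of the group unit and a list of
  length one. As \<open>T_map f\<close> preserves the group element and the length, a matching arrow
  \<open>u\<close> has the same shape, and its single entry is the filler.\<close>

lemma T_unit_cartesian:
  fixes X :: "('xo, 'xm) cat" and Y :: "('yo, 'ym) cat"
  assumes X: "category X" and Y: "category Y" and f: "is_functor X Y f"
  shows "two_pullback TYPE(('w, 'v) cat) X (T \<Lambda> X) Y (T \<Lambda> Y) (T_unit \<Lambda>) f (T_map f) (T_unit \<Lambda>)"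
proof (rule two_pullback_of_arrows)
  let ?eX = "T_unit \<Lambda> :: ('xo, 'xm, ('l, 'xo) tob, ('l, 'xm) tar) ftor"
  let ?eY = "T_unit \<Lambda> :: ('yo, 'ym, ('l, 'yo) tob, ('l, 'ym) tar) ftor"
  have o: "\<one>\<^bsub>grp \<Lambda> (Suc 0)\<^esub> \<in> carrier (grp \<Lambda> (length [u]))" for u :: 'z by simp
  have "feq X (T_map f \<circ>\<circ> T_unit \<Lambda>) (T_unit \<Lambda> \<circ>\<circ> f)"
    by (rule feq_of_arrows[OF X functor_fcomp[OF functor_T_unit[OF X] functor_T_map[OF X Y f]]
          functor_fcomp[OF f functor_T_unit[OF Y]] category_T[OF Y]])
      (simp add: far_T_unit far_T_map_nar)
  then show "commuting_square X (T \<Lambda> X) Y (T \<Lambda> Y) (T_unit \<Lambda>) f (T_map f) (T_unit \<Lambda>)"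
    unfolding commuting_square_def
    using X Y f category_T[OF X] category_T[OF Y] functor_T_unit[OF X] functor_T_unit[OF Y] functor_T_map[OF X Y f]
    by blast
  fix u :: "('l, 'xm) tar" and v :: 'ym
  assume "u \<in> Ar (T \<Lambda> X)"
  then obtain a us where a: "a \<in> carrier (grp \<Lambda> (length us))" and us: "set us \<subseteq> Ar X" and u: "u = nar a us"
    by (rule Ar_T_cases)
  assume v: "v \<in> Ar Y" and "far (T_map f) u = far ?eY v"
  then have "nar a (map (far f) us) = nar \<one>\<^bsub>grp \<Lambda> (Suc 0)\<^esub> [v]"
    unfolding u far_T_map_nar[OF a] far_T_unit by blast
  then have a1: "a = \<one>\<^bsub>grp \<Lambda> (Suc 0)\<^esub>" and "map (far f) us = [v]"
    using nar_eq_iff[of a "map (far f) us" _ "[v]"] a o by simp_all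
  then obtain w where w: "us = [w]" "far f w = v" by auto
  show "\<exists>!w. w \<in> Ar X \<and> far ?eX w = u \<and> far f w = v"
  proof (rule ex1I[of _ w])
    show "w \<in> Ar X \<and> far ?eX w = u \<and> far f w = v"
      using us unfolding far_T_unit u a1 w by simp
    fix w' assume "w' \<in> Ar X \<and> far ?eX w' = u \<and> far f w' = v"
    then have "nar \<one>\<^bsub>grp \<Lambda> (Suc 0)\<^esub> [w'] = nar \<one>\<^bsub>grp \<Lambda> (Suc 0)\<^esub> [w]"
      unfolding far_T_unit u a1 w by blast
    then show "w' = w" using nar_eq_iff[OF o o, of w' w] by simp
  qed
qed

section \<open>Two-layer normal forms in \<open>T \<Lambda> (T \<Lambda> X)\<close> and the squares
  of the multiplication\<close>

lemma nars_T_cases: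
  assumes "set cs \<subseteq> Ar (T \<Lambda> X)"
  obtains hs uss where "length uss = length cs" "args (map length uss) hs"
    "\<And>us. us \<in> set uss \<Longrightarrow> set us \<subseteq> Ar X" "cs = map2 nar hs uss"
  using assms
proof (induction cs arbitrary: thesis)
  case Nil
  show ?case by (rule Nil(1)[of "[]" "[]"]) simp_all
next
  case (Cons c cs)
  have "set cs \<subseteq> Ar (T \<Lambda> X)" using Cons.prems(2) by simp
  from Cons.IH[OF _ this] obtain hs uss where IH: "length uss = length cs" "args (map length uss) hs"
    "\<And>us. us \<in> set uss \<Longrightarrow> set us \<subseteq> Ar X" "cs = map2 nar hs uss"
    by blast
  have "c \<in> Ar (T \<Lambda> X)" using Cons.prems(2) by simp
  then obtain h us where "h \<in> carrier (grp \<Lambda> (length us))" "set us \<subseteq> Ar X" "c = nar h us"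
    by (rule Ar_T_cases)
  then show ?case by (intro Cons.prems(1)[of "us # uss" "h # hs"]) (use IH in auto)
qed

lemma Ar_TT_cases:
  assumes "u \<in> Ar (T \<Lambda> (T \<Lambda> X))"
  obtains g hs uss where "g \<in> carrier (grp \<Lambda> (length uss))" "args (map length uss) hs"
    "\<And>us. us \<in> set uss \<Longrightarrow> set us \<subseteq> Ar X" "u = nar g (map2 nar hs uss)"
proof -
  obtain g cs where g: "g \<in> carrier (grp \<Lambda> (length cs))" and cs: "set cs \<subseteq> Ar (T \<Lambda> X)" and u: "u = nar g cs"
    using assms by (rule Ar_T_cases)
  from cs obtain hs uss where l: "length uss = length cs" and hs: "args (map length uss) hs"
    and uss: "\<And>us. us \<in> set uss \<Longrightarrow> set us \<subseteq> Ar X" and c: "cs = map2 nar hs uss"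
    by (rule nars_T_cases) blast
  show thesis using g unfolding l[symmetric] by (rule that) (fact hs, erule uss, simp only: u c)
qed

text \<open>The inner data can be read off the list of inner arrows, which makes two-layer normal
  forms unique.\<close>

lemma nf_nars:
  assumes "args (map length uss) hs"
  shows "map (fst \<circ> nf_ar) (map2 nar hs uss) = hs" "map (snd \<circ> nf_ar) (map2 nar hs uss) = uss"
  using assms by (auto intro!: nth_equalityI simp: args_iff nf_ar_nar)

lemma far_T_map_T_map:
  assumes "g \<in> carrier (grp \<Lambda> (length uss))" and hs: "args (map length uss) hs"
  shows "far (T_map (T_map F)) (nar g (map2 nar hs uss)) = nar g (map2 nar hs (map (map (far F)) uss))"
proof -
  have l: "length (map2 nar hs uss) = length uss" using args_length[OF hs] by simp
  have "map (far (T_map F)) (map2 nar hs uss) = map2 nar hs (map (map (far F)) uss)"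
    using hs by (auto intro!: nth_equalityI simp: args_iff far_T_map_nar)
  then show ?thesis using assms(1) far_T_map_nar[of g "map2 nar hs uss" "T_map F"] unfolding l by simp
qed

text \<open>The arrow \<open>v\<close> supplies the operations of both layers and the block lengths,
  while \<open>u\<close> supplies the arrows of \<open>X\<close>. Agreement in
  \<open>T \<Lambda> Y\<close> says that the group element of \<open>u\<close> is the composite of
  these operations and that its list lies over the concatenated blocks.\<close>

lemma T_mult_cartesian:
  fixes X :: "('xo, 'xm) cat" and Y :: "('yo, 'ym) cat"
  assumes X: "category X" and Y: "category Y" and f: "is_functor X Y f"
  shows "two_pullback TYPE(('w, 'v) cat) (T \<Lambda> (T \<Lambda> X)) (T \<Lambda> X) (T \<Lambda> (T \<Lambda> Y)) (T \<Lambda> Y)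
    (T_mult \<Lambda>) (T_map (T_map f)) (T_map f) (T_mult \<Lambda>)"
proof (rule two_pullback_of_arrows)
  let ?mX = "T_mult \<Lambda> :: (('l, ('l, 'xo) tob) tob, ('l, ('l, 'xm) tar) tar, ('l, 'xo) tob, ('l, 'xm) tar) ftor"
  let ?mY = "T_mult \<Lambda> :: (('l, ('l, 'yo) tob) tob, ('l, ('l, 'ym) tar) tar, ('l, 'yo) tob, ('l, 'ym) tar) ftor"
  note TX = category_T[OF X] and TY = category_T[OF Y]
  note Tf = functor_T_map[OF X Y f] and TTf = functor_T_map[OF TX TY functor_T_map[OF X Y f]]
  have k: "map length (map (map (far f)) uss) = map length uss" for uss by simp
  have "feq (T \<Lambda> (T \<Lambda> X)) (T_map f \<circ>\<circ> T_mult \<Lambda>) (T_mult \<Lambda> \<circ>\<circ> T_map (T_map f))"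
  proof (rule feq_of_arrows[OF category_T[OF TX] functor_fcomp[OF functor_T_mult[OF X] Tf]
        functor_fcomp[OF TTf functor_T_mult[OF Y]] TY])
    fix u :: "('l, ('l, 'xm) tar) tar" assume "u \<in> Ar (T \<Lambda> (T \<Lambda> X))"
    then obtain g hs uss where g: "g \<in> carrier (grp \<Lambda> (length uss))" and hs: "args (map length uss) hs"
      and u: "u = nar g (map2 nar hs uss)" by (rule Ar_TT_cases)
    have m: "amu \<Lambda> (map length uss) g hs \<in> carrier (grp \<Lambda> (length (concat uss)))"
      using amu_closed[of g "map length uss" hs] g hs by (simp add: length_concat)
    have g': "g \<in> carrier (grp \<Lambda> (length (map (map (far f)) uss)))" using g by simp
    have hs': "args (map length (map (map (far f)) uss)) hs" using hs unfolding k .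
    show "far (T_map f \<circ>\<circ> T_mult \<Lambda>) u = far (T_mult \<Lambda> \<circ>\<circ> T_map (T_map f)) u"
      unfolding fcomp_sel o_apply u far_T_map_T_map[OF g hs] far_T_mult_nar[OF g hs] far_T_map_nar[OF m]
        far_T_mult_nar[OF g' hs'] k map_concat ..
  qed
  then show "commuting_square (T \<Lambda> (T \<Lambda> X)) (T \<Lambda> X) (T \<Lambda> (T \<Lambda> Y)) (T \<Lambda> Y)
      (T_mult \<Lambda>) (T_map (T_map f)) (T_map f) (T_mult \<Lambda>)"
    unfolding commuting_square_def
    using TX TY category_T[OF TX] category_T[OF TY] Tf TTf functor_T_mult[OF X] functor_T_mult[OF Y] by blast
  fix u :: "('l, 'xm) tar" and v :: "('l, ('l, 'ym) tar) tar"
  assume "u \<in> Ar (T \<Lambda> X)"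
  then obtain a us where a: "a \<in> carrier (grp \<Lambda> (length us))" and us: "set us \<subseteq> Ar X" and u: "u = nar a us"
    by (rule Ar_T_cases)
  assume "v \<in> Ar (T \<Lambda> (T \<Lambda> Y))"
  then obtain g hs vss where g: "g \<in> carrier (grp \<Lambda> (length vss))" and hs: "args (map length vss) hs"
    and v: "v = nar g (map2 nar hs vss)" by (rule Ar_TT_cases)
  have m: "amu \<Lambda> (map length vss) g hs \<in> carrier (grp \<Lambda> (length (concat vss)))"
    using amu_closed[of g "map length vss" hs] g hs by (simp add: length_concat)
  assume "far (T_map f) u = far ?mY v"
  then have "nar a (map (far f) us) = nar (amu \<Lambda> (map length vss) g hs) (concat vss)"
    unfolding u v far_T_map_nar[OF a] far_T_mult_nar[OF g hs] .
  then have aeq: "a = amu \<Lambda> (map length vss) g hs" and "map (far f) us = concat vss"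
    using nar_eq_iff[OF _ m, of a "map (far f) us"] a by simp_all
  \<comment> \<open>The list in \<open>X\<close> is cut into blocks over those of \<open>v\<close>;
    with the operations of \<open>v\<close> it forms the filler.\<close>
  then obtain uss where uss: "us = concat uss" "map (map (far f)) uss = vss" by (blast elim: map_eq_concat)
  have ku: "map length vss = map length uss" using uss(2) k by blast
  have lu: "length vss = length uss" using uss(2) by auto
  have gu: "g \<in> carrier (grp \<Lambda> (length uss))" and hu: "args (map length uss) hs"
    using g hs unfolding lu ku .
  show "\<exists>!w. w \<in> Ar (T \<Lambda> (T \<Lambda> X)) \<and> far ?mX w = u \<and> far (T_map (T_map f)) w = v"
  proof (rule ex1I[of _ "nar g (map2 nar hs uss)"])
    have "set (map2 nar hs uss) \<subseteq> Ar (T \<Lambda> X)"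
    proof
      fix c assume "c \<in> set (map2 nar hs uss)"
      then obtain i where i: "i < length uss" "c = nar (hs ! i) (uss ! i)"
        using args_length[OF hu] by (auto simp: in_set_conv_nth)
      have "set (uss ! i) \<subseteq> Ar X" using us i(1) unfolding uss(1) by (auto dest: nth_mem)
      then show "c \<in> Ar (T \<Lambda> X)" unfolding i(2) using hu i(1) by (intro nar_in_T) (auto simp: args_iff)
    qed
    then have "nar g (map2 nar hs uss) \<in> Ar (T \<Lambda> (T \<Lambda> X))"
      using gu args_length[OF hu] by (intro nar_in_T) simp_all
    then show "nar g (map2 nar hs uss) \<in> Ar (T \<Lambda> (T \<Lambda> X)) \<and> far ?mX (nar g (map2 nar hs uss)) = u \<and>
        far (T_map (T_map f)) (nar g (map2 nar hs uss)) = v"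
      unfolding far_T_mult_nar[OF gu hu] far_T_map_T_map[OF gu hu] u v aeq uss ku by blast
    fix w assume w: "w \<in> Ar (T \<Lambda> (T \<Lambda> X)) \<and> far ?mX w = u \<and> far (T_map (T_map f)) w = v"
    then obtain g' hs' wss where g': "g' \<in> carrier (grp \<Lambda> (length wss))" and hs': "args (map length wss) hs'"
      and weq: "w = nar g' (map2 nar hs' wss)" by (blast elim: Ar_TT_cases)
    have m': "amu \<Lambda> (map length wss) g' hs' \<in> carrier (grp \<Lambda> (length (concat wss)))"
      using amu_closed[of g' "map length wss" hs'] g' hs' by (simp add: length_concat)
    \<comment> \<open>The multiplication determines the concatenated list of a competing
      arrow.\<close>
    have "nar (amu \<Lambda> (map length wss) g' hs') (concat wss) = nar a us"
      using w unfolding weq far_T_mult_nar[OF g' hs'] u by blast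
    then have c: "concat wss = concat uss" using nar_eq_iff[OF m' a] uss(1) by simp
    have hm: "args (map length (map (map (far f)) wss)) hs'" using hs' unfolding k .
    \<comment> \<open>The image in \<open>T \<Lambda> (T \<Lambda> Y)\<close> determines the
      operations of the competing arrow and the images of its blocks, in particular their
      lengths.\<close>
    have "nar g' (map2 nar hs' (map (map (far f)) wss)) = nar g (map2 nar hs vss)"
      using w unfolding weq far_T_map_T_map[OF g' hs'] v by blast
    then have gg: "g' = g" and e: "map2 nar hs' (map (map (far f)) wss) = map2 nar hs vss"
      using nar_eq_iff[of g' "map2 nar hs' (map (map (far f)) wss)" g "map2 nar hs vss"]
        g g' args_length[OF hs] args_length[OF hs'] by simp_all
    have "hs' = hs" "map (map (far f)) wss = vss"
      using nf_nars[OF hm] nf_nars[OF hs] unfolding e by simp_all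
    \<comment> \<open>Equal concatenations with equal block lengths have equal blocks.\<close>
    moreover from this have "wss = uss" using concat_unique[OF c] k[of wss] ku by simp
    ultimately show "w = nar g (map2 nar hs uss)" unfolding weq gg by simp
  qed
qed

end

theorem corollary14p10:
  fixes \<Lambda> :: "'l action_operad_data"
  assumes "action_operad \<Lambda>"
  shows
    "(\<forall>(P :: ('po, 'pm) cat) (A :: ('ao, 'am) cat) (B :: ('bo, 'bm) cat) (C :: ('co, 'cm) cat) p q f g.
        two_pullback TYPE((nat, nat) cat) P A B C p q f g \<longrightarrow>
        two_pullback TYPE(('w, 'v) cat) (T \<Lambda> P) (T \<Lambda> A) (T \<Lambda> B) (T \<Lambda> C)
          (T_map p) (T_map q) (T_map f) (T_map g)) \<and>
     (\<forall>(X :: ('xo, 'xm) cat) (Y :: ('yo, 'ym) cat) f.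
        category X \<and> category Y \<and> is_functor X Y f \<longrightarrow>
        two_pullback TYPE(('w, 'v) cat) X (T \<Lambda> X) Y (T \<Lambda> Y)
          (T_unit \<Lambda>) f (T_map f) (T_unit \<Lambda>)) \<and>
     (\<forall>(X :: ('xo, 'xm) cat) (Y :: ('yo, 'ym) cat) f.
        category X \<and> category Y \<and> is_functor X Y f \<longrightarrow>
        two_pullback TYPE(('w, 'v) cat) (T \<Lambda> (T \<Lambda> X)) (T \<Lambda> X) (T \<Lambda> (T \<Lambda> Y)) (T \<Lambda> Y)
          (T_mult \<Lambda>) (T_map (T_map f)) (T_map f) (T_mult \<Lambda>))"
proof -
  interpret act_op \<Lambda> using assms by (rule act_op.intro)
  show ?thesis
    using T_preserves_pullback T_unit_cartesian T_mult_cartesian by blast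
qed

end
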